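(* Let $n\ge 1$, $\alpha\in\mathbf R$, $\beta,\gamma>0$, $1\le p,q<\infty$ and $0<m\le 1$. Then the following are equivalent: (i) $P_{\beta m}$ extends to a bounded operator from $L^p_{\alpha m}$ into $L^q_{\gamma m}$; (ii) either $q<q_{\max}$, or $q=q_{\max}\ge p$, where $q_{\max}=q_{\max}(\alpha,\beta,\gamma,p):=\frac{4\gamma}{\beta^2}\left(\beta-\frac{\alpha}{p}\right)$.
   Context: For $\alpha\in\mathbf R$, $m>0$ let $d\mu_{\alpha m}(z)=e^{-\alpha|z|^{2m}}\,dz$ on $\mathbf C^n$ ($dz$ Lebesgue measure, $|z|$ the Euclidean norm), and $L^p_{\alpha m}=L^p(\mathbf C^n,d\mu_{\alpha m})$. For $\beta>0$, $H^2_{\beta m}$ is the closed subspace of entire functions in $L^2_{\beta m}$; its reproducing kernel is $K_{\beta m}(x,y)=\frac{m\beta^{n/m}}{\pi^n}\sum_{k=0}^\infty \frac{(\beta^{1/m}\langle x,y\rangle)^k}{k!}\frac{\Gamma(n+k)}{\Gamma(\frac{n+k}{m})}$, and $P_{\beta m}f(x)=\int_{\mathbf C^n} f(y)K_{\beta m}(x,y)\,d\mu_{\beta m}(y)$ is the orthogonal projection of $L^2_{\beta m}$ onto $H^2_{\beta m}$. "$P_{\beta m}$ is bounded from $L^p_{\alpha m}$ into $L^q_{\gamma m}$" means that $P_{\beta m}$, defined by this integral on $L^2_{\beta m}\cap L^p_{\alpha m}$, extends by continuity to a bounded operator $L^p_{\alpha m}\to L^q_{\gamma m}$. *)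

theory Defs
  imports "HOL-Analysis.Analysis"
begin

definition cinner :: "complex ^ 'n \<Rightarrow> complex ^ 'n \<Rightarrow> complex" where
  "cinner x y = (\<Sum>i\<in>UNIV. x $ i * cnj (y $ i))"

definition mu :: "real \<Rightarrow> real \<Rightarrow> (complex ^ 'n::finite) measure" where
  "mu a m = density lebesgue (\<lambda>z. ennreal (exp (- a * norm z powr (2 * m))))"

definition in_Lp :: "('a \<Rightarrow> complex) \<Rightarrow> 'a measure \<Rightarrow> real \<Rightarrow> bool" where
  "in_Lp f M p \<longleftrightarrow> f \<in> borel_measurable M \<and> integrable M (\<lambda>x. norm (f x) powr p)"

definition Lp_norm :: "('a \<Rightarrow> complex) \<Rightarrow> 'a measure \<Rightarrow> real \<Rightarrow> real" where
  "Lp_norm f M p = (\<integral>x. norm (f x) powr p \<partial>M) powr (1 / p)"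

text \<open>Reproducing kernel K_{beta m} of H^2_{beta m}.\<close>
definition kernel :: "real \<Rightarrow> real \<Rightarrow> complex ^ 'n::finite \<Rightarrow> complex ^ 'n \<Rightarrow> complex" where
  "kernel b m x y =
     complex_of_real (m * b powr (real CARD('n) / m) / pi ^ CARD('n)) *
     (\<Sum>k. (complex_of_real (b powr (1 / m)) * cinner x y) ^ k / of_nat (fact k) *
            complex_of_real (Gamma (real (CARD('n) + k)) / Gamma (real (CARD('n) + k) / m)))"

definition proj :: "real \<Rightarrow> real \<Rightarrow> (complex ^ 'n::finite \<Rightarrow> complex) \<Rightarrow> complex ^ 'n \<Rightarrow> complex" where
  "proj b m f x = (\<integral>y. f y * kernel b m x y \<partial>(mu b m))"

text \<open>P_{beta m} extends (by continuity, from L^2_beta \<inter> L^p_alpha) to a bounded operator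
  L^p_alpha \<rightarrow> L^q_gamma: a uniform norm bound on the dense subspace L^2_beta \<inter> L^p_alpha.\<close>
definition proj_bounded :: "real \<Rightarrow> real \<Rightarrow> real \<Rightarrow> real \<Rightarrow> real \<Rightarrow> real \<Rightarrow> 'n::finite itself \<Rightarrow> bool" where
  "proj_bounded b m a p g q (_::'n itself) \<longleftrightarrow>
     (\<exists>C. \<forall>f :: complex ^ 'n \<Rightarrow> complex.
        in_Lp f (mu b m) 2 \<and> in_Lp f (mu a m) p \<longrightarrow>
          in_Lp (proj b m f) (mu g m) q \<and>
          Lp_norm (proj b m f) (mu g m) q \<le> C * Lp_norm f (mu a m) p)"

definition qmax :: "real \<Rightarrow> real \<Rightarrow> real \<Rightarrow> real \<Rightarrow> real" where
  "qmax a b g p = 4 * g / b\<^sup>2 * (b - a / p)"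

end

theory Submission
  imports Defs
begin

text \<open>
  Put \<open>A = b - a / p\<close> and \<open>B = g / q\<close>, so that \<open>q \<le> q\<^sub>m\<^sub>a\<^sub>x\<close> means \<open>b\<^sup>2 \<le> 4 A B\<close>. The kernel is
  \<open>F(b\<^sup>1\<^sup>/\<^sup>m \<langle>x, y\<rangle>)\<close> up to a constant, with \<open>F(t) = \<Sum> c\<^sub>k t\<^sup>k\<close>, and \<open>\<bar>F(t)\<bar> \<le> C exp \<bar>t\<bar>\<^sup>m\<close>.
  For \<open>b\<^sup>2 < 4 A B\<close> the weighted kernel therefore decays exponentially in both variables. For
  \<open>b\<^sup>2 = 4 A B\<close> it is bounded, and it passes Schur's test, which yields \<open>L\<^sup>p\<close> to \<open>L\<^sup>q\<close> bounds for
  \<open>p \<le> q\<close>. Schur's test needs the decay of \<open>F\<close> in the angle: \<open>(1 - t / \<bar>t\<bar>)\<^sup>2 F(t)\<close> is estimated by the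
  second differences of \<open>c\<^sub>k \<bar>t\<bar>\<^sup>k\<close>, so no asymptotics of \<open>F\<close> in sectors are required. The angular mean of
  \<open>\<bar>F\<bar>\<close> is then dominated by power series in \<open>\<bar>\<langle>x, y\<rangle>\<bar>\<close>, which are integrated termwise using the exact
  moments of \<open>\<bar>\<langle>x, y\<rangle>\<bar>\<close> on the unit ball.

  Conversely, truncations of \<open>y\<^sub>i\<^sup>k exp ((a / p - c) \<bar>y\<bar>\<^sup>2\<^sup>m)\<close> are mapped to multiples of \<open>x\<^sub>i\<^sup>k\<close>. By Stirling's
  formula, boundedness forces \<open>\<rho>\<^sup>k\<^sup>/\<^sup>2\<^sup>m k\<^sup>s\<close> to stay bounded as \<open>k\<close> grows, where
  \<open>\<rho> = b\<^sup>2 c q / ((A + c)\<^sup>2 g)\<close> and \<open>s\<close> is a positive multiple of \<open>1 / q - 1 / p\<close>; the optimal choice is \<open>c = A\<close>.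
\<close>

subsection \<open>Gamma function estimates\<close>

text \<open>At \<open>b^2 = 4 A B\<close> the estimate |F(t)| <= C exp |t|^m leaves only the
  majorant exp (-(sqrt A |y|^m - sqrt B |x|^m)^2). It is bounded but constant on spheres, so its
  integral over y grows like |x|^(2n - m), and Schur's test fails for it. Two concentrations of the
  true kernel have to make up for this power: <x, y> is small for most y, which is the decay j^(-n)
  of the moments of order j on the ball, and F lives near the positive axis. For the latter, the
  terms c_k s^k with s = |t| sit at k of order s^m, so a weight 1/k gains s^(-m), and the angular
  width is s^(-m/2). After integration all powers of the large parameter cancel exactly; any loss of
  a power, however small, would destroy the critical case. This is why every Gamma quotient is
  estimated up to bounded factors. The same accuracy is needed in the converse: at the critical
  exponent the exponential factor equals 1 for the best c, and the relation between p and q is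
  visible only in the remaining power of k.\<close>

lemma Gamma_add_le:
  fixes x d :: real
  assumes "x > 0" "d \<ge> 0"
  shows "Gamma (x + d) \<le> Gamma x * (x + d) powr d"
proof -
  have c: "convex_on {0<..} (\<lambda>x::real. ln (Gamma x))"
    using log_convex_Gamma_real by (simp add: o_def)
  \<comment> \<open>The right end x + d + 1 is chosen because the functional equation leads it back
    to x + d: the unknown ln (Gamma (x + d)) then stands on both sides and can be solved
    for.\<close>
  have "ln (Gamma ((1 - d / (d + 1)) *\<^sub>R x + (d / (d + 1)) *\<^sub>R (x + d + 1)))
    \<le> (1 - d / (d + 1)) * ln (Gamma x) + d / (d + 1) * ln (Gamma (x + d + 1))"
    using assms by (intro convex_onD[OF c]) auto
  moreover have "(1 - d / (d + 1)) *\<^sub>R x + (d / (d + 1)) *\<^sub>R (x + d + 1) = x + d"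
  proof -
    have "d / (d + 1) * (d + 1) = d" using assms by simp
    moreover have "(1 - t) * x + t * (x + d + 1) = x + t * (d + 1)" for t by algebra
    ultimately show ?thesis by (simp only: real_scaleR_def)
  qed
  moreover have "ln (Gamma (x + d + 1)) = ln (x + d) + ln (Gamma (x + d))"
  proof -
    have "Gamma (x + d + 1) = (x + d) * Gamma (x + d)"
      using assms by (intro Gamma_plus1) auto
    then show ?thesis
      using assms Gamma_real_pos[OF assms(1)] Gamma_real_pos[of "x + d"] by (simp add: ln_mult_pos)
  qed
  ultimately have "ln (Gamma (x + d)) \<le> (1 - d / (d + 1)) * ln (Gamma x) + d / (d + 1) * (ln (x + d) + ln (Gamma (x + d)))"
    by simp
  then have "(d + 1) * ln (Gamma (x + d)) \<le> (d + 1) * ((1 - d / (d + 1)) * ln (Gamma x) + d / (d + 1) * (ln (x + d) + ln (Gamma (x + d))))"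
    using assms by (intro mult_left_mono) auto
  also have "\<dots> = ln (Gamma x) + d * (ln (x + d) + ln (Gamma (x + d)))"
  proof -
    have "(d + 1) * ((1 - t) * X + t * Y) = X + d * Y" if "(d + 1) * t = d" for t X Y
    proof -
      have "(d + 1) * ((1 - t) * X + t * Y) = (d + 1) * X - ((d + 1) * t) * X + ((d + 1) * t) * Y"
        by (simp add: algebra_simps)
      then show ?thesis unfolding that by (simp add: algebra_simps)
    qed
    moreover have "(d + 1) * (d / (d + 1)) = d" using assms by simp
    ultimately show ?thesis by blast
  qed
  finally have "(d + 1) * ln (Gamma (x + d)) \<le> ln (Gamma x) + d * (ln (x + d) + ln (Gamma (x + d)))" .
  then have "ln (Gamma (x + d)) \<le> ln (Gamma x) + d * ln (x + d)"
    by (simp add: algebra_simps)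
  then have "exp (ln (Gamma (x + d))) \<le> exp (ln (Gamma x) + d * ln (x + d))"
    by simp
  then show ?thesis
    using assms by (simp add: exp_add powr_def Gamma_real_pos)
qed

text \<open>Log-convexity at x + 1, which lies between x and x + d exactly when d >= 1.\<close>

lemma Gamma_add_ge:
  fixes x d :: real
  assumes "x > 0" "d \<ge> 1"
  shows "Gamma x * x powr d \<le> Gamma (x + d)"
proof -
  have c: "convex_on {0<..} (\<lambda>x::real. ln (Gamma x))"
    using log_convex_Gamma_real by (simp add: o_def)
  have "ln (Gamma ((1 - 1 / d) *\<^sub>R x + (1 / d) *\<^sub>R (x + d)))
    \<le> (1 - 1 / d) * ln (Gamma x) + 1 / d * ln (Gamma (x + d))"
    using assms by (intro convex_onD[OF c]) auto
  moreover have "(1 - 1 / d) *\<^sub>R x + (1 / d) *\<^sub>R (x + d) = x + 1"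
    using assms by (simp add: field_simps)
  moreover have "ln (Gamma (x + 1)) = ln x + ln (Gamma x)"
  proof -
    have "Gamma (x + 1) = x * Gamma x"
      using assms by (intro Gamma_plus1) auto
    then show ?thesis
      using assms Gamma_real_pos[OF assms(1)] Gamma_real_pos[of "x + d"] by (simp add: ln_mult_pos)
  qed
  ultimately have "ln x + ln (Gamma x) \<le> (1 - 1 / d) * ln (Gamma x) + 1 / d * ln (Gamma (x + d))"
    by simp
  then have "d * (ln x + ln (Gamma x)) \<le> d * ((1 - 1 / d) * ln (Gamma x) + 1 / d * ln (Gamma (x + d)))"
    using assms by (intro mult_left_mono) auto
  also have "\<dots> = (d - 1) * ln (Gamma x) + ln (Gamma (x + d))"
    using assms by (simp add: field_simps)
  finally have "ln (Gamma x) + d * ln x \<le> ln (Gamma (x + d))"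
    by (simp add: algebra_simps)
  then have "exp (ln (Gamma x) + d * ln x) \<le> exp (ln (Gamma (x + d)))"
    by simp
  then show ?thesis
    using assms by (simp add: exp_add powr_def Gamma_real_pos)
qed

text \<open>The lower bound has to cover d < 1, where \<open>Gamma_add_ge\<close> does not apply. It
  climbs to x + N with an integer N >= d + 1 and returns to x + d by \<open>Gamma_add_le\<close>; on
  x >= x0 the shifted bases are comparable with x.\<close>

lemma Gamma_add_asymp:
  fixes x0 d :: real
  assumes "x0 > 0" "d \<ge> 0"
  obtains C where "C > 0"
    "\<And>x. x \<ge> x0 \<Longrightarrow> Gamma (x + d) \<le> C * (Gamma x * x powr d)"
    "\<And>x. x \<ge> x0 \<Longrightarrow> Gamma x * x powr d \<le> C * Gamma (x + d)"
proof -
  obtain N :: nat where N: "real N \<ge> d + 1"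
    using real_arch_simple by blast
  define C1 where "C1 = (1 + d / x0) powr d"
  define C2 where "C2 = (1 + N / x0) powr (N - d)"
  have le: "x + e \<le> x * (1 + e / x0)" if "x \<ge> x0" "e \<ge> 0" for x e
  proof -
    have "e * x0 \<le> e * x" using that by (intro mult_left_mono) auto
    then show ?thesis using that assms by (simp add: field_simps)
  qed
  show ?thesis
  proof (rule that[of "C1 + C2"])
    show "C1 + C2 > 0"
      unfolding C1_def C2_def using assms by (intro add_pos_pos) (auto simp: add_pos_nonneg divide_nonneg_pos less_imp_neq[THEN not_sym])
  next
    fix x assume x: "x \<ge> x0"
    then have x0: "x > 0" using assms by simp
    have "(x + d) powr d \<le> (x * (1 + d / x0)) powr d"
      using le[OF x assms(2)] x0 assms by (intro powr_mono2) auto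
    also have "\<dots> = x powr d * C1"
      using x0 assms by (simp add: powr_mult C1_def)
    finally have "Gamma x * (x + d) powr d \<le> Gamma x * (x powr d * C1)"
      using x0 by (intro mult_left_mono) (auto simp: Gamma_real_pos less_imp_le)
    then have "Gamma (x + d) \<le> Gamma x * (x powr d * C1)"
      using Gamma_add_le[OF x0 assms(2)] by linarith
    also have "\<dots> \<le> (C1 + C2) * (Gamma x * x powr d)"
      using x0 by (simp add: C2_def algebra_simps Gamma_real_pos less_imp_le)
    finally show "Gamma (x + d) \<le> (C1 + C2) * (Gamma x * x powr d)" .
    have "Gamma x * x powr N \<le> Gamma (x + N)"
      using N assms x0 by (intro Gamma_add_ge) auto
    also have "\<dots> = Gamma ((x + d) + (N - d))" by simp
    also have "\<dots> \<le> Gamma (x + d) * (x + d + (N - d)) powr (N - d)"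
      using N assms x0 by (intro Gamma_add_le) auto
    also have "\<dots> \<le> Gamma (x + d) * (x * (1 + N / x0)) powr (N - d)"
      using N assms x0 le[OF x, of N] by (intro mult_left_mono powr_mono2) (auto simp: Gamma_real_pos less_imp_le)
    also have "\<dots> = Gamma (x + d) * C2 * x powr (N - d)"
      using x0 assms by (simp add: powr_mult C2_def)
    finally have "Gamma x * x powr d * x powr (N - d) \<le> Gamma (x + d) * C2 * x powr (N - d)"
      using x0 by (simp add: powr_add[symmetric] mult.assoc)
    then have "Gamma x * x powr d \<le> Gamma (x + d) * C2"
      using x0 by (simp add: mult_le_cancel_right)
    also have "\<dots> \<le> (C1 + C2) * Gamma (x + d)"
      using x0 assms by (simp add: C1_def algebra_simps Gamma_real_pos less_imp_le)
    finally show "Gamma x * x powr d \<le> (C1 + C2) * Gamma (x + d)" .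
  qed
qed

text \<open>The midpoint and trapezoidal bounds for ln (x + 1) - ln x show that the error
  \<open>d\<close> decreases under x -> x + 1, while d x - 1 / (4 x) increases. So \<open>d\<close>
  on the half-line is controlled by its values on the compact interval of length 1 at x0.\<close>

lemma Gamma_Stirling_bounds:
  fixes x0 :: real
  assumes "x0 > 0"
  obtains C where "C > 0"
    "\<And>x. x \<ge> x0 \<Longrightarrow> Gamma x \<le> C * (x powr (x - 1/2) * exp (- x))"
    "\<And>x. x \<ge> x0 \<Longrightarrow> x powr (x - 1/2) * exp (- x) \<le> C * Gamma x"
proof -
  define d where "d x = ln (Gamma x) - ((x - 1/2) * ln x - x)" for x :: real
  have step: "d (x + 1) \<le> d x" "d x - 1 / (4 * x) \<le> d (x + 1) - 1 / (4 * (x + 1))" if "x > 0" for x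
  proof -
    have "Gamma (x + 1) = x * Gamma x"
      using that by (intro Gamma_plus1) auto
    then have "d x - d (x + 1) = (x + 1/2) * (ln (x + 1) - ln x) - 1"
      using that Gamma_real_pos[OF that] by (simp add: d_def ln_mult_pos algebra_simps)
    moreover have "(x + 1/2) * (ln (x + 1) - ln x) \<ge> (x + 1/2) * (2 / (2 * x + 1))"
      using that ln_inverse_approx_ge[of x "x + 1"] by (intro mult_left_mono) (auto simp: add_ac)
    moreover have "(x + 1/2) * (2 / (2 * x + 1)) = 1"
      using that by (simp add: field_simps)
    moreover have "(x + 1/2) * (ln (x + 1) - ln x) \<le> (x + 1/2) * ((inverse x + inverse (x + 1)) / 2)"
      using that ln_inverse_approx_le[of x 1] by (intro mult_left_mono) auto
    moreover have "(x + 1/2) * ((inverse x + inverse (x + 1)) / 2) - 1 = 1 / (4 * x) - 1 / (4 * (x + 1))"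
      using that by (simp add: divide_simps) (simp add: algebra_simps)
    ultimately show "d (x + 1) \<le> d x" "d x - 1 / (4 * x) \<le> d (x + 1) - 1 / (4 * (x + 1))"
      by linarith+
  qed
  have "continuous_on {x0..x0+1} d"
    unfolding d_def using assms
    by (intro continuous_intros continuous_on_Gamma) (auto simp: Gamma_eq_zero_iff)
  then have "bounded (d ` {x0..x0+1})"
    by (intro compact_imp_bounded compact_continuous_image) auto
  then obtain M where M: "\<And>x. x \<in> {x0..x0+1} \<Longrightarrow> \<bar>d x\<bar> \<le> M"
    by (metis bounded_iff imageI real_norm_def)
  have it: "d (y + real k) \<le> d y \<and> d y - 1 / (4 * y) \<le> d (y + real k) - 1 / (4 * (y + real k))"
    if "y > 0" for y k
  proof (induction k)
    case (Suc k)
    then show ?case using step[of "y + real k"] that by (auto simp: add_ac)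
  qed simp
  have dM: "\<bar>d x\<bar> \<le> M + 1 / (4 * x0)" if "x \<ge> x0" for x
  proof -
    define k where "k = nat \<lfloor>x - x0\<rfloor>"
    define y where "y = x - real k"
    have k: "real k \<le> x - x0" "x - x0 < real k + 1"
      using that unfolding k_def by linarith+
    then have y: "y \<in> {x0..x0+1}" "y > 0" using assms by (auto simp: y_def)
    have "1 / (4 * y) \<le> 1 / (4 * x0)" using y assms by (intro divide_left_mono) auto
    moreover have "1 / (4 * x) \<ge> 0" "1 / (4 * x0) \<ge> 0" using that assms by auto
    moreover have e: "y + real k = x" by (simp add: y_def)
    ultimately show ?thesis using it[OF y(2), of k, unfolded e] M[OF y(1)] by (auto simp only: abs_le_iff)
  qed
  have G: "Gamma x = exp (d x) * (x powr (x - 1/2) * exp (- x))" if "x \<ge> x0" for x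
  proof -
    have "exp (d x) * (exp ((x - 1/2) * ln x) * exp (- x)) = exp (ln (Gamma x))"
      by (simp add: d_def exp_add[symmetric])
    then show ?thesis using that assms by (simp add: powr_def Gamma_real_pos)
  qed
  define C where "C = exp (M + 1 / (4 * x0))"
  show ?thesis
  proof (rule that[of C])
    fix x assume x: "x \<ge> x0"
    have "exp (d x) \<le> C" using dM[OF x] by (simp add: C_def)
    then show "Gamma x \<le> C * (x powr (x - 1/2) * exp (- x))"
      unfolding G[OF x] by (intro mult_right_mono) auto
    have "1 = exp (- d x) * exp (d x)" by (simp add: exp_add[symmetric])
    also have "\<dots> \<le> C * exp (d x)" using dM[OF x] by (simp add: C_def)
    finally have "1 * (x powr (x - 1/2) * exp (- x)) \<le> C * exp (d x) * (x powr (x - 1/2) * exp (- x))"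
      by (intro mult_right_mono) auto
    then show "x powr (x - 1/2) * exp (- x) \<le> C * Gamma x"
      unfolding G[OF x] by (simp add: mult.assoc)
  qed (simp add: C_def)
qed

section \<open>Moments of Poisson weights and sums of u^v / Gamma v over arithmetic
  progressions\<close>

lemma exp_partial_sum_le:
  fixes u :: real
  assumes "u \<ge> 0"
  shows "(\<Sum>j<J. u ^ j / fact j) \<le> exp u"
proof -
  have s: "(\<lambda>j. u ^ j / fact j) sums exp u"
    using exp_converges[of u] by (simp add: divide_inverse mult.commute scaleR_conv_of_real)
  have "(\<Sum>j<J. u ^ j / fact j) \<le> (\<Sum>j. u ^ j / fact j)"
    using s assms by (intro sum_le_suminf) (auto simp: sums_iff)
  then show ?thesis using s by (simp add: sums_iff)
qed

text \<open>Induction by (j + 1)^(N + 1) = (j + 1)^N + j (j + 1)^N: the factor j cancels in j! and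
  shifts the index by one, at the cost of j + 2 <= 2 (j + 1).\<close>

lemma poisson_moment_power:
  obtains C where "C > 0"
    "\<And>u J. u \<ge> 1 \<Longrightarrow> (\<Sum>j<J. real (j + 1) ^ N * u ^ j / fact j) \<le> C * u ^ N * exp u"
proof (induction N arbitrary: thesis)
  case 0
  show ?case by (rule 0[of 1]) (auto intro!: exp_partial_sum_le)
next
  case (Suc N)
  obtain C where C: "C > 0"
    "\<And>u J. u \<ge> 1 \<Longrightarrow> (\<Sum>j<J. real (j + 1) ^ N * u ^ j / fact j) \<le> C * u ^ N * exp u"
    using Suc.IH by blast
  show ?case
  proof (rule Suc.prems[of "(1 + 2 ^ N) * C"])
    fix u :: real and J :: nat
    assume u: "u \<ge> 1"
    have a: "(\<Sum>j<J. real j * real (j + 1) ^ N * u ^ j / fact j) \<le> 2 ^ N * u * (C * u ^ N * exp u)"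
    proof (cases J)
      case (Suc J')
      have "(\<Sum>j<J. real j * real (j + 1) ^ N * u ^ j / fact j)
          = (\<Sum>j<J'. u * (real (j + 2) ^ N * u ^ j / fact j))"
        unfolding Suc
      proof (subst sum.lessThan_Suc_shift, simp only: of_nat_0 mult_zero_left div_0 add_0, intro sum.cong refl)
        fix j
        have "real (Suc j) * (real (j + 2) ^ N * u ^ Suc j) / (real (Suc j) * fact j) = real (j + 2) ^ N * u ^ Suc j / fact j"
          by (rule mult_divide_mult_cancel_left) simp
        then show "real (Suc j) * real (Suc j + 1) ^ N * u ^ Suc j / fact (Suc j) = u * (real (j + 2) ^ N * u ^ j / fact j)"
          by (simp add: mult_ac add_ac)
      qed
      also have "\<dots> \<le> (\<Sum>j<J'. u * (2 ^ N * (real (j + 1) ^ N * u ^ j / fact j)))"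
      proof (intro sum_mono mult_left_mono)
        fix j
        have "real (j + 2) ^ N \<le> (2 * real (j + 1)) ^ N" by (intro power_mono) auto
        then have "real (j + 2) ^ N * (u ^ j / fact j) \<le> (2 ^ N * real (j + 1) ^ N) * (u ^ j / fact j)"
          unfolding power_mult_distrib using u by (intro mult_right_mono) auto
        then show "real (j + 2) ^ N * u ^ j / fact j \<le> 2 ^ N * (real (j + 1) ^ N * u ^ j / fact j)"
          by (simp add: mult.assoc)
      qed (use u in auto)
      also have "\<dots> = 2 ^ N * u * (\<Sum>j<J'. real (j + 1) ^ N * u ^ j / fact j)"
        by (simp add: sum_distrib_left mult_ac)
      also have "\<dots> \<le> 2 ^ N * u * (C * u ^ N * exp u)"
        using u C by (intro mult_left_mono) auto
      finally show ?thesis .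
    qed (use u C(1) in auto)
    have "(\<Sum>j<J. real (j + 1) ^ Suc N * u ^ j / fact j)
      = (\<Sum>j<J. real (j + 1) ^ N * u ^ j / fact j) + (\<Sum>j<J. real j * real (j + 1) ^ N * u ^ j / fact j)"
      by (simp add: sum.distrib[symmetric] field_simps)
    also have "\<dots> \<le> C * u ^ N * exp u + 2 ^ N * u * (C * u ^ N * exp u)"
      using C(2)[OF u] a by (intro add_mono) auto
    also have "\<dots> \<le> u * (C * u ^ N * exp u) + 2 ^ N * u * (C * u ^ N * exp u)"
      using mult_right_mono[OF u, of "C * u ^ N * exp u"] u C(1) by (intro add_right_mono) auto
    finally show "(\<Sum>j<J. real (j + 1) ^ Suc N * u ^ j / fact j) \<le> (1 + 2 ^ N) * C * u ^ Suc N * exp u"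
      by (simp add: algebra_simps)
  next
    show "0 < (1 + 2 ^ N) * C" using C(1) by (intro mult_pos_pos add_pos_pos) auto
  qed
qed

lemma fact_add_le: "(fact (j + N) :: real) \<le> fact N * real (j + 1) ^ N * fact j"
proof (induction N)
  case (Suc N)
  have "(fact (j + Suc N) :: real) = real (j + Suc N) * fact (j + N)" by simp
  also have "\<dots> \<le> (real (Suc N) * real (j + 1)) * (fact N * real (j + 1) ^ N * fact j)"
    using Suc by (intro mult_mono) (auto simp: algebra_simps)
  finally show ?case by (simp add: mult_ac)
qed simp

text \<open>By \<open>fact_add_le\<close> the denominator absorbs (j + N)! up to the factor N!, so
  the sum is part of the exponential series shifted by N.\<close>

lemma poisson_moment_inverse_power:
  fixes u :: real
  assumes u: "u > 0"
  shows "(\<Sum>j<J. u ^ j / (real (j + 1) ^ N * fact j)) \<le> fact N * exp u / u ^ N"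
proof -
  have "(\<Sum>j<J. u ^ j / (real (j + 1) ^ N * fact j)) \<le> (\<Sum>j<J. fact N / u ^ N * (u ^ (j + N) / fact (j + N)))"
  proof (intro sum_mono)
    fix j
    have "u ^ j / (real (j + 1) ^ N * fact j) = u ^ j * fact N / (fact N * real (j + 1) ^ N * fact j)"
      by simp
    also have "\<dots> \<le> u ^ j * fact N / fact (j + N)"
      using u fact_add_le[of j N] by (intro divide_left_mono) auto
    finally show "u ^ j / (real (j + 1) ^ N * fact j) \<le> fact N / u ^ N * (u ^ (j + N) / fact (j + N))"
      using u by (simp add: power_add mult.commute)
  qed
  also have "\<dots> = fact N / u ^ N * (\<Sum>j\<in>(\<lambda>j. j + N) ` {..<J}. u ^ j / fact j)"
    by (simp add: sum_distrib_left sum.reindex)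
  also have "(\<Sum>j\<in>(\<lambda>j. j + N) ` {..<J}. u ^ j / fact j) \<le> (\<Sum>j<J+N. u ^ j / fact j)"
    using u by (intro sum_mono2) auto
  also have "\<dots> \<le> exp u" using u by (intro exp_partial_sum_le) auto
  finally show ?thesis using u by (simp add: field_simps mult_left_mono)
qed

lemma powr_le_power_add_inverse:
  fixes t r :: real
  assumes "t > 0" "\<bar>r\<bar> \<le> real N"
  shows "t powr r \<le> t ^ N + 1 / t ^ N"
proof (cases "t \<ge> 1")
  case True
  then have "t powr r \<le> t powr N" using assms by (intro powr_mono) auto
  then show ?thesis using assms by (simp add: powr_realpow add_increasing2)
next
  case False
  then have "t powr r \<le> t powr (- real N)" using assms by (intro powr_mono') auto
  then show ?thesis using assms by (simp add: powr_minus powr_realpow add_increasing divide_inverse)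
qed

text \<open>Poisson weights of parameter u concentrate at j near u, so (j + 1)^r acts like u^r. For
  real r the ratio t = (j + 1) / u satisfies t^r <= t^N + t^(-N), and both integer moments are
  known.\<close>

lemma poisson_moment_powr:
  obtains C where "C > 0"
    "\<And>u J. u \<ge> 1 \<Longrightarrow> (\<Sum>j<J. real (j + 1) powr r * u ^ j / fact j) \<le> C * u powr r * exp u"
proof -
  obtain N :: nat where N: "\<bar>r\<bar> \<le> real N" using real_arch_simple by blast
  obtain C where C: "C > 0"
    "\<And>u J. u \<ge> 1 \<Longrightarrow> (\<Sum>j<J. real (j + 1) ^ N * u ^ j / fact j) \<le> C * u ^ N * exp u"
    using poisson_moment_power by blast
  show ?thesis
  proof (rule that[of "C + fact N"])
    fix u :: real and J :: nat
    assume u: "u \<ge> 1"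
    have "(\<Sum>j<J. real (j + 1) powr r * u ^ j / fact j)
      \<le> (\<Sum>j<J. u powr r * (1 / u ^ N * (real (j + 1) ^ N * u ^ j / fact j)
            + u ^ N * (u ^ j / (real (j + 1) ^ N * fact j))))"
    proof (intro sum_mono)
      fix j
      let ?t = "real (j + 1) / u"
      have "real (j + 1) powr r = u powr r * ?t powr r"
        using u by (simp add: powr_divide)
      also have "\<dots> \<le> u powr r * (?t ^ N + 1 / ?t ^ N)"
        using u N by (intro mult_left_mono powr_le_power_add_inverse) auto
      finally have "real (j + 1) powr r * (u ^ j / fact j) \<le> u powr r * (?t ^ N + 1 / ?t ^ N) * (u ^ j / fact j)"
        using u by (intro mult_right_mono) auto
      also have "\<dots> = u powr r * (1 / u ^ N * (real (j + 1) ^ N * u ^ j / fact j)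
            + u ^ N * (u ^ j / (real (j + 1) ^ N * fact j)))"
        using u by (simp add: field_simps power_divide)
      finally show "real (j + 1) powr r * u ^ j / fact j \<le> u powr r * (1 / u ^ N * (real (j + 1) ^ N * u ^ j / fact j)
            + u ^ N * (u ^ j / (real (j + 1) ^ N * fact j)))"
        by simp
    qed
    also have "\<dots> = u powr r * (1 / u ^ N * (\<Sum>j<J. real (j + 1) ^ N * u ^ j / fact j)
            + u ^ N * (\<Sum>j<J. u ^ j / (real (j + 1) ^ N * fact j)))"
      by (simp only: sum.distrib sum_distrib_left[symmetric])
    also have "\<dots> \<le> u powr r * (1 / u ^ N * (C * u ^ N * exp u) + u ^ N * (fact N * exp u / u ^ N))"
      using u C(2)[OF u] poisson_moment_inverse_power[of u N J]
      by (intro mult_left_mono add_mono) auto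
    also have "\<dots> = (C + fact N) * u powr r * exp u"
      using u by (simp add: field_simps)
    finally show "(\<Sum>j<J. real (j + 1) powr r * u ^ j / fact j) \<le> (C + fact N) * u powr r * exp u" .
  qed (use C in \<open>auto intro: add_pos_pos\<close>)
qed


text \<open>A term with real argument v is interpolated between the two Poisson terms at the
  integers floor v and floor v + 1, so that sums over non-integer grids reduce to Poisson
  moments.\<close>

lemma powr_over_Gamma_le_poisson:
  fixes v0 e :: real
  assumes v0: "v0 > 0"
  obtains C where "C > 0"
    "\<And>u v. v \<ge> v0 \<Longrightarrow> u \<ge> 0 \<Longrightarrow> v powr e * u powr v / Gamma v \<le>
      C * (real (nat \<lfloor>v\<rfloor> + 1) powr (e + 1) * u ^ nat \<lfloor>v\<rfloor> / fact (nat \<lfloor>v\<rfloor>)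
         + real (nat \<lfloor>v\<rfloor> + 2) powr (e + 1) * u ^ (nat \<lfloor>v\<rfloor> + 1) / fact (nat \<lfloor>v\<rfloor> + 1))"
proof -
  \<comment> \<open>Chosen such that c (j + 2) <= v with j = floor v: for j = 0 this uses v >= v0,
    for j >= 1 it uses j + 2 <= 3 j. Then v, j + 1 and j + 2 are interchangeable in powers of either
    sign.\<close>
  define c where "c = min 1 v0 / 3"
  have c: "c > 0" "c \<le> 1" using v0 by (auto simp: c_def)
  define C where "C = 2 * c powr (- \<bar>e + 1\<bar>)"
  have C: "C > 0" using c by (simp add: C_def)
  show ?thesis
  proof (rule that[of C])
    fix u v :: real
    assume v: "v \<ge> v0" and u: "u \<ge> 0"
    define j where "j = nat \<lfloor>v\<rfloor>"
    define f where "f = v - real j"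
    have vp: "v > 0" using v v0 by simp
    have f: "0 \<le> f" "f < 1" "v = real j + f"
      using vp unfolding f_def j_def by linarith+
    have comp: "v powr (e + 1) \<le> c powr (- \<bar>e + 1\<bar>) * w powr (e + 1)"
      if w: "w \<ge> v" "c * w \<le> v" for w
    proof (cases "e + 1 \<ge> 0")
      case True
      have "1 \<le> c powr (- \<bar>e + 1\<bar>)" using powr_mono'[of "- \<bar>e + 1\<bar>" 0 c] c by simp
      moreover have "v powr (e + 1) \<le> w powr (e + 1)" using w vp True by (intro powr_mono2) auto
      ultimately show ?thesis
        by (metis mult_mono mult_1 powr_ge_zero)
    next
      case False
      have "v powr (e + 1) \<le> (c * w) powr (e + 1)"
        using False w c vp by (intro powr_mono2') (auto intro!: mult_pos_pos)
      then show ?thesis using False c w vp by (simp add: powr_mult add.commute)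
    qed
    have w1: "real (j + 1) \<ge> v" "real (j + 2) \<ge> v" using f by auto
    have cj: "c * real (j + 2) \<le> v"
    proof (cases "j = 0")
      case True
      then show ?thesis using v v0 by (auto simp: c_def min_def)
    next
      case False
      have "c * real (j + 2) \<le> 1 / 3 * (3 * real j)"
        using c False by (intro mult_mono) (auto simp: c_def)
      then show ?thesis using f by simp
    qed
    have cj1: "c * real (j + 1) \<le> v" using cj c(1) by (auto simp: algebra_simps)
    \<comment> \<open>Log-convexity between the argument v + 1 = j + 1 + f and the integer j + 2;
      the factor 2 compares j + 2 with j + 1.\<close>
    have fj: "fact j * real (j + 1) powr f \<le> 2 * Gamma (v + 1)"
    proof -
      have "Gamma (real j + 2) \<le> Gamma (real j + 1 + f) * (real j + 1 + f + (1 - f)) powr (1 - f)"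
        using Gamma_add_le[of "real j + 1 + f" "1 - f"] f by (simp add: add_ac)
      also have "real j + 1 + f + (1 - f) = real j + 2" by simp
      also have "Gamma (real j + 2) = real (j + 1) * fact j"
        using Gamma_fact[of "j + 1", where ?'a = real] by (simp add: add_ac)
      finally have "real (j + 1) * fact j \<le> Gamma (v + 1) * (real j + 2) powr (1 - f)"
        using f by (simp add: add_ac)
      also have "\<dots> \<le> Gamma (v + 1) * (2 * real (j + 1) powr (1 - f))"
      proof (intro mult_left_mono)
        have "(real j + 2) powr (1 - f) \<le> (2 * real (j + 1)) powr (1 - f)"
          using f by (intro powr_mono2) auto
        also have "\<dots> = 2 powr (1 - f) * real (j + 1) powr (1 - f)" by (rule powr_mult)
        also have "\<dots> \<le> 2 powr 1 * real (j + 1) powr (1 - f)"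
          using f by (intro mult_right_mono powr_mono) auto
        finally show "(real j + 2) powr (1 - f) \<le> 2 * real (j + 1) powr (1 - f)" by simp
      qed (use vp in \<open>auto intro!: less_imp_le Gamma_real_pos\<close>)
      also have "real (j + 1) powr (1 - f) = real (j + 1) / real (j + 1) powr f"
        by (simp add: powr_diff)
      finally have "real (j + 1) * fact j * real (j + 1) powr f \<le> real (j + 1) * (2 * Gamma (v + 1))"
        by (simp add: field_simps)
      then have "real (j + 1) * (fact j * real (j + 1) powr f) \<le> real (j + 1) * (2 * Gamma (v + 1))"
        by (simp add: mult.assoc)
      then show ?thesis by (rule mult_left_le_imp_le) simp
    qed
    \<comment> \<open>With t = u / (j + 1) the fractional power obeys t^f <= 1 + t, which is where
      the second Poisson term comes from.\<close>
    have uf: "u powr v \<le> (u ^ j + u ^ (j + 1) / real (j + 1)) * real (j + 1) powr f"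
    proof (cases "u = 0")
      case False
      define t where "t = u / real (j + 1)"
      have t: "t > 0" using u False by (simp add: t_def)
      have "t powr f \<le> 1 + t"
      proof (cases "t \<le> 1")
        case True
        then have "t powr f \<le> 1" using t f by (intro powr_le1) auto
        then show ?thesis using t by simp
      next
        case False
        then have "t powr f \<le> t powr 1" using t f by (intro powr_mono) auto
        then show ?thesis using t by simp
      qed
      moreover have "u powr f = t powr f * real (j + 1) powr f"
        unfolding t_def by (simp add: powr_divide)
      ultimately have "u powr f \<le> (1 + t) * real (j + 1) powr f"
        by (simp add: mult_right_mono)
      then have "u ^ j * u powr f \<le> u ^ j * ((1 + t) * real (j + 1) powr f)"
        using u by (intro mult_left_mono) auto
      moreover have "u powr v = u ^ j * u powr f"
        using f(3) u False by (simp add: powr_add powr_realpow)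
      ultimately show ?thesis by (simp add: t_def algebra_simps)
    qed (use f vp in auto)
    have "v powr e * u powr v / Gamma v = v powr (e + 1) * u powr v / Gamma (v + 1)"
    proof -
      have "Gamma (v + 1) = v * Gamma v" using vp by (intro Gamma_plus1) auto
      then show ?thesis using vp by (simp add: powr_add)
    qed
    also have "\<dots> \<le> v powr (e + 1) * ((u ^ j + u ^ (j + 1) / real (j + 1)) * real (j + 1) powr f) / Gamma (v + 1)"
      using uf vp by (intro divide_right_mono mult_left_mono) (auto intro!: less_imp_le Gamma_real_pos)
    also have "\<dots> \<le> v powr (e + 1) * ((u ^ j + u ^ (j + 1) / real (j + 1)) * real (j + 1) powr f)
        / (fact j * real (j + 1) powr f / 2)"
      using fj u vp by (intro divide_left_mono mult_nonneg_nonneg mult_pos_pos) (auto intro!: Gamma_real_pos)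
    also have "\<dots> = 2 * (v powr (e + 1) * u ^ j / fact j + v powr (e + 1) * u ^ (j + 1) / fact (j + 1))"
    proof -
      have "X * ((a + b / r) * Z) / (F * Z / 2) = 2 * (X * a / F + X * b / (r * F))"
        if "r \<noteq> 0" "F \<noteq> 0" "Z \<noteq> 0" for X a b r F Z :: real
        using that by (simp add: field_simps)
      from this[of "real (j + 1)" "fact j" "real (j + 1) powr f"] show ?thesis
        by simp
    qed
    also have "\<dots> \<le> 2 * ((c powr (- \<bar>e + 1\<bar>) * real (j + 1) powr (e + 1)) * u ^ j / fact j
        + (c powr (- \<bar>e + 1\<bar>) * real (j + 2) powr (e + 1)) * u ^ (j + 1) / fact (j + 1))"
      using u comp[OF w1(1) cj1] comp[OF w1(2) cj]
      by (intro mult_left_mono add_mono divide_right_mono mult_right_mono) auto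
    also have "\<dots> = C * (real (j + 1) powr (e + 1) * u ^ j / fact j
        + real (j + 2) powr (e + 1) * u ^ (j + 1) / fact (j + 1))"
      by (simp add: C_def algebra_simps)
    finally show "v powr e * u powr v / Gamma v \<le>
      C * (real (nat \<lfloor>v\<rfloor> + 1) powr (e + 1) * u ^ nat \<lfloor>v\<rfloor> / fact (nat \<lfloor>v\<rfloor>)
         + real (nat \<lfloor>v\<rfloor> + 2) powr (e + 1) * u ^ (nat \<lfloor>v\<rfloor> + 1) / fact (nat \<lfloor>v\<rfloor> + 1))"
      unfolding j_def .
  qed fact
qed

text \<open>Step at least 1 makes the integer parts of the grid points distinct.\<close>

lemma sum_powr_over_Gamma_le_of_step_ge_1:
  fixes v0 e :: real
  assumes v0: "v0 > 0"
  obtains C where "C > 0"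
    "\<And>u D w K. u \<ge> 1 \<Longrightarrow> D \<ge> 1 \<Longrightarrow> w \<ge> v0 \<Longrightarrow>
      (\<Sum>k<K. (w + real k * D) powr e * u powr (w + real k * D) / Gamma (w + real k * D))
      \<le> C * u powr (e + 1) * exp u"
proof -
  obtain C1 where C1: "C1 > 0"
    "\<And>u v. v \<ge> v0 \<Longrightarrow> u \<ge> 0 \<Longrightarrow> v powr e * u powr v / Gamma v \<le>
      C1 * (real (nat \<lfloor>v\<rfloor> + 1) powr (e + 1) * u ^ nat \<lfloor>v\<rfloor> / fact (nat \<lfloor>v\<rfloor>)
         + real (nat \<lfloor>v\<rfloor> + 2) powr (e + 1) * u ^ (nat \<lfloor>v\<rfloor> + 1) / fact (nat \<lfloor>v\<rfloor> + 1))"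
    using powr_over_Gamma_le_poisson[OF v0] by blast
  obtain C2 where C2: "C2 > 0"
    "\<And>u J. u \<ge> 1 \<Longrightarrow> (\<Sum>j<J. real (j + 1) powr (e + 1) * u ^ j / fact j) \<le> C2 * u powr (e + 1) * exp u"
    using poisson_moment_powr by blast
  show ?thesis
  proof (rule that[of "2 * C1 * C2"])
    fix u D w :: real and K :: nat
    assume u: "u \<ge> 1" and D: "D \<ge> 1" and w: "w \<ge> v0"
    define v where "v k = w + real k * D" for k
    define j where "j k = nat \<lfloor>v k\<rfloor>" for k
    define g where "g i = real (i + 1) powr (e + 1) * u ^ i / fact i" for i
    have g0: "g i \<ge> 0" for i using u by (simp add: g_def)
    have v: "v k \<ge> v0" for k using w D by (simp add: v_def add_increasing2)
    have "j k < j k'" if "k < k'" for k k'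
    proof -
      have "1 * 1 \<le> real (k' - k) * D" using that D by (intro mult_mono) auto
      then have "v k + 1 \<le> v k'" using that by (simp add: v_def algebra_simps of_nat_diff)
      then show ?thesis using v[of k] v0 unfolding j_def by linarith
    qed
    then have inj: "inj_on j A" for A by (metis inj_onI linorder_neqE_nat order_less_irrefl)
    have bound: "(\<Sum>i\<in>I. g i) \<le> C2 * u powr (e + 1) * exp u" if "finite I" for I
    proof -
      have "I \<subseteq> {..<Suc (Max (insert 0 I))}" using that by (auto simp: less_Suc_eq_le)
      then have "(\<Sum>i\<in>I. g i) \<le> (\<Sum>i<Suc (Max (insert 0 I)). g i)"
        using g0 by (intro sum_mono2) auto
      also have "\<dots> \<le> C2 * u powr (e + 1) * exp u" unfolding g_def by (rule C2(2)[OF u])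
      finally show ?thesis .
    qed
    have "(\<Sum>k<K. v k powr e * u powr v k / Gamma (v k)) \<le> (\<Sum>k<K. C1 * (g (j k) + g (j k + 1)))"
      using C1(2)[OF v, of u] u by (intro sum_mono) (simp add: g_def j_def)
    also have "\<dots> = C1 * ((\<Sum>k<K. g (j k)) + (\<Sum>k<K. g (j k + 1)))"
      by (simp only: sum_distrib_left[symmetric] sum.distrib)
    also have "(\<Sum>k<K. g (j k)) = (\<Sum>i\<in>j ` {..<K}. g i)"
      using inj by (simp add: sum.reindex)
    also have "(\<Sum>k<K. g (j k + 1)) = (\<Sum>i\<in>(\<lambda>k. j k + 1) ` {..<K}. g i)"
      using inj by (subst sum.reindex) (auto simp: inj_on_def)
    also have "C1 * ((\<Sum>i\<in>j ` {..<K}. g i) + (\<Sum>i\<in>(\<lambda>k. j k + 1) ` {..<K}. g i))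
        \<le> C1 * (C2 * u powr (e + 1) * exp u + C2 * u powr (e + 1) * exp u)"
      using C1(1) by (intro mult_left_mono add_mono bound) auto
    finally show "(\<Sum>k<K. (w + real k * D) powr e * u powr (w + real k * D) / Gamma (w + real k * D))
      \<le> 2 * C1 * C2 * u powr (e + 1) * exp u"
      by (simp add: v_def algebra_simps)
  qed (use C1 C2 in auto)
qed

text \<open>The grids used below have steps 1/m and 1/(2m), and m <= 1 guarantees only 1/2 for the
  finer one. Even and odd indices form two grids of step 2 D >= 1 each, with starting points v0 and
  v0 + D.\<close>

lemma sum_powr_over_Gamma_le:
  fixes v0 e D :: real
  assumes v0: "v0 > 0" and D: "D \<ge> 1 / 2"
  obtains C where "C > 0"
    "\<And>u K. u \<ge> 1 \<Longrightarrow>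
      (\<Sum>k<K. (v0 + real k * D) powr e * u powr (v0 + real k * D) / Gamma (v0 + real k * D))
      \<le> C * u powr (e + 1) * exp u"
proof -
  obtain C where C: "C > 0"
    "\<And>u D w K. u \<ge> 1 \<Longrightarrow> D \<ge> 1 \<Longrightarrow> w \<ge> v0 \<Longrightarrow>
      (\<Sum>k<K. (w + real k * D) powr e * u powr (w + real k * D) / Gamma (w + real k * D))
      \<le> C * u powr (e + 1) * exp u"
    using sum_powr_over_Gamma_le_of_step_ge_1[OF v0] by blast
  show ?thesis
  proof (rule that[of "2 * C"])
    fix u :: real and K :: nat
    assume u: "u \<ge> 1"
    define h where "h v = v powr e * u powr v / Gamma v" for v
    have pos: "h (v0 + real k * D) \<ge> 0" for k
      using v0 D by (auto simp: h_def intro!: divide_nonneg_pos Gamma_real_pos add_pos_nonneg)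
    have split: "(\<Sum>k<2*K. f k) = (\<Sum>k<K. f (2 * k)) + (\<Sum>k<K. f (2 * k + 1))" for f :: "nat \<Rightarrow> real" and K
      by (induction K) auto
    have "(\<Sum>k<K. h (v0 + real k * D)) \<le> (\<Sum>k<2*K. h (v0 + real k * D))"
      using pos by (intro sum_mono2) auto
    also have "\<dots> = (\<Sum>k<K. h (v0 + real k * (2 * D))) + (\<Sum>k<K. h ((v0 + D) + real k * (2 * D)))"
      unfolding split by (simp add: algebra_simps)
    also have "\<dots> \<le> C * u powr (e + 1) * exp u + C * u powr (e + 1) * exp u"
      unfolding h_def using u D by (intro add_mono C(2)) auto
    finally show "(\<Sum>k<K. (v0 + real k * D) powr e * u powr (v0 + real k * D) / Gamma (v0 + real k * D))
      \<le> 2 * C * u powr (e + 1) * exp u"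
      by (simp add: h_def mult_ac)
  qed (use C in auto)
qed

subsection \<open>The Taylor coefficients of the kernel\<close>

definition kcoef :: "real \<Rightarrow> nat \<Rightarrow> nat \<Rightarrow> real" where
  "kcoef m n k = Gamma (real (n + k)) / (fact k * Gamma (real (n + k) / m))"

definition kfun :: "real \<Rightarrow> nat \<Rightarrow> complex \<Rightarrow> complex" where
  "kfun m n t = (\<Sum>k. complex_of_real (kcoef m n k) * t ^ k)"

lemma kernel_eq_kfun:
  "kernel b m x (y :: complex ^ 'n::finite) =
     complex_of_real (m * b powr (real CARD('n) / m) / pi ^ CARD('n)) *
     kfun m CARD('n) (complex_of_real (b powr (1 / m)) * cinner x y)"
proof -
  have "(complex_of_real (b powr (1 / m)) * cinner x y) ^ k / of_nat (fact k) *
            complex_of_real (Gamma (real (CARD('n) + k)) / Gamma (real (CARD('n) + k) / m))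
     = complex_of_real (kcoef m CARD('n) k) * (complex_of_real (b powr (1 / m)) * cinner x y) ^ k" for k
    by (simp add: kcoef_def)
  then show ?thesis
    unfolding kernel_def kfun_def by simp
qed

lemma kcoef_pos:
  assumes "m > 0" "n \<ge> 1"
  shows "kcoef m n k > 0"
  unfolding kcoef_def using assms by (intro divide_pos_pos mult_pos_pos Gamma_real_pos) auto

lemma kcoef_le_powr:
  assumes "m > 0" "m \<le> 1" "n \<ge> 1"
  shows "kcoef m n k \<le> real (n + k) powr (real n - 1) / Gamma (real (n + k) / m)"
proof -
  have "Gamma (real (n + k)) \<le> fact k * real (n + k) powr (real n - 1)"
    using Gamma_add_le[of "1 + real k" "real n - 1"] Gamma_fact[of k, where ?'a = real] assms
    by (simp add: add_ac)
  then have "Gamma (real (n + k)) / fact k \<le> real (n + k) powr (real n - 1)"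
    by (simp add: field_simps)
  then have "Gamma (real (n + k)) / fact k / Gamma (real (n + k) / m)
      \<le> real (n + k) powr (real n - 1) / Gamma (real (n + k) / m)"
    using assms by (intro divide_right_mono) (auto intro!: less_imp_le Gamma_real_pos)
  then show ?thesis by (simp add: kcoef_def)
qed

text \<open>With u = s^m and v = (n + k) / m one has u^v = s^(n + k), so after multiplication by s^n
  the sum runs over the grid n/m + k/m. The resulting factor u^n is at most s^n since s >= 1 and m
  <= 1, and s^n cancels.\<close>

lemma kcoef_partial_sum_le:
  assumes m: "m > 0" "m \<le> 1" and n: "n \<ge> 1"
  obtains C where "C > 0"
    "\<And>s K. s \<ge> 1 \<Longrightarrow> (\<Sum>k<K. kcoef m n k * s ^ k) \<le> C * exp (s powr m)"
proof -
  have v0: "real n / m > 0" "1 / m \<ge> 1 / 2" using m n by (auto simp: field_simps)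
  obtain C where C: "C > 0"
    "\<And>u K. u \<ge> 1 \<Longrightarrow>
      (\<Sum>k<K. (real n / m + real k * (1 / m)) powr (real n - 1) * u powr (real n / m + real k * (1 / m))
         / Gamma (real n / m + real k * (1 / m)))
      \<le> C * u powr (real n - 1 + 1) * exp u"
    using sum_powr_over_Gamma_le[OF v0] by blast
  show ?thesis
  proof (rule that[of C])
    fix s :: real and K :: nat
    assume s: "s \<ge> 1"
    define u where "u = s powr m"
    have u: "u \<ge> 1" using s m by (simp add: u_def ge_one_powr_ge_zero)
    have v: "real n / m + real k * (1 / m) = real (n + k) / m" for k
      by (simp add: add_divide_distrib)
    have us: "u powr (real (n + k) / m) = s ^ n * s ^ k" for k
      using s m by (simp add: u_def powr_powr powr_realpow[symmetric] powr_add[symmetric])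
    have "s ^ n * (\<Sum>k<K. kcoef m n k * s ^ k) = (\<Sum>k<K. kcoef m n k * (s ^ n * s ^ k))"
      by (simp add: sum_distrib_left mult_ac)
    also have "\<dots> \<le> (\<Sum>k<K. (real (n + k) / m) powr (real n - 1) * u powr (real (n + k) / m) / Gamma (real (n + k) / m))"
    proof (intro sum_mono)
      fix k
      have "real (n + k) * m \<le> real (n + k)" using m by (simp add: mult_left_le)
      then have "real (n + k) \<le> real (n + k) / m" using m by (simp add: pos_le_divide_eq)
      then have "real (n + k) powr (real n - 1) \<le> (real (n + k) / m) powr (real n - 1)"
        using n by (intro powr_mono2) auto
      then have "real (n + k) powr (real n - 1) / Gamma (real (n + k) / m) \<le> (real (n + k) / m) powr (real n - 1) / Gamma (real (n + k) / m)"
        using m n by (intro divide_right_mono) (auto intro!: less_imp_le Gamma_real_pos)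
      then have "kcoef m n k \<le> (real (n + k) / m) powr (real n - 1) / Gamma (real (n + k) / m)"
        using kcoef_le_powr[OF m n, of k] by linarith
      then have "kcoef m n k * (s ^ n * s ^ k) \<le> (real (n + k) / m) powr (real n - 1) / Gamma (real (n + k) / m) * (s ^ n * s ^ k)"
        using s by (intro mult_right_mono) auto
      then show "kcoef m n k * (s ^ n * s ^ k) \<le> (real (n + k) / m) powr (real n - 1) * u powr (real (n + k) / m) / Gamma (real (n + k) / m)"
        unfolding us by simp
    qed
    also have "\<dots> \<le> C * u powr (real n) * exp u"
      using C(2)[OF u, of K] unfolding v by simp
    also have "\<dots> \<le> C * s ^ n * exp u"
    proof -
      have "u powr real n = (s powr n) powr m" by (simp add: u_def powr_powr mult.commute)
      also have "\<dots> \<le> (s powr n) powr 1" using s m by (intro powr_mono) (auto simp: ge_one_powr_ge_zero)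
      finally have "u powr real n \<le> s ^ n" using s by (simp add: powr_realpow)
      then show ?thesis using C(1) by (intro mult_right_mono mult_left_mono) auto
    qed
    finally have "s ^ n * (\<Sum>k<K. kcoef m n k * s ^ k) \<le> s ^ n * (C * exp u)" by (simp add: mult_ac)
    then show "(\<Sum>k<K. kcoef m n k * s ^ k) \<le> C * exp (s powr m)"
      using s unfolding u_def by (simp add: mult_le_cancel_left_pos)
  qed fact
qed

lemma kcoef_summable:
  assumes m: "m > 0" "m \<le> 1" and n: "n \<ge> 1" and s: "s \<ge> 0"
  shows "summable (\<lambda>k. kcoef m n k * s ^ k)"
proof -
  obtain C where C: "C > 0"
    "\<And>s K. s \<ge> 1 \<Longrightarrow> (\<Sum>k<K. kcoef m n k * s ^ k) \<le> C * exp (s powr m)"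
    using kcoef_partial_sum_le[OF m n] by blast
  have pos: "kcoef m n k * r ^ k \<ge> 0" if "r \<ge> 0" for k r
    using kcoef_pos[OF m(1) n, of k] that by simp
  have "summable (\<lambda>k. kcoef m n k * (max s 1) ^ k)"
  proof (rule bounded_imp_summable)
    fix K
    show "(\<Sum>k\<le>K. kcoef m n k * (max s 1) ^ k) \<le> C * exp (max s 1 powr m)"
      using C(2)[of "max s 1" "Suc K"] by (simp add: lessThan_Suc_atMost)
  qed (simp add: pos)
  then show ?thesis
  proof (rule summable_comparison_test_ev[rotated], intro always_eventually allI)
    fix k
    have "kcoef m n k * s ^ k \<le> kcoef m n k * max s 1 ^ k"
      using s kcoef_pos[OF m(1) n, of k] by (intro mult_left_mono power_mono) auto
    then show "norm (kcoef m n k * s ^ k) \<le> kcoef m n k * max s 1 ^ k"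
      using pos[OF s, of k] by simp
  qed
qed

lemma kcoef_suminf_le:
  assumes m: "m > 0" "m \<le> 1" and n: "n \<ge> 1"
  obtains C where "C > 0"
    "\<And>s. s \<ge> 0 \<Longrightarrow> (\<Sum>k. kcoef m n k * s ^ k) \<le> C * exp (s powr m)"
proof -
  obtain C where C: "C > 0"
    "\<And>s K. s \<ge> 1 \<Longrightarrow> (\<Sum>k<K. kcoef m n k * s ^ k) \<le> C * exp (s powr m)"
    using kcoef_partial_sum_le[OF m n] by blast
  have le: "(\<Sum>k. kcoef m n k * s ^ k) \<le> C * exp (s powr m)" if "s \<ge> 1" for s
    using that by (intro suminf_le_const kcoef_summable C(2) m n) auto
  show ?thesis
  proof (rule that[of "C * exp 1"])
    fix s :: real assume s: "s \<ge> 0"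
    show "(\<Sum>k. kcoef m n k * s ^ k) \<le> C * exp 1 * exp (s powr m)"
    proof (cases "s \<ge> 1")
      case True
      have "1 * (C * exp (s powr m)) \<le> exp 1 * (C * exp (s powr m))"
        using C(1) by (intro mult_right_mono) auto
      then show ?thesis using le[OF True] by (simp add: mult_ac)
    next
      case False
      have "(\<Sum>k. kcoef m n k * s ^ k) \<le> (\<Sum>k. kcoef m n k * 1 ^ k)"
        using False s kcoef_pos[OF m(1) n] kcoef_summable[OF m n, of 1]
        by (intro suminf_le kcoef_summable m n mult_left_mono power_mono) (auto intro: less_imp_le)
      also have "\<dots> \<le> C * exp 1" using le[of 1] by simp
      also have "\<dots> \<le> C * exp 1 * exp (s powr m)" using C(1) by simp
      finally show ?thesis .
    qed
  qed (use C in auto)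
qed

lemma norm_kfun_le:
  assumes m: "m > 0" "m \<le> 1" and n: "n \<ge> 1"
  shows "norm (kfun m n t) \<le> (\<Sum>k. kcoef m n k * norm t ^ k)"
proof -
  have "norm (complex_of_real (kcoef m n k) * t ^ k) = kcoef m n k * norm t ^ k" for k
    using kcoef_pos[OF m(1) n, of k] by (simp add: norm_mult norm_power)
  then show ?thesis
    unfolding kfun_def using summable_norm[of "\<lambda>k. complex_of_real (kcoef m n k) * t ^ k"]
      kcoef_summable[OF m n, of "norm t"] by simp
qed

lemma norm_kfun_le_exp:
  assumes m: "m > 0" "m \<le> 1" and n: "n \<ge> 1"
  obtains C where "C > 0" "\<And>t. norm (kfun m n t) \<le> C * exp (norm t powr m)"
proof -
  obtain C where C: "C > 0" "\<And>s. s \<ge> 0 \<Longrightarrow> (\<Sum>k. kcoef m n k * s ^ k) \<le> C * exp (s powr m)"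
    using kcoef_suminf_le[OF m n] by blast
  show ?thesis
    by (rule that[OF C(1)]) (meson C(2) norm_ge_zero norm_kfun_le[OF m n] order_trans)
qed

section \<open>Second differences of the Taylor coefficients\<close>

lemma one_add_power_le:
  fixes h :: real
  assumes "0 \<le> h" "h \<le> 2"
  shows "(1 + h) ^ N \<le> 1 + real N * 3 ^ N * h"
proof (induction N)
  case (Suc N)
  have "(1 + h) ^ Suc N = (1 + h) ^ N + h * (1 + h) ^ N" by (simp add: algebra_simps)
  also have "\<dots> \<le> (1 + real N * 3 ^ N * h) + h * 3 ^ N"
    using Suc assms by (intro add_mono mult_left_mono power_mono) auto
  also have "\<dots> = 1 + real (Suc N) * 3 ^ N * h" by (simp add: algebra_simps)
  also have "\<dots> \<le> 1 + real (Suc N) * 3 ^ Suc N * h"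
    using assms by (intro add_left_mono mult_right_mono mult_left_mono power_increasing) auto
  finally show ?case .
qed simp

text \<open>The coefficients are log-concave with a gain of order \<open>1/k\<close> at most, which is what makes their
  second differences smaller than the coefficients by a factor \<open>1/k\<close> on average.\<close>

lemma kcoef_square_le:
  assumes m: "m > 0" "m \<le> 1" and n: "n \<ge> 1"
  obtains C where "C \<ge> 0"
    "\<And>k. kcoef m n (k + 1) ^ 2 \<le> (1 + C / real (k + 2)) * kcoef m n (k + 2) * kcoef m n k"
proof -
  define d where "d = 1 / m"
  have d: "d \<ge> 1" using m by (simp add: d_def)
  obtain N :: nat where N: "d \<le> real N" using real_arch_simple by blast
  \<comment> \<open>From (1 + h)^d <= 1 + N 3^N h with h = 2 / (n + k) <= 6 / (k + 2). The constant
    \<open>C\<close> comes from expanding (1 + 2/x) (1 + C1/x) with x >= 2.\<close>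
  define C1 where "C1 = 6 * real N * 3 ^ N"
  define C where "C = 2 + C1 + 2 * C1"
  have C1: "C1 \<ge> 0" by (simp add: C1_def)
  show ?thesis
  proof (rule that[of C])
    fix k :: nat
    define v where "v = real (n + k) / m"
    define x where "x = real (k + 2)"
    have x: "x \<ge> 2" by (simp add: x_def)
    have v: "v > 0" using m n by (simp add: v_def)
    have v1: "real (n + k + 1) / m = v + d" "real (n + k + 2) / m = v + d + d"
      by (simp_all add: v_def d_def add_divide_distrib)
    let ?G = "\<lambda>x. Gamma x :: real"
    have Gp: "?G v > 0" "?G (v + d) > 0" "?G (v + d + d) > 0"
      using v d by (auto intro!: Gamma_real_pos)
    \<comment> \<open>The step from v + d to v + 2 d is estimated from above, the step from v to v +
      d from below; the two powers of exponent d = 1/m differ by a factor 1 + O(1/k).\<close>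
    have "?G (v + d + d) \<le> ?G (v + d) * (v + d + d) powr d"
      using v d by (intro Gamma_add_le) auto
    then have "?G v * ?G (v + d + d) * v powr d \<le> (?G v * v powr d) * (?G (v + d) * (v + d + d) powr d)"
      using Gp v mult_left_mono[of "?G (v + d + d)" "?G (v + d) * (v + d + d) powr d" "?G v * v powr d"]
      by (simp add: mult_ac)
    also have "\<dots> \<le> ?G (v + d) * (?G (v + d) * (v + d + d) powr d)"
      using Gp v d by (intro mult_right_mono Gamma_add_ge) auto
    finally have g1: "?G v * ?G (v + d + d) * v powr d \<le> ?G (v + d) ^ 2 * (v + d + d) powr d"
      by (simp add: power2_eq_square mult_ac)
    have "(v + d + d) powr d = (v * (1 + 2 / real (n + k))) powr d"
    proof -
      have "real (n + k) > 0" using n by simp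
      moreover have "x / m * (1 + 2 / x) = x / m + 1 / m + 1 / m" if "x > 0" for x
        using that m by (simp add: field_simps)
      ultimately show ?thesis by (simp only: v_def d_def)
    qed
    also have "\<dots> = v powr d * (1 + 2 / real (n + k)) powr d"
      using v by (simp add: powr_mult)
    also have "(1 + 2 / real (n + k)) powr d \<le> (1 + 2 / real (n + k)) powr N"
      using N by (intro powr_mono) auto
    also have "\<dots> = (1 + 2 / real (n + k)) ^ N"
      using n by (intro powr_realpow add_pos_nonneg) auto
    also have "\<dots> \<le> 1 + real N * 3 ^ N * (2 / real (n + k))"
      using n by (intro one_add_power_le) (auto simp: field_simps)
    also have "\<dots> \<le> 1 + C1 / x"
    proof -
      have "2 / real (n + k) \<le> 6 / x"
        using n by (simp add: x_def field_simps)
      then have "real N * 3 ^ N * (2 / real (n + k)) \<le> real N * 3 ^ N * (6 / x)"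
        by (intro mult_left_mono) auto
      then show ?thesis by (simp add: C1_def mult_ac)
    qed
    finally have "(v + d + d) powr d \<le> v powr d * (1 + C1 / x)"
      using v by (simp add: mult_left_mono)
    then have "?G v * ?G (v + d + d) * v powr d \<le> ?G (v + d) ^ 2 * (v powr d * (1 + C1 / x))"
      using g1 by (meson mult_left_mono order_trans zero_le_power2)
    then have "(?G v * ?G (v + d + d)) * v powr d \<le> (?G (v + d) ^ 2 * (1 + C1 / x)) * v powr d"
      by (simp add: mult_ac)
    then have g2: "?G v * ?G (v + d + d) \<le> ?G (v + d) ^ 2 * (1 + C1 / x)"
      by (rule mult_right_le_imp_le) (use v in simp)
    \<comment> \<open>The other factor of the coefficient; its ratios are rational by the functional
      equation, and they contribute the factor 1 + 2/x.\<close>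
    define P where "P i = Gamma (real (n + i)) / fact i" for i
    have Pp: "P i > 0" for i using n by (auto simp: P_def intro!: divide_pos_pos Gamma_real_pos)
    have PS: "P (i + 1) * real (i + 1) = real (n + i) * P i" for i
    proof -
      have "Gamma (real (n + i) + 1) = real (n + i) * Gamma (real (n + i))"
        using n by (intro Gamma_plus1) auto
      then have "Gamma (real (n + (i + 1))) = real (n + i) * Gamma (real (n + i))"
        by (simp add: add_ac)
      then have "P (i + 1) = real (n + i) * Gamma (real (n + i)) / (real (i + 1) * fact i)"
        unfolding P_def by simp
      then show ?thesis by (simp add: P_def del: of_nat_Suc)
    qed
    have "P (k + 1) ^ 2 \<le> (1 + 2 / x) * (P (k + 2) * P k)"
    proof -
      have e1: "P (k + 1) = real (n + k) * P k / real (k + 1)"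
        using PS[of k] by (simp add: field_simps)
      have e2: "P (k + 2) = real (n + k + 1) * P (k + 1) / real (k + 2)"
        using PS[of "k + 1"] by (simp add: field_simps)
      have "P (k + 1) ^ 2 = P (k + 1) * P k * (real (n + k) / real (k + 1))"
        unfolding power2_eq_square using arg_cong[OF e1, of "\<lambda>z. P (k + 1) * z"] by (simp add: mult_ac)
      also have "\<dots> \<le> P (k + 1) * P k * ((1 + 2 / x) * (real (n + k + 1) / real (k + 2)))"
      proof (intro mult_left_mono)
        have "real (n + k) / real (k + 1) \<le> real (n + k + 1) / real (k + 1)"
          by (simp add: divide_right_mono)
        also have "\<dots> = (real (k + 2) / real (k + 1)) * (real (n + k + 1) / real (k + 2))"
        proof -
          have "X / r = (q / r) * (X / q)" if "q \<noteq> 0" for X r q :: real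
            using that by simp
          then show ?thesis by (metis of_nat_eq_0_iff add_is_0 zero_neq_numeral)
        qed
        also have "\<dots> \<le> (1 + 2 / x) * (real (n + k + 1) / real (k + 2))"
          by (intro mult_right_mono) (simp_all add: x_def field_simps)
        finally show "real (n + k) / real (k + 1) \<le> (1 + 2 / x) * (real (n + k + 1) / real (k + 2))" .
      qed (use Pp[of k] Pp[of "k+1"] in auto)
      also have "\<dots> = (1 + 2 / x) * (P (k + 2) * P k)"
        unfolding e2 by (simp add: mult_ac)
      finally show ?thesis .
    qed
    then have "P (k + 1) ^ 2 * (?G v * ?G (v + d + d)) \<le> ((1 + 2 / x) * (P (k + 2) * P k)) * (?G (v + d) ^ 2 * (1 + C1 / x))"
      using Gp Pp[of k] Pp[of "k+2"] x by (intro mult_mono[OF _ g2]) auto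
    also have "\<dots> = ((1 + 2 / x) * (1 + C1 / x)) * (P (k + 2) * P k * ?G (v + d) ^ 2)"
      by (simp add: mult_ac)
    also have "\<dots> \<le> (1 + C / x) * (P (k + 2) * P k * ?G (v + d) ^ 2)"
    proof (intro mult_right_mono)
      define y where "y = 1 / x"
      have "2 * C1 * y * y \<le> 2 * C1 * y * 1" using C1 x by (intro mult_left_mono) (auto simp: y_def)
      then have "(1 + 2 * y) * (1 + C1 * y) \<le> 1 + C * y"
        by (simp add: C_def algebra_simps)
      then show "(1 + 2 / x) * (1 + C1 / x) \<le> 1 + C / x"
        by (simp add: y_def)
    qed (use Pp[of k] Pp[of "k+2"] in auto)
    finally have fin: "P (k + 1) ^ 2 * (?G v * ?G (v + d + d)) \<le> (1 + C / x) * (P (k + 2) * P k * ?G (v + d) ^ 2)" .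
    have "kcoef m n (k + 1) = P (k + 1) / ?G (v + d)" "kcoef m n (k + 2) = P (k + 2) / ?G (v + d + d)"
      "kcoef m n k = P k / ?G v"
      using v1 by (simp_all add: kcoef_def P_def v_def add_ac)
    moreover have "(p1 / G1) ^ 2 \<le> Q * (p2 / G2) * (p0 / G0)"
      if "p1 ^ 2 * (G0 * G2) \<le> Q * (p2 * p0 * G1 ^ 2)" "G0 > 0" "G1 > 0" "G2 > 0"
      for p0 p1 p2 G0 G1 G2 Q :: real
    proof -
      have "p1 ^ 2 * (G0 * G2) / (G1 ^ 2 * (G0 * G2)) \<le> Q * (p2 * p0 * G1 ^ 2) / (G1 ^ 2 * (G0 * G2))"
        using that by (intro divide_right_mono) auto
      then show ?thesis using that by (simp add: power_divide mult_ac)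
    qed
    ultimately show "kcoef m n (k + 1) ^ 2 \<le> (1 + C / real (k + 2)) * kcoef m n (k + 2) * kcoef m n k"
      using fin Gp unfolding x_def by metis
  qed (use C1 in \<open>simp add: C_def\<close>)
qed

text \<open>The second difference \<open>B k\<close> plus the defect \<open>e k\<close> dominates a square divided by \<open>a k\<close>, hence
  \<open>\<bar>B k\<bar> \<le> B k + 2 * e k\<close>; the sum of \<open>B\<close> telescopes, so only the defects contribute.\<close>

lemma second_difference_bound:
  fixes a :: "nat \<Rightarrow> real" and t :: complex
  assumes pos: "\<And>k. a k > 0" and sa: "summable a" and C: "C \<ge> 0"
    and sq: "\<And>k. a (k + 1) ^ 2 \<le> (1 + C / real (k + 2)) * a (k + 2) * a k"
    and t: "norm t = 1"
  shows "norm (\<Sum>k. complex_of_real (a k) * t ^ k) * norm (1 - t) ^ 2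
           \<le> (4 + 4 * C) * (\<Sum>k. a k / real (k + 1))"
proof -
  define B where "B k = a (k + 2) - 2 * a (k + 1) + a k" for k
  define e where "e k = C * a (k + 2) / real (k + 2)" for k
  define A where "A k = complex_of_real (a k) * t ^ k" for k
  define G where "G = (\<Sum>k. a k / real (k + 1))"
  have e0: "e k \<ge> 0" for k using pos[of "k+2"] C by (simp add: e_def less_imp_le)
  have sG: "summable (\<lambda>k. a k / real (k + 1))"
  proof (rule summable_comparison_test_ev[OF _ sa], intro always_eventually allI)
    fix k
    have "a k / real (k + 1) \<le> a k / 1" using pos[of k] by (intro divide_left_mono) auto
    then show "norm (a k / real (k + 1)) \<le> a k" using pos[of k] by simp
  qed
  have sG2: "summable (\<lambda>k. a (k + 2) / real (k + 2 + 1))"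
    using sG by (subst summable_iff_shift)
  have e_le: "e k \<le> 2 * C * (a (k + 2) / real (k + 2 + 1))" for k
  proof -
    have "a (k + 2) / real (k + 2) \<le> 2 * (a (k + 2) / real (k + 2 + 1))"
      using pos[of "k+2"] by (simp add: field_simps)
    from mult_left_mono[OF this C] show ?thesis by (simp add: e_def mult_ac)
  qed
  have se: "summable e"
    by (rule summable_comparison_test_ev[OF _ summable_mult[OF sG2, of "2 * C"]])
      (use e_le e0 in \<open>auto intro!: always_eventually\<close>)
  have absB: "\<bar>B k\<bar> \<le> B k + 2 * e k" for k
  proof -
    have "a (k + 1) ^ 2 / a k \<le> a (k + 2) + e k"
      using sq[of k] pos[of k] by (simp add: e_def field_simps)
    moreover have "a (k + 1) ^ 2 / a k - 2 * a (k + 1) + a k = (a (k + 1) - a k) ^ 2 / a k"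
      using pos[of k] by (simp add: field_simps power2_eq_square)
    moreover have "(a (k + 1) - a k) ^ 2 / a k \<ge> 0" using pos[of k] by simp
    ultimately have "B k + e k \<ge> 0" by (simp add: B_def)
    then show ?thesis using e0[of k] by linarith
  qed
  have s1: "summable (\<lambda>k. a (k + 1))" "summable (\<lambda>k. a (k + 2))"
    using sa by (subst summable_iff_shift, assumption)+
  have sB: "summable B" unfolding B_def
    by (intro summable_add summable_diff summable_mult s1 sa)
  have sumB: "suminf B = a 0 - a 1"
  proof -
    have "suminf B = (\<Sum>k. a (k + 2)) - 2 * (\<Sum>k. a (k + 1)) + suminf a"
      unfolding B_def using s1 sa
      by (simp add: suminf_add[symmetric] suminf_diff[symmetric] suminf_mult summable_diff summable_mult)
    moreover have "suminf a = (\<Sum>k. a (k + 1)) + a 0"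
      using suminf_split_initial_segment[OF sa, of 1] by simp
    moreover have "suminf a = (\<Sum>k. a (k + 2)) + a 0 + a 1"
      using suminf_split_initial_segment[OF sa, of 2] by (simp add: numeral_2_eq_2)
    ultimately show ?thesis by simp
  qed
  have sabs: "summable (\<lambda>k. \<bar>B k\<bar>)"
    by (rule summable_comparison_test_ev[OF _ summable_add[OF sB summable_mult[OF se, of 2]]])
      (use absB in \<open>auto intro!: always_eventually\<close>)
  have "(\<Sum>k. \<bar>B k\<bar>) \<le> (\<Sum>k. B k + 2 * e k)"
    by (intro suminf_le absB sabs summable_add sB summable_mult se)
  also have "\<dots> = a 0 - a 1 + 2 * suminf e"
    using sB se by (simp add: suminf_add[symmetric] summable_mult suminf_mult sumB)
  also have "suminf e \<le> (\<Sum>k. 2 * C * (a (k + 2) / real (k + 2 + 1)))"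
    by (intro suminf_le e_le se summable_mult sG2)
  also have "\<dots> = 2 * C * (\<Sum>k. a (k + 2) / real (k + 2 + 1))"
    by (rule suminf_mult[OF sG2])
  also have "(\<Sum>k. a (k + 2) / real (k + 2 + 1)) \<le> G"
    unfolding G_def using suminf_split_initial_segment[OF sG, of 2] pos
    by (simp add: sum_nonneg less_imp_le numeral_2_eq_2 add_nonneg_nonneg)
  finally have absB_sum: "(\<Sum>k. \<bar>B k\<bar>) \<le> a 0 - a 1 + 4 * C * G"
    using C by (simp add: mult_left_mono)
  \<comment> \<open>The series \<open>G\<close> starts with a 0 / 1, so it also absorbs the boundary
    terms of the summation by parts.\<close>
  have a0: "a 0 \<le> G"
    unfolding G_def using sum_le_suminf[OF sG, of "{0}"] pos by (simp add: less_imp_le)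
  have nA: "norm (A k) = a k" for k
    using pos[of k] t by (simp add: A_def norm_mult norm_power)
  have sA: "summable A"
    using sa by (intro summable_norm_cancel[of A]) (simp add: nA)
  have sA1: "summable (\<lambda>k. A (k + 1))" "summable (\<lambda>k. A (k + 2))"
    using sA by (subst summable_iff_shift, assumption)+
  have F1: "suminf A = (\<Sum>k. A (k + 1)) + A 0"
    using suminf_split_initial_segment[OF sA, of 1] by simp
  have F2: "suminf A = (\<Sum>k. A (k + 2)) + A 0 + A 1"
    using suminf_split_initial_segment[OF sA, of 2] by (simp add: numeral_2_eq_2)
  \<comment> \<open>Summation by parts twice: since A k = a k t^k, the second difference of the
    coefficients corresponds to multiplication by (1 - t)^2, up to the boundary terms in A 0 and A
    1.\<close>
  have "(\<Sum>k. complex_of_real (B k) * t ^ (k + 2)) = (\<Sum>k. A (k + 2) - 2 * t * A (k + 1) + t ^ 2 * A k)"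
    by (simp add: B_def A_def algebra_simps power_add power2_eq_square)
  also have "\<dots> = (\<Sum>k. A (k + 2)) - 2 * t * (\<Sum>k. A (k + 1)) + t ^ 2 * suminf A"
    using sA1 sA by (simp add: suminf_add[symmetric] suminf_diff[symmetric] suminf_mult summable_diff summable_mult)
  also have "\<dots> = (suminf A - A 0 - A 1) - 2 * t * (suminf A - A 0) + t ^ 2 * suminf A"
  proof -
    have "(\<Sum>k. A (k + 1)) = suminf A - A 0" by (subst F1) simp
    moreover have "(\<Sum>k. A (k + 2)) = suminf A - A 0 - A 1" by (subst F2) simp
    ultimately show ?thesis by (simp only:)
  qed
  finally have "(1 - t) ^ 2 * suminf A = (\<Sum>k. complex_of_real (B k) * t ^ (k + 2)) + (A 0 + A 1 - 2 * t * A 0)"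
    by (simp add: algebra_simps power2_eq_square)
  then have "norm (suminf A) * norm (1 - t) ^ 2
      = norm ((\<Sum>k. complex_of_real (B k) * t ^ (k + 2)) + (A 0 + A 1 - 2 * t * A 0))"
    by (metis mult.commute norm_mult norm_power)
  also have "\<dots> \<le> norm (\<Sum>k. complex_of_real (B k) * t ^ (k + 2)) + (norm (A 0) + norm (A 1) + norm (2 * t * A 0))"
    by (intro order_trans[OF norm_triangle_ineq] add_mono order_refl order_trans[OF norm_triangle_ineq4])
  also have "norm (2 * t * A 0) = 2 * a 0" using t by (simp add: norm_mult nA)
  also have "norm (\<Sum>k. complex_of_real (B k) * t ^ (k + 2)) \<le> (\<Sum>k. \<bar>B k\<bar>)"
    using summable_norm[of "\<lambda>k. complex_of_real (B k) * t ^ (k + 2)"] sabs t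
    by (simp add: norm_mult norm_power)
  \<comment> \<open>The term - a 1 of the telescoped sum cancels norm (A 1), so only multiples of a
    0 and \<open>G\<close> remain.\<close>
  also have "(\<Sum>k. \<bar>B k\<bar>) + (norm (A 0) + norm (A 1) + 2 * a 0) \<le> 4 * a 0 + 4 * C * G"
    using absB_sum by (simp add: nA)
  also have "\<dots> \<le> (4 + 4 * C) * G" using a0 by (simp add: algebra_simps)
  finally show ?thesis unfolding A_def G_def by simp
qed

section \<open>Mean of the kernel function over circles\<close>

lemma half_abs_le_abs_sin:
  fixes x :: real
  assumes "\<bar>x\<bar> \<le> pi / 2"
  shows "\<bar>x\<bar> / 2 \<le> \<bar>sin x\<bar>"
proof -
  have *: "y / 2 \<le> sin y" if y: "0 \<le> y" "y \<le> pi / 2" for y :: real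
  proof -
    have "\<bar>sin y - (\<Sum>m<3. sin_coeff m * y ^ m)\<bar> \<le> inverse (fact 3) * \<bar>y\<bar> ^ 3"
      by (rule Maclaurin_sin_bound)
    then have "\<bar>sin y - y\<bar> \<le> y ^ 3 / 6"
      using y by (simp add: sin_coeff_def numeral_3_eq_3 fact_numeral)
    then have "sin y \<ge> y - y ^ 3 / 6" by linarith
    moreover have "y ^ 3 \<le> 3 * y"
    proof -
      have "pi \<le> 32 / 10" using pi_approx(2) by simp
      then have "y \<le> 16 / 10" using y by linarith
      then have "y ^ 2 \<le> (16 / 10) ^ 2" using y by (intro power_mono)
      then have "y ^ 2 \<le> 3" by (simp add: power_divide)
      then have "y ^ 2 * y \<le> 3 * y" using y(1) by (rule mult_right_mono)
      then show ?thesis by (simp add: power3_eq_cube power2_eq_square)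
    qed
    ultimately show ?thesis by simp
  qed
  show ?thesis
    using *[of x] *[of "- x"] assms by (cases "x \<ge> 0") auto
qed

text \<open>The antiderivative is an arctangent, whose total variation is at most pi for every shift
  c.\<close>

lemma nn_integral_inverse_quadratic_le:
  fixes l c :: real
  assumes l: "l > 0"
  shows "(\<integral>\<^sup>+\<theta>. ennreal (1 / (l\<^sup>2 + (\<theta> + c)\<^sup>2 / 4)) * indicator {- pi..pi} \<theta> \<partial>lborel) \<le> ennreal (2 * pi / l)"
proof -
  define F where "F \<theta> = 2 / l * arctan ((\<theta> + c) / (2 * l))" for \<theta>
  have der: "(F has_real_derivative (1 / (l\<^sup>2 + (\<theta> + c)\<^sup>2 / 4))) (at \<theta>)" for \<theta>
  proof -
    have d1: "((\<lambda>\<theta>. (\<theta> + c) / (2 * l)) has_real_derivative 1 / (2 * l)) (at \<theta>)"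
      using DERIV_cdivide[OF DERIV_add[OF DERIV_ident DERIV_const[of c]], of "2 * l"] by simp
    have "(F has_real_derivative (2 / l * (inverse (1 + ((\<theta> + c) / (2 * l))\<^sup>2) * (1 / (2 * l))))) (at \<theta>)"
      unfolding F_def using DERIV_cmult[OF DERIV_chain2[OF DERIV_arctan d1], of "2 / l"] by simp
    moreover have "2 / l * (inverse (1 + ((\<theta> + c) / (2 * l))\<^sup>2) * (1 / (2 * l))) = 1 / (l\<^sup>2 + (\<theta> + c)\<^sup>2 / 4)"
    proof -
      have "l\<^sup>2 * (1 + ((\<theta> + c) / (2 * l))\<^sup>2) = l\<^sup>2 + (\<theta> + c)\<^sup>2 / 4"
        unfolding distrib_left using l by (simp add: power_divide power_mult_distrib)
      moreover have "2 / l * (inverse X * (1 / (2 * l))) = 1 / (l\<^sup>2 * X)" for X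
        using l by (cases "X = 0") (simp_all add: field_simps power2_eq_square)
      ultimately show ?thesis by (simp only:)
    qed
    ultimately show ?thesis by simp
  qed
  have "(\<integral>\<^sup>+\<theta>. ennreal (1 / (l\<^sup>2 + (\<theta> + c)\<^sup>2 / 4)) * indicator {- pi..pi} \<theta> \<partial>lborel) = ennreal (F pi - F (- pi))"
  proof (rule nn_integral_FTC_Icc)
    show "(F has_real_derivative 1 / (l\<^sup>2 + (\<theta> + c)\<^sup>2 / 4)) (at \<theta>)" for \<theta> by (rule der)
    show "0 \<le> 1 / (l\<^sup>2 + (\<theta> + c)\<^sup>2 / 4)" for \<theta> by simp
  qed auto
  also have "\<dots> \<le> ennreal (2 * pi / l)"
  proof (intro ennreal_leI)
    have "arctan ((pi + c) / (2 * l)) - arctan ((- pi + c) / (2 * l)) \<le> pi"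
      using arctan_bounded[of "(pi + c) / (2 * l)"] arctan_bounded[of "(- pi + c) / (2 * l)"] by linarith
    then have "2 / l * (arctan ((pi + c) / (2 * l)) - arctan ((- pi + c) / (2 * l))) \<le> 2 / l * pi"
      using l by (intro mult_left_mono) auto
    then show "F pi - F (- pi) \<le> 2 * pi / l"
      by (simp add: F_def right_diff_distrib)
  qed
  finally show ?thesis .
qed

text \<open>The two bounds combine to h (l^2 + w^2) <= P l^2 + Q for the chord w, and the chord is
  at least half the arc. Integrating 1 / (l^2 + arc^2 / 4) costs 2 pi / l, which gives P l + Q / l
  with the width l still free.\<close>

lemma angular_integral_le:
  fixes h :: "real \<Rightarrow> real" and P Q l \<phi> :: real
  assumes l: "l > 0" and P: "P \<ge> 0" and Q: "Q \<ge> 0" and \<phi>: "\<bar>\<phi>\<bar> \<le> pi"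
    and hP: "\<And>\<theta>. 0 \<le> h \<theta>" "\<And>\<theta>. h \<theta> \<le> P" and hQ: "\<And>\<theta>. h \<theta> * (norm (1 - cis (\<theta> + \<phi>)))\<^sup>2 \<le> Q"
  shows "(\<integral>\<^sup>+\<theta>. ennreal (h \<theta>) * indicator {- pi..pi} \<theta> \<partial>lborel) \<le> ennreal (6 * pi * (P * l + Q / l))"
proof -
  define g where "g c \<theta> = 1 / (l\<^sup>2 + (\<theta> + c)\<^sup>2 / 4)" for c \<theta> :: real
  have g0: "g c \<theta> \<ge> 0" for c \<theta> by (simp add: g_def add_nonneg_nonneg)
  have pt: "h \<theta> \<le> (P * l\<^sup>2 + Q) * (g \<phi> \<theta> + g (\<phi> - 2 * pi) \<theta> + g (\<phi> + 2 * pi) \<theta>)"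
    if \<theta>: "\<theta> \<in> {- pi..pi}" for \<theta>
  proof -
    define w where "w = norm (1 - cis (\<theta> + \<phi>))"
    have *: "h \<theta> \<le> (P * l\<^sup>2 + Q) * g c \<theta>" if c: "\<bar>\<theta> + c\<bar> \<le> pi" "cis (\<theta> + c) = cis (\<theta> + \<phi>)" for c
    proof -
      have "w = norm (exp (\<i> * complex_of_real (\<theta> + c)) - 1)"
        unfolding w_def c(2)[symmetric] by (simp add: cis_conv_exp norm_minus_commute)
      also have "\<dots> = 2 * \<bar>sin ((\<theta> + c) / 2)\<bar>" by (rule dist_exp_i_1)
      finally have "w \<ge> \<bar>\<theta> + c\<bar> / 2" using half_abs_le_abs_sin[of "(\<theta> + c) / 2"] c(1) by simp
      then have "(\<bar>\<theta> + c\<bar> / 2)\<^sup>2 \<le> w\<^sup>2" by (intro power_mono) auto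
      then have "h \<theta> * (l\<^sup>2 + (\<theta> + c)\<^sup>2 / 4) \<le> h \<theta> * (l\<^sup>2 + w\<^sup>2)"
        using hP(1)[of \<theta>] by (intro mult_left_mono) (auto simp: power_divide)
      also have "\<dots> \<le> P * l\<^sup>2 + Q"
        using hQ[of \<theta>] mult_right_mono[OF hP(2)[of \<theta>], of "l\<^sup>2"] by (simp add: w_def algebra_simps)
      finally have "h \<theta> * (l\<^sup>2 + (\<theta> + c)\<^sup>2 / 4) \<le> P * l\<^sup>2 + Q" .
      moreover have "l\<^sup>2 + (\<theta> + c)\<^sup>2 / 4 > 0" using l by (intro add_pos_nonneg) auto
      ultimately show ?thesis unfolding g_def by (simp add: pos_le_divide_eq)
    qed
    have PQ: "P * l\<^sup>2 + Q \<ge> 0" using P Q by simp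
    \<comment> \<open>The sum of two angles in [-pi, pi] may leave that interval; one of three
      shifts by multiples of 2 pi brings it back. Adding the three majorants avoids a case
      distinction under the integral.\<close>
    have "h \<theta> \<le> (P * l\<^sup>2 + Q) * g \<phi> \<theta> \<or> h \<theta> \<le> (P * l\<^sup>2 + Q) * g (\<phi> - 2 * pi) \<theta>
       \<or> h \<theta> \<le> (P * l\<^sup>2 + Q) * g (\<phi> + 2 * pi) \<theta>"
    proof -
      have c: "cis (\<theta> + (\<phi> - 2 * pi)) = cis (\<theta> + \<phi>)" "cis (\<theta> + (\<phi> + 2 * pi)) = cis (\<theta> + \<phi>)"
        by (simp_all add: complex_eq_iff cos_add sin_add cos_diff sin_diff add.assoc[symmetric] add_diff_eq)
      consider "\<bar>\<theta> + \<phi>\<bar> \<le> pi" | "\<bar>\<theta> + (\<phi> - 2 * pi)\<bar> \<le> pi" | "\<bar>\<theta> + (\<phi> + 2 * pi)\<bar> \<le> pi"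
      proof -
        have b: "- pi \<le> \<theta>" "\<theta> \<le> pi" "- pi \<le> \<phi>" "\<phi> \<le> pi" using \<theta> \<phi> by auto
        consider "\<theta> + \<phi> > pi" | "\<theta> + \<phi> < - pi" | "\<bar>\<theta> + \<phi>\<bar> \<le> pi" by linarith
        then show thesis using that b by cases (auto simp: abs_le_iff)
      qed
      then show ?thesis using *[of \<phi>] *[OF _ c(1)] *[OF _ c(2)] by cases auto
    qed
    note disj = this
    have nn: "(P * l\<^sup>2 + Q) * g c \<theta> \<ge> 0" for c using PQ g0 by simp
    show ?thesis
    proof -
      have "X \<ge> 0 \<Longrightarrow> Y \<ge> 0 \<Longrightarrow> Z \<ge> 0 \<Longrightarrow> h \<theta> \<le> X \<or> h \<theta> \<le> Y \<or> h \<theta> \<le> Z \<Longrightarrow> h \<theta> \<le> X + Y + Z" for X Y Z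
        by linarith
      then show ?thesis unfolding distrib_left
        using disj nn by blast
    qed
  qed
  have [measurable]: "g c \<in> borel_measurable borel" for c unfolding g_def by measurable
  have "(\<integral>\<^sup>+\<theta>. ennreal (h \<theta>) * indicator {- pi..pi} \<theta> \<partial>lborel) \<le>
    (\<integral>\<^sup>+\<theta>. ennreal (P * l\<^sup>2 + Q) * (ennreal (g \<phi> \<theta>) * indicator {- pi..pi} \<theta>
      + ennreal (g (\<phi> - 2 * pi) \<theta>) * indicator {- pi..pi} \<theta> + ennreal (g (\<phi> + 2 * pi) \<theta>) * indicator {- pi..pi} \<theta>) \<partial>lborel)"
  proof (intro nn_integral_mono)
    fix \<theta>
    show "ennreal (h \<theta>) * indicator {- pi..pi} \<theta> \<le> ennreal (P * l\<^sup>2 + Q) * (ennreal (g \<phi> \<theta>) * indicator {- pi..pi} \<theta>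
      + ennreal (g (\<phi> - 2 * pi) \<theta>) * indicator {- pi..pi} \<theta> + ennreal (g (\<phi> + 2 * pi) \<theta>) * indicator {- pi..pi} \<theta>)"
    proof (cases "\<theta> \<in> {- pi..pi}")
      case True
      have "ennreal (h \<theta>) \<le> ennreal ((P * l\<^sup>2 + Q) * (g \<phi> \<theta> + g (\<phi> - 2 * pi) \<theta> + g (\<phi> + 2 * pi) \<theta>))"
        by (intro ennreal_leI pt True)
      also have "\<dots> = ennreal (P * l\<^sup>2 + Q) * (ennreal (g \<phi> \<theta>) + ennreal (g (\<phi> - 2 * pi) \<theta>) + ennreal (g (\<phi> + 2 * pi) \<theta>))"
        using P Q g0 by (subst ennreal_mult) (auto simp: add_nonneg_nonneg)
      finally show ?thesis using True by simp
    qed simp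
  qed
  also have "\<dots> = ennreal (P * l\<^sup>2 + Q) * ((\<integral>\<^sup>+\<theta>. ennreal (g \<phi> \<theta>) * indicator {- pi..pi} \<theta> \<partial>lborel)
      + (\<integral>\<^sup>+\<theta>. ennreal (g (\<phi> - 2 * pi) \<theta>) * indicator {- pi..pi} \<theta> \<partial>lborel)
      + (\<integral>\<^sup>+\<theta>. ennreal (g (\<phi> + 2 * pi) \<theta>) * indicator {- pi..pi} \<theta> \<partial>lborel))"
    by (simp add: nn_integral_cmult nn_integral_add)
  also have "\<dots> \<le> ennreal (P * l\<^sup>2 + Q) * (ennreal (2 * pi / l) + ennreal (2 * pi / l) + ennreal (2 * pi / l))"
    unfolding g_def using l by (intro mult_left_mono add_mono nn_integral_inverse_quadratic_le) auto
  also have "\<dots> = ennreal ((P * l\<^sup>2 + Q) * (2 * pi / l + 2 * pi / l + 2 * pi / l))"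
    using l P Q by (simp add: ennreal_mult[symmetric] ennreal_plus[symmetric] del: ennreal_plus)
  also have "(P * l\<^sup>2 + Q) * (2 * pi / l + 2 * pi / l + 2 * pi / l) = 6 * pi * (P * l + Q / l)"
    using l by (simp add: field_simps power2_eq_square)
  finally show ?thesis .
qed

text \<open>The bound is a pair of power series in |t|, so that it can be integrated over y term by
  term. The summand 1 covers |t| < 1 as well as the term k = 0 of the first series, which would
  carry the negative exponent - m / 2.\<close>

lemma kfun_circle_integral_le:
  assumes m: "m > 0" "m \<le> 1" and n: "n \<ge> 1"
  obtains C where "C > 0"
    "\<And>t. (\<integral>\<^sup>+\<theta>. ennreal (norm (kfun m n (cis \<theta> * t))) * indicator {- pi..pi} \<theta> \<partial>lborel) \<le>
       ennreal C * (1 + (\<Sum>k. ennreal (kcoef m n (k + 1) * norm t powr (real (k + 1) - m / 2)))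
         + (\<Sum>k. ennreal (kcoef m n k / real (k + 1) * norm t powr (real k + m / 2))))"
proof -
  obtain C0 where C0: "C0 \<ge> 0"
    "\<And>k. kcoef m n (k + 1) ^ 2 \<le> (1 + C0 / real (k + 2)) * kcoef m n (k + 2) * kcoef m n k"
    using kcoef_square_le[OF m n] by blast
  have pos: "kcoef m n k > 0" for k by (rule kcoef_pos[OF m(1) n])
  define F1 where "F1 = (\<Sum>k. kcoef m n k * 1 ^ k)"
  have F1: "F1 > 0"
    unfolding F1_def using kcoef_summable[OF m n, of 1] pos by (intro suminf_pos) auto
  define C where "C = 6 * pi * (kcoef m n 0 + 1 + (4 + 4 * C0)) + 2 * pi * F1"
  have C: "C > 0" using F1 pos[of 0] C0(1) by (simp add: C_def add_nonneg_pos)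
  show ?thesis
  proof (rule that[of C])
    fix t :: complex
    define s where "s = norm t"
    define S1 where "S1 = (\<Sum>k. ennreal (kcoef m n (k + 1) * s powr (real (k + 1) - m / 2)))"
    define S2 where "S2 = (\<Sum>k. ennreal (kcoef m n k / real (k + 1) * s powr (real k + m / 2)))"
    have "(\<integral>\<^sup>+\<theta>. ennreal (norm (kfun m n (cis \<theta> * t))) * indicator {- pi..pi} \<theta> \<partial>lborel) \<le> ennreal C * (1 + S1 + S2)"
    proof (cases "s < 1")
      case True
      have "norm (kfun m n (cis \<theta> * t)) \<le> F1" for \<theta>
      proof -
        have "norm (kfun m n (cis \<theta> * t)) \<le> (\<Sum>k. kcoef m n k * s ^ k)"
          using norm_kfun_le[OF m n, of "cis \<theta> * t"] by (simp add: norm_mult s_def)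
        also have "\<dots> \<le> F1"
          unfolding F1_def using True pos
          by (intro suminf_le kcoef_summable m n mult_left_mono power_mono) (auto simp: s_def less_imp_le)
        finally show ?thesis .
      qed
      then have "(\<integral>\<^sup>+\<theta>. ennreal (norm (kfun m n (cis \<theta> * t))) * indicator {- pi..pi} \<theta> \<partial>lborel)
          \<le> (\<integral>\<^sup>+\<theta>. ennreal F1 * indicator {- pi..pi} \<theta> \<partial>lborel)"
        by (intro nn_integral_mono mult_right_mono ennreal_leI) auto
      also have "\<dots> = ennreal (F1 * (2 * pi))"
        using F1 by (simp add: nn_integral_cmult_indicator ennreal_mult)
      also have "\<dots> \<le> ennreal C"
        using pos[of 0] C0(1) by (intro ennreal_leI) (simp add: C_def less_imp_le)
      also have "\<dots> \<le> ennreal C * (1 + S1 + S2)"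
        by (simp add: distrib_left add.assoc add_increasing2)
      finally show ?thesis .
    next
      case False
      then have s: "s \<ge> 1" by simp
      define a where "a k = kcoef m n k * s ^ k" for k
      define P where "P = suminf a"
      define G where "G = (\<Sum>k. a k / real (k + 1))"
      \<comment> \<open>Balances P l against G / l: the terms a k concentrate at k of order s^m,
        hence \<open>G\<close> is expected to be of size P s^(-m).\<close>
      define l where "l = s powr (- (m / 2))"
      have l: "l > 0" using s by (simp add: l_def)
      have l1: "l \<le> 1" using s m by (simp add: l_def powr_minus ge_one_powr_ge_zero inverse_le_1_iff)
      have apos: "a k > 0" for k using pos[of k] s by (simp add: a_def)
      have apos0: "a k \<ge> 0" for k using apos[of k] by simp
      have sa: "summable a" unfolding a_def using s by (intro kcoef_summable m n) auto
      have sG: "summable (\<lambda>k. a k / real (k + 1))"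
      proof (rule summable_comparison_test_ev[OF _ sa], intro always_eventually allI)
        fix k
        have "a k / real (k + 1) \<le> a k / 1" using apos[of k] by (intro divide_left_mono) auto
        then show "norm (a k / real (k + 1)) \<le> a k" using apos[of k] by simp
      qed
      have sa1: "summable (\<lambda>k. a (k + 1))" using sa by (subst summable_iff_shift)
      have G0: "G \<ge> 0" unfolding G_def using apos by (intro suminf_nonneg sG) (simp add: less_imp_le)
      have P0: "P \<ge> 0" unfolding P_def using apos by (intro suminf_nonneg sa) (simp add: less_imp_le)
      have asq: "a (k + 1) ^ 2 \<le> (1 + C0 / real (k + 2)) * a (k + 2) * a k" for k
      proof -
        have "a (k + 1) ^ 2 = kcoef m n (k + 1) ^ 2 * s ^ (2 * k + 2)"
          by (simp add: a_def power_mult_distrib power_mult power2_eq_square mult_ac)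
        also have "\<dots> \<le> ((1 + C0 / real (k + 2)) * kcoef m n (k + 2) * kcoef m n k) * s ^ (2 * k + 2)"
          using C0(2) s by (intro mult_right_mono) auto
        also have "\<dots> = (1 + C0 / real (k + 2)) * a (k + 2) * a k"
          by (simp add: a_def power_add power_mult power2_eq_square mult_ac)
        finally show ?thesis .
      qed
      have "(\<integral>\<^sup>+\<theta>. ennreal (norm (kfun m n (cis \<theta> * t))) * indicator {- pi..pi} \<theta> \<partial>lborel)
          \<le> ennreal (6 * pi * (P * l + ((4 + 4 * C0) * G) / l))"
      proof (rule angular_integral_le[OF l P0])
        show "0 \<le> (4 + 4 * C0) * G" using C0(1) G0 by simp
        show "\<bar>Arg t\<bar> \<le> pi" using Arg_bounded[of t] by auto
        have ts: "cis \<theta> * t = complex_of_real s * cis (\<theta> + Arg t)" for \<theta>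
        proof -
          have "t = complex_of_real s * cis (Arg t)"
            using rcis_cmod_Arg[of t] by (simp add: rcis_def s_def)
          then have "cis \<theta> * t = complex_of_real s * (cis \<theta> * cis (Arg t))"
            by (metis mult.left_commute)
          then show ?thesis by (simp only: cis_mult)
        qed
        have k: "kfun m n (cis \<theta> * t) = (\<Sum>k. complex_of_real (a k) * cis (\<theta> + Arg t) ^ k)" for \<theta>
          unfolding kfun_def ts by (simp add: a_def power_mult_distrib mult_ac)
        show "norm (kfun m n (cis \<theta> * t)) * (norm (1 - cis (\<theta> + Arg t)))\<^sup>2 \<le> (4 + 4 * C0) * G" for \<theta>
          unfolding k G_def by (intro second_difference_bound apos sa C0 asq) auto
        show "norm (kfun m n (cis \<theta> * t)) \<le> P" for \<theta>
          unfolding P_def a_def using norm_kfun_le[OF m n, of "cis \<theta> * t"] by (simp add: norm_mult s_def)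
      qed auto
      also have "\<dots> \<le> ennreal (C * (1 + (\<Sum>k. a (k + 1) * l) + (\<Sum>k. a k / real (k + 1) / l)))"
      proof (intro ennreal_leI)
        \<comment> \<open>The term k = 0 is split off and bounded by kcoef m n 0, using l <=
          1.\<close>
        have "P * l = a 0 * l + (\<Sum>k. a (k + 1) * l)"
          unfolding P_def using suminf_split_initial_segment[OF sa, of 1] suminf_mult2[OF sa1, of l]
          by (simp add: algebra_simps)
        also have "a 0 * l \<le> kcoef m n 0" using pos[of 0] l1 by (simp add: a_def mult_left_le)
        finally have Pl: "P * l \<le> kcoef m n 0 + (\<Sum>k. a (k + 1) * l)" by simp
        have Gl: "G / l = (\<Sum>k. a k / real (k + 1) / l)"
          unfolding G_def by (rule suminf_divide[OF sG, symmetric])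
        have nn: "(\<Sum>k. a (k + 1) * l) \<ge> 0" "G / l \<ge> 0"
          using apos0 l sa1 G0 by (auto intro!: suminf_nonneg summable_mult2 mult_nonneg_nonneg)
        have "P * l + ((4 + 4 * C0) * G) / l \<le> kcoef m n 0 + (\<Sum>k. a (k + 1) * l) + (4 + 4 * C0) * (G / l)"
          using Pl by simp
        also have "\<dots> \<le> (kcoef m n 0 + 1 + (4 + 4 * C0)) * (1 + (\<Sum>k. a (k + 1) * l) + G / l)"
        proof -
          have "c + x + d * y \<le> (c + 1 + d) * (1 + x + y)" if "c \<ge> 0" "d \<ge> 0" "x \<ge> 0" "y \<ge> 0" for c d x y :: real
          proof -
            have "(c + 1 + d) * (1 + x + y) = (c + x + d * y) + (c * x + c * y + 1 + y + d + d * x)"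
              by (simp add: algebra_simps)
            moreover have "c * x + c * y + 1 + y + d + d * x \<ge> 0" using that by simp
            ultimately show ?thesis by linarith
          qed
          note key = this
          show ?thesis using nn pos[of 0] C0(1) by (intro key) auto
        qed
        finally have "6 * pi * (P * l + ((4 + 4 * C0) * G) / l)
            \<le> 6 * pi * ((kcoef m n 0 + 1 + (4 + 4 * C0)) * (1 + (\<Sum>k. a (k + 1) * l) + G / l))"
          by (intro mult_left_mono) auto
        also have "\<dots> = (6 * pi * (kcoef m n 0 + 1 + (4 + 4 * C0))) * (1 + (\<Sum>k. a (k + 1) * l) + G / l)"
          by (simp only: mult.assoc)
        also have "\<dots> \<le> C * (1 + (\<Sum>k. a (k + 1) * l) + G / l)"
          unfolding C_def using nn F1 by (intro mult_right_mono) auto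
        finally show "6 * pi * (P * l + ((4 + 4 * C0) * G) / l)
            \<le> C * (1 + (\<Sum>k. a (k + 1) * l) + (\<Sum>k. a k / real (k + 1) / l))"
          unfolding Gl .
      qed
      also have "\<dots> = ennreal C * (1 + ennreal (\<Sum>k. a (k + 1) * l) + ennreal (\<Sum>k. a k / real (k + 1) / l))"
      proof -
        have "(\<Sum>k. a (k + 1) * l) \<ge> 0" "(\<Sum>k. a k / real (k + 1) / l) \<ge> 0"
          using apos0 l by (intro suminf_nonneg summable_mult2 summable_divide sG sa1 mult_nonneg_nonneg divide_nonneg_nonneg; simp)+
        then show ?thesis using C
          by (subst ennreal_mult) (auto simp: ennreal_plus)
      qed
      also have "ennreal (\<Sum>k. a (k + 1) * l) = (\<Sum>k. ennreal (a (k + 1) * l))"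
        using apos l by (intro suminf_ennreal2[symmetric] summable_mult2 sa1) (auto simp: less_imp_le)
      also have "ennreal (\<Sum>k. a k / real (k + 1) / l) = (\<Sum>k. ennreal (a k / real (k + 1) / l))"
        using apos l sG by (intro suminf_ennreal2[symmetric] summable_divide) (auto simp: less_imp_le)
      also have "(\<lambda>k. a (k + 1) * l) = (\<lambda>k. kcoef m n (k + 1) * s powr (real (k + 1) - m / 2))"
      proof
        fix k
        have "s powr (real (k + 1) - m / 2) = s powr (real (k + 1)) * l"
          by (simp only: l_def powr_add[symmetric]) simp
        then show "a (k + 1) * l = kcoef m n (k + 1) * s powr (real (k + 1) - m / 2)"
          using s powr_realpow[of s "k + 1"] by (simp add: a_def)
      qed
      also have "(\<lambda>k. a k / real (k + 1) / l) = (\<lambda>k. kcoef m n k / real (k + 1) * s powr (real k + m / 2))"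
      proof
        fix k
        have "s powr (real k + m / 2) = s powr (real k) / l"
          unfolding l_def powr_minus powr_add by (simp add: field_simps)
        then show "a k / real (k + 1) / l = kcoef m n k / real (k + 1) * s powr (real k + m / 2)"
          using s powr_realpow[of s k] by (simp add: a_def)
      qed
      finally show ?thesis unfolding S1_def S2_def .
    qed
    then show "(\<integral>\<^sup>+\<theta>. ennreal (norm (kfun m n (cis \<theta> * t))) * indicator {- pi..pi} \<theta> \<partial>lborel) \<le>
       ennreal C * (1 + (\<Sum>k. ennreal (kcoef m n (k + 1) * norm t powr (real (k + 1) - m / 2)))
         + (\<Sum>k. ennreal (kcoef m n k / real (k + 1) * norm t powr (real k + m / 2))))"
      unfolding S1_def S2_def s_def .
  qed fact
qed

subsection \<open>Isometry invariance of Lebesgue measure\<close>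

lemma nn_integral_lborel_translate:
  fixes f :: "'a::euclidean_space \<Rightarrow> ennreal"
  assumes [measurable]: "f \<in> borel_measurable borel"
  shows "(\<integral>\<^sup>+x. f (c + x) \<partial>lborel) = (\<integral>\<^sup>+x. f x \<partial>lborel)"
  by (subst (2) lborel_distr_plus[of c, symmetric]) (simp add: nn_integral_distr)

lemma nn_integral_lborel_scale:
  fixes f :: "'a::euclidean_space \<Rightarrow> ennreal"
  assumes [measurable]: "f \<in> borel_measurable borel" and r: "r > 0"
  shows "(\<integral>\<^sup>+x. f x \<partial>lborel) = ennreal (r ^ DIM('a)) * (\<integral>\<^sup>+x. f (r *\<^sub>R x) \<partial>lborel)"
  using r by (subst lborel_affine[of r 0])
    (simp_all add: nn_integral_density nn_integral_distr nn_integral_cmult)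

text \<open>Only translation invariance and Fubini: f is integrated against the indicator of the
  unit ball, which is unchanged by T and by y -> - y. In the double integral f (T y + x) g (T y), a
  translation of y by a preimage of x moves x from f to g, after which the integral over x gives the
  volume of the ball again.\<close>

lemma nn_integral_lborel_isometry:
  fixes f :: "'a::euclidean_space \<Rightarrow> ennreal" and T :: "'a \<Rightarrow> 'a"
  assumes f[measurable]: "f \<in> borel_measurable borel"
    and T: "linear T" and iso: "\<And>x. norm (T x) = norm x"
  shows "(\<integral>\<^sup>+x. f (T x) \<partial>lborel) = (\<integral>\<^sup>+x. f x \<partial>lborel)"
proof -
  have [measurable]: "T \<in> borel_measurable borel"
    using T by (intro borel_measurable_continuous_onI linear_continuous_on) (simp add: linear_conv_bounded_linear)
  have "inj T"
    using T iso by (metis linear_injective_0 norm_eq_zero)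
  then have surj: "surj T" using T by (intro linear_injective_imp_surjective) auto
  define g :: "'a \<Rightarrow> ennreal" where "g = indicator (ball 0 1)"
  have [measurable]: "g \<in> borel_measurable borel" unfolding g_def by (intro borel_measurable_indicator) simp
  define b where "b = emeasure lborel (ball (0::'a) 1)"
  have b_fin: "b \<noteq> \<infinity>" using emeasure_lborel_ball_finite[of "0::'a" 1] by (simp add: b_def)
  have b_pos: "b \<noteq> 0"
  proof
    assume "b = 0"
    then have "ball (0::'a) 1 \<in> null_sets lborel" by (auto simp: b_def null_sets_def)
    then have "negligible (ball (0::'a) 1)"
      using negligible_iff_null_sets null_sets_completionI by blast
    then show False using open_not_negligible[of "ball (0::'a) 1"] by simp
  qed
  have gT: "g (T y) = g y" for y using iso by (simp add: g_def indicator_def)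
  have bg: "(\<integral>\<^sup>+y. g y \<partial>lborel) = b" by (simp add: g_def b_def)
  have bw: "(\<integral>\<^sup>+x. g (w - x) \<partial>lborel) = b" for w
  proof -
    have "(\<integral>\<^sup>+x. g (w - x) \<partial>lborel) = (\<integral>\<^sup>+x. g (w - (w + x)) \<partial>lborel)"
      by (rule nn_integral_lborel_translate[symmetric]) measurable
    also have "\<dots> = (\<integral>\<^sup>+x. g x \<partial>lborel)"
      by (intro nn_integral_cong) (simp add: g_def indicator_def)
    finally show ?thesis using bg by simp
  qed
  have "(\<integral>\<^sup>+x. f x \<partial>lborel) * b = (\<integral>\<^sup>+x. (\<integral>\<^sup>+y. f x * g (T y) \<partial>lborel) \<partial>lborel)"
    by (simp add: nn_integral_cmult nn_integral_multc gT bg)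
  also have "\<dots> = (\<integral>\<^sup>+y. (\<integral>\<^sup>+x. f x * g (T y) \<partial>lborel) \<partial>lborel)"
    by (rule lborel_pair.Fubini') measurable
  also have "\<dots> = (\<integral>\<^sup>+y. (\<integral>\<^sup>+x. f (T y + x) * g (T y) \<partial>lborel) \<partial>lborel)"
  proof (rule nn_integral_cong)
    fix y
    show "(\<integral>\<^sup>+x. f x * g (T y) \<partial>lborel) = (\<integral>\<^sup>+x. f (T y + x) * g (T y) \<partial>lborel)"
      by (rule nn_integral_lborel_translate[where f = "\<lambda>x. f x * g (T y)", symmetric]) measurable
  qed
  also have "\<dots> = (\<integral>\<^sup>+x. (\<integral>\<^sup>+y. f (T y + x) * g (T y) \<partial>lborel) \<partial>lborel)"
    by (rule lborel_pair.Fubini') measurable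
  also have "\<dots> = (\<integral>\<^sup>+x. (\<integral>\<^sup>+y. f (T y) * g (T y - x) \<partial>lborel) \<partial>lborel)"
  proof (rule nn_integral_cong)
    fix x
    \<comment> \<open>By surjectivity of T the shift by x is a shift of the argument y, where
      translation invariance applies.\<close>
    obtain z where z: "T z = x" using surj by (metis surjD)
    have "(\<integral>\<^sup>+y. f (T y) * g (T y - x) \<partial>lborel) = (\<integral>\<^sup>+y. f (T (z + y)) * g (T (z + y) - x) \<partial>lborel)"
      by (rule nn_integral_lborel_translate[where f = "\<lambda>y. f (T y) * g (T y - x)", symmetric]) measurable
    also have "\<dots> = (\<integral>\<^sup>+y. f (T y + x) * g (T y) \<partial>lborel)"
      by (simp add: linear_add[OF T] z add.commute)
    finally show "(\<integral>\<^sup>+y. f (T y + x) * g (T y) \<partial>lborel) = (\<integral>\<^sup>+y. f (T y) * g (T y - x) \<partial>lborel)" ..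
  qed
  also have "\<dots> = (\<integral>\<^sup>+y. (\<integral>\<^sup>+x. f (T y) * g (T y - x) \<partial>lborel) \<partial>lborel)"
    by (rule lborel_pair.Fubini') measurable
  also have "\<dots> = (\<integral>\<^sup>+y. f (T y) \<partial>lborel) * b"
    by (simp add: nn_integral_cmult nn_integral_multc bw)
  finally have "b * (\<integral>\<^sup>+x. f x \<partial>lborel) = b * (\<integral>\<^sup>+y. f (T y) \<partial>lborel)"
    by (simp add: mult.commute)
  then show ?thesis
    using b_pos b_fin by (metis ennreal_mult_cancel_left infinity_ennreal_def)
qed

text \<open>Layer cake in place of polar coordinates: only the homogeneity of \<open>h\<close> is used.\<close>

lemma nn_integral_homogeneous_exp:
  fixes h :: "'a::euclidean_space \<Rightarrow> ennreal"
  assumes h[measurable]: "h \<in> borel_measurable borel"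
    and hom: "\<And>r x. r > 0 \<Longrightarrow> h (r *\<^sub>R x) = ennreal (r powr j) * h x"
    and j: "j \<ge> 0" and l: "l > 0" and m: "m > 0"
  shows "(\<integral>\<^sup>+y. h y * ennreal (exp (- l * norm y powr (2 * m))) \<partial>lborel) =
    (\<integral>\<^sup>+y. h y * indicator (cball 0 1) y \<partial>lborel) *
      ennreal (l powr (- (j + DIM('a)) / (2 * m)) * Gamma ((j + DIM('a)) / (2 * m) + 1))"
proof -
  define E where "E = (j + DIM('a)) / (2 * m)"
  define \<nu> where "\<nu> = (\<integral>\<^sup>+y. h y * indicator (cball 0 1) y \<partial>lborel)"
  have [measurable]: "cball (0 :: 'a) r \<in> sets borel" for r by simp
  have E: "E > 0" using j m by (simp add: E_def add_nonneg_pos)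
  \<comment> \<open>The weight is written as an integral over its superlevel parameter, so that for
    fixed parameter the y-integral runs over a ball.\<close>
  have layer: "ennreal (exp (- a)) = (\<integral>\<^sup>+\<tau>. ennreal (exp (- \<tau>)) * (if a \<le> \<tau> then 1 else 0) \<partial>lborel)" for a :: real
  proof -
    have "(\<integral>\<^sup>+\<tau>. ennreal (exp (- \<tau>)) * indicator {a..} \<tau> \<partial>lborel) = ennreal (0 - (- exp (- a)))"
    proof (rule nn_integral_FTC_atLeast)
      show "((\<lambda>\<tau>. - exp (- \<tau>)) has_real_derivative exp (- \<tau>)) (at \<tau>)" for \<tau> :: real
        by (auto intro!: derivative_eq_intros)
      show "((\<lambda>\<tau>. - exp (- \<tau>)) \<longlongrightarrow> 0) (at_top :: real filter)"
        using tendsto_minus[OF filterlim_compose[OF exp_at_bot filterlim_uminus_at_bot_at_top]] by simp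
    qed auto
    moreover have "(if a \<le> \<tau> then 1 else 0) = (indicator {a..} \<tau> :: ennreal)" for \<tau>
      by (simp add: indicator_def)
    ultimately show ?thesis by (simp only: minus_minus diff_0)
  qed
  have "(\<integral>\<^sup>+y. h y * ennreal (exp (- l * norm y powr (2 * m))) \<partial>lborel) =
     (\<integral>\<^sup>+y. (\<integral>\<^sup>+\<tau>. h y * (ennreal (exp (- \<tau>)) * (if l * norm y powr (2 * m) \<le> \<tau> then 1 else 0)) \<partial>lborel) \<partial>lborel)"
  proof (rule nn_integral_cong)
    fix y
    show "h y * ennreal (exp (- l * norm y powr (2 * m))) =
      (\<integral>\<^sup>+\<tau>. h y * (ennreal (exp (- \<tau>)) * (if l * norm y powr (2 * m) \<le> \<tau> then 1 else 0)) \<partial>lborel)"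
      using layer[of "l * norm y powr (2 * m)"] by (subst nn_integral_cmult) auto
  qed
  also have "\<dots> = (\<integral>\<^sup>+\<tau>. (\<integral>\<^sup>+y. h y * (ennreal (exp (- \<tau>)) * (if l * norm y powr (2 * m) \<le> \<tau> then 1 else 0)) \<partial>lborel) \<partial>lborel)"
    by (rule lborel_pair.Fubini') measurable
  \<comment> \<open>For positive level the ball has radius
    \<open>(\<tau> / l) powr (1 / (2 * m))\<close>, and scaling it to the unit ball produces the
    power E of the level; the outer integral is then Gamma (E + 1). The level 0, where scaling would
    be by 0, is a null set.\<close>
  also have "\<dots> = (\<integral>\<^sup>+\<tau>. (\<nu> * ennreal (l powr (- E))) * ennreal (indicator {0..} \<tau> * \<tau> powr (E + 1 - 1) / exp \<tau>) \<partial>lborel)"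
  proof (rule nn_integral_cong_AE)
    show "AE \<tau> in lborel. (\<integral>\<^sup>+y. h y * (ennreal (exp (- \<tau>)) * (if l * norm y powr (2 * m) \<le> \<tau> then 1 else 0)) \<partial>lborel)
        = (\<nu> * ennreal (l powr (- E))) * ennreal (indicator {0..} \<tau> * \<tau> powr (E + 1 - 1) / exp \<tau>)"
      using AE_lborel_singleton[of "0::real"]
    proof eventually_elim
      fix \<tau> :: real
      assume "\<tau> \<noteq> 0"
      then consider "\<tau> < 0" | "\<tau> > 0" by linarith
      then show "(\<integral>\<^sup>+y. h y * (ennreal (exp (- \<tau>)) * (if l * norm y powr (2 * m) \<le> \<tau> then 1 else 0)) \<partial>lborel)
        = (\<nu> * ennreal (l powr (- E))) * ennreal (indicator {0..} \<tau> * \<tau> powr (E + 1 - 1) / exp \<tau>)"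
      proof cases
        case 1
        have "\<not> l * norm y powr (2 * m) \<le> \<tau>" for y :: 'a
        proof -
          have "0 \<le> l * norm y powr (2 * m)" using l by simp
          then show ?thesis using 1 by linarith
        qed
        then show ?thesis using 1 by simp
      next
        case 2
        define \<rho> where "\<rho> = (\<tau> / l) powr (1 / (2 * m))"
        have \<rho>: "\<rho> > 0" using 2 l by (simp add: \<rho>_def)
        have \<rho>m: "\<rho> powr (2 * m) = \<tau> / l" using 2 l m by (simp add: \<rho>_def powr_powr)
        have iff: "l * norm y powr (2 * m) \<le> \<tau> \<longleftrightarrow> norm y \<le> \<rho>" for y :: 'a
        proof -
          have "l * norm y powr (2 * m) \<le> \<tau> \<longleftrightarrow> norm y powr (2 * m) \<le> \<rho> powr (2 * m)"
            unfolding \<rho>m using l by (simp add: field_simps)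
          also have "\<dots> \<longleftrightarrow> norm y \<le> \<rho>"
            using \<rho> m powr_mono2[of "2 * m" "norm y" \<rho>] powr_less_mono2[of "2 * m" \<rho> "norm y"]
            by (cases "norm y \<le> \<rho>") auto
          finally show ?thesis .
        qed
        have "(\<integral>\<^sup>+y. h y * (ennreal (exp (- \<tau>)) * (if l * norm y powr (2 * m) \<le> \<tau> then 1 else 0)) \<partial>lborel)
           = ennreal (exp (- \<tau>)) * (\<integral>\<^sup>+y. h y * indicator (cball 0 \<rho>) y \<partial>lborel)"
          unfolding iff by (subst nn_integral_cmult[symmetric]) (auto intro!: nn_integral_cong simp: indicator_def mult.commute)
        also have "(\<integral>\<^sup>+y. h y * indicator (cball 0 \<rho>) y \<partial>lborel)
           = ennreal (\<rho> ^ DIM('a)) * (\<integral>\<^sup>+y. h (\<rho> *\<^sub>R y) * indicator (cball 0 \<rho>) (\<rho> *\<^sub>R y) \<partial>lborel)"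
          using \<rho> by (intro nn_integral_lborel_scale; measurable)
        also have "(\<integral>\<^sup>+y. h (\<rho> *\<^sub>R y) * indicator (cball 0 \<rho>) (\<rho> *\<^sub>R y) \<partial>lborel)
           = (\<integral>\<^sup>+y. ennreal (\<rho> powr j) * (h y * indicator (cball 0 1) y) \<partial>lborel)"
          using \<rho> by (intro nn_integral_cong) (auto simp: hom indicator_def)
        also have "\<dots> = ennreal (\<rho> powr j) * \<nu>"
          unfolding \<nu>_def by (rule nn_integral_cmult) measurable
        also have "ennreal (exp (- \<tau>)) * (ennreal (\<rho> ^ DIM('a)) * (ennreal (\<rho> powr j) * \<nu>))
           = \<nu> * ennreal (exp (- \<tau>) * (\<rho> ^ DIM('a) * \<rho> powr j))"
          using \<rho> by (simp add: ennreal_mult mult_ac)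
        also have "\<rho> ^ DIM('a) * \<rho> powr j = (\<tau> / l) powr E"
          using \<rho> by (simp add: powr_realpow[symmetric] powr_add[symmetric] \<rho>_def powr_powr E_def add.commute add_divide_distrib)
        also have "exp (- \<tau>) * (\<tau> / l) powr E = l powr (- E) * (indicator {0..} \<tau> * \<tau> powr (E + 1 - 1) / exp \<tau>)"
          using 2 l by (simp add: powr_divide powr_minus exp_minus field_simps)
        finally show ?thesis
          by (subst mult.assoc, subst ennreal_mult[symmetric]) auto
      qed
    qed
  qed
  also have "\<dots> = (\<nu> * ennreal (l powr (- E))) * ennreal (Gamma (E + 1))"
    using E by (subst nn_integral_cmult) (auto simp: Gamma_conv_nn_integral_real)
  also have "\<dots> = \<nu> * ennreal (l powr (- E) * Gamma (E + 1))"
    using E by (simp add: ennreal_mult mult.assoc Gamma_real_pos less_imp_le)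
  finally show ?thesis by (simp add: \<nu>_def E_def minus_divide_left)
qed

section \<open>The Hermitian product and invariance under phases\<close>

lemma cinner_measurable[measurable]:
  assumes [measurable]: "f \<in> borel_measurable M" "g \<in> borel_measurable M"
  shows "(\<lambda>w. cinner (f w) (g w :: complex ^ 'n::finite)) \<in> borel_measurable M"
proof -
  have "continuous_on UNIV (\<lambda>z :: (complex ^ 'n) \<times> (complex ^ 'n). cinner (fst z) (snd z))"
    unfolding cinner_def by (intro continuous_intros)
  then have "(\<lambda>z :: (complex ^ 'n) \<times> (complex ^ 'n). cinner (fst z) (snd z)) \<in> borel_measurable borel"
    by (rule borel_measurable_continuous_onI)
  then have [measurable]: "(\<lambda>z :: (complex ^ 'n) \<times> (complex ^ 'n). cinner (fst z) (snd z)) \<in> borel \<Otimes>\<^sub>M borel \<rightarrow>\<^sub>M borel"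
    by (simp add: borel_prod)
  have "(\<lambda>w. (\<lambda>z. cinner (fst z) (snd z)) (f w, g w)) \<in> borel_measurable M" by measurable
  then show ?thesis by simp
qed

lemma cinner_scaleR:
  "cinner (r *\<^sub>R x) y = complex_of_real r * cinner x y"
  "cinner x (r *\<^sub>R y) = complex_of_real r * cinner x y"
  by (simp_all add: cinner_def sum_distrib_left scaleR_conv_of_real[where 'a = complex] mult_ac)

lemma cinner_commute: "cinner y x = cnj (cinner x y)"
  by (simp add: cinner_def mult.commute)

lemma Re_cinner: "Re (cinner x y) = x \<bullet> y"
  by (simp add: cinner_def inner_vec_def inner_complex_def)

definition cmul :: "complex \<Rightarrow> complex ^ 'n \<Rightarrow> complex ^ 'n" where
  "cmul c y = (\<chi> i. c * y $ i)"

lemma norm_cmul: "norm (cmul c y) = norm c * norm (y :: complex ^ 'n::finite)"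
  by (simp add: cmul_def norm_vec_def norm_mult L2_set_right_distrib)

lemma linear_cmul: "linear (cmul c)"
  by (rule linearI) (simp_all add: cmul_def vec_eq_iff algebra_simps)

lemma cinner_cmul: "cinner x (cmul c y) = cnj c * cinner x y" "cinner (cmul c x) y = c * cinner x y"
  by (simp_all add: cmul_def cinner_def sum_distrib_left mult_ac)

text \<open>A phase on x makes the product real and nonnegative, and then it equals the real inner
  product, for which Cauchy-Schwarz is known.\<close>

lemma norm_cinner_le: "norm (cinner x y) \<le> norm x * norm (y :: complex ^ 'n::finite)"
proof (cases "cinner x y = 0")
  case False
  define w where "w = cinner x y"
  define c where "c = cnj w / norm w"
  have w: "w \<noteq> 0" using False by (simp add: w_def)
  have c: "norm c = 1" using w by (simp add: c_def norm_divide)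
  have "c * w = complex_of_real (norm w)"
    using w by (simp add: c_def complex_norm_square[symmetric] mult.commute power2_eq_square[of "complex_of_real (norm w)"])
  then have "norm w = Re (cinner (cmul c x) y)"
    by (simp add: cinner_cmul w_def)
  also have "\<dots> \<le> norm (cmul c x) * norm y"
    unfolding Re_cinner by (rule norm_cauchy_schwarz)
  finally show ?thesis using c by (simp add: norm_cmul w_def)
qed simp

lemma nn_integral_phase:
  fixes f :: "complex ^ 'n::finite \<Rightarrow> ennreal"
  assumes [measurable]: "f \<in> borel_measurable borel" and c: "norm c = 1"
  shows "(\<integral>\<^sup>+y. f (cmul c y) \<partial>lborel) = (\<integral>\<^sup>+y. f y \<partial>lborel)"
  using c by (intro nn_integral_lborel_isometry linear_cmul) (auto simp: norm_cmul)

lemma distr_lborel_isometry: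
  fixes T :: "'a::euclidean_space \<Rightarrow> 'a"
  assumes T: "linear T" and iso: "\<And>x. norm (T x) = norm x"
  shows "distr lborel borel T = lborel"
proof (rule measure_eqI)
  have [measurable]: "T \<in> borel_measurable borel"
    using T by (intro borel_measurable_continuous_onI linear_continuous_on) (simp add: linear_conv_bounded_linear)
  fix A assume "A \<in> sets (distr lborel borel T)"
  then have [measurable]: "A \<in> sets borel" by simp
  have "emeasure (distr lborel borel T) A = (\<integral>\<^sup>+x. indicator A x \<partial>distr lborel borel T)" by simp
  also have "\<dots> = (\<integral>\<^sup>+x. indicator A (T x) \<partial>lborel)" by (rule nn_integral_distr) measurable
  also have "\<dots> = emeasure lborel A"
    using nn_integral_lborel_isometry[OF _ T iso, of "indicator A"] by simp
  finally show "emeasure (distr lborel borel T) A = emeasure lborel A" .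
qed simp

lemma integral_lborel_isometry:
  fixes T :: "'a::euclidean_space \<Rightarrow> 'a" and f :: "'a \<Rightarrow> 'b::{banach, second_countable_topology}"
  assumes [measurable]: "f \<in> borel_measurable borel" and T: "linear T" and iso: "\<And>x. norm (T x) = norm x"
  shows "(\<integral>x. f (T x) \<partial>lborel) = (\<integral>x. f x \<partial>lborel)"
proof -
  have [measurable]: "T \<in> borel_measurable borel"
    using T by (intro borel_measurable_continuous_onI linear_continuous_on) (simp add: linear_conv_bounded_linear)
  show ?thesis
    by (subst (2) distr_lborel_isometry[OF T iso, symmetric]) (simp add: integral_distr)
qed

text \<open>A rotation by pi / |i - l| reverses the sign of every integrand of bidegree (i, l) off
  the diagonal; this is the source of all orthogonality relations below.\<close>

lemma exists_phase_minus_one: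
  assumes "i \<noteq> l"
  obtains c :: complex where "norm c = 1" "cnj c ^ i * c ^ l = -1"
proof (cases "i < l")
  case True
  define c where "c = cis (pi / real (l - i))"
  have "cnj c ^ i * c ^ l = (cnj c * c) ^ i * c ^ (l - i)"
    using True by (simp add: power_mult_distrib mult.assoc power_add[symmetric])
  also have "cnj c * c = 1" by (simp add: c_def cis_cnj cis_mult)
  also have "c ^ (l - i) = -1"
  proof -
    have "real (l - i) * (pi / real (l - i)) = pi" using True by simp
    then show ?thesis unfolding c_def by (metis Complex.DeMoivre cis_pi)
  qed
  finally show ?thesis by (intro that[of c]) (auto simp: c_def)
next
  case False
  with assms have gt: "l < i" by simp
  define c where "c = cis (- pi / real (i - l))"
  have "cnj c ^ i * c ^ l = (cnj c * c) ^ l * cnj c ^ (i - l)"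
    using gt by (simp add: power_mult_distrib mult_ac power_add[symmetric])
  also have "cnj c * c = 1" by (simp add: c_def cis_cnj cis_mult)
  also have "cnj c ^ (i - l) = -1"
  proof -
    have "real (i - l) * - (- pi / real (i - l)) = pi" using gt by simp
    then show ?thesis unfolding c_def cis_cnj by (metis Complex.DeMoivre cis_pi)
  qed
  finally show ?thesis by (intro that[of c]) (auto simp: c_def)
qed

lemma integral_bidegree_eq_0:
  fixes F :: "complex ^ 'n::finite \<Rightarrow> complex"
  assumes [measurable]: "F \<in> borel_measurable borel" and il: "i \<noteq> l"
    and F: "\<And>c y. norm c = 1 \<Longrightarrow> F (cmul c y) = cnj c ^ i * c ^ l * F y"
  shows "(\<integral>y. F y \<partial>lborel) = 0"
proof -
  obtain c :: complex where c: "norm c = 1" "cnj c ^ i * c ^ l = -1"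
    using exists_phase_minus_one[OF il] by blast
  have "(\<integral>y. F y \<partial>lborel) = (\<integral>y. F (cmul c y) \<partial>lborel)"
    using c by (intro integral_lborel_isometry[symmetric] linear_cmul) (auto simp: norm_cmul)
  also have "\<dots> = - (\<integral>y. F y \<partial>lborel)"
    using c by (simp add: F)
  finally have "(\<integral>y. F y \<partial>lborel) + (\<integral>y. F y \<partial>lborel) = 0"
    by (metis add.right_inverse)
  then show ?thesis by (metis mult_2 mult_eq_0_iff zero_neq_numeral)
qed

subsection \<open>Gaussian and ball moments\<close>

text \<open>Uniqueness of coefficients, needed to compare two generating functions of Gaussian
  moments.\<close>

lemma powser_eq_zero:
  fixes a :: "nat \<Rightarrow> real"
  assumes "\<And>x. (\<lambda>k. a k * x ^ k) sums 0"
  shows "a n = 0"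
  using assms
proof (induction n arbitrary: a)
  case 0
  have "(\<lambda>k. a k * 0 ^ k) sums a 0" by (rule powser_sums_zero)
  then show ?case using 0[of 0] sums_unique2 by blast
next
  case (Suc n)
  have a0: "a 0 = 0"
    using Suc.prems[of 0] powser_sums_zero[of a] sums_unique2 by blast
  have ne: "(\<lambda>k. a (Suc k) * x ^ k) sums 0" if "x \<noteq> 0" for x
  proof -
    have "(\<lambda>k. a (Suc k) * x ^ Suc k) sums 0"
      using sums_Suc_iff[of "\<lambda>k. a k * x ^ k" 0] Suc.prems[of x] a0 by simp
    from sums_mult[OF this, of "inverse x"] show ?thesis using that by (simp add: field_simps)
  qed
  \<comment> \<open>The sum of the shifted series: it vanishes for x different from 0, where
    division by x is possible, and equals a 1 at 0. Continuity of power series at 0 forces a 1 =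
    0.\<close>
  define f where "f x = (if x = 0 then a 1 else 0)" for x :: real
  have "(f \<longlongrightarrow> a (Suc 0)) (at 0)"
  proof (rule powser_limit_0[where s = 1])
    fix x :: real
    show "(\<lambda>k. a (Suc k) * x ^ k) sums f x"
      using ne[of x] powser_sums_zero[of "\<lambda>k. a (Suc k)"] by (auto simp: f_def)
  qed simp
  moreover have "(f \<longlongrightarrow> 0) (at 0)"
    by (rule tendsto_eventually) (auto simp: f_def eventually_at intro!: exI[of _ 1])
  ultimately have a1: "a (Suc 0) = 0" using tendsto_unique trivial_limit_at by blast
  have "(\<lambda>k. a (Suc k) * x ^ k) sums 0" for x
    using ne[of x] powser_sums_zero[of "\<lambda>k. a (Suc k)"] a1 by (cases "x = 0") auto
  from Suc.IH[OF this] show ?case .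
qed

definition ball_moment :: "real \<Rightarrow> complex ^ 'n::finite \<Rightarrow> ennreal" where
  "ball_moment j x = (\<integral>\<^sup>+y. ennreal (norm (cinner x y) powr j) * indicator (cball 0 1) y \<partial>lborel)"

text \<open>The classical value is pi^n; it is carried along as a positive constant.\<close>

definition gauss_mass :: "'n::finite itself \<Rightarrow> real" where
  "gauss_mass _ = enn2real (\<integral>\<^sup>+y. ennreal (exp (- (norm (y :: complex ^ 'n))\<^sup>2)) \<partial>lborel)"

lemma cnj_measurable[measurable]: "cnj \<in> borel_measurable borel"
  by (intro borel_measurable_continuous_onI continuous_intros)

lemma emeasure_cball_pos: "emeasure lborel (cball (0::'a::euclidean_space) 1) \<noteq> 0"
proof
  assume 0: "emeasure lborel (cball (0::'a) 1) = 0"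
  then have "cball (0::'a) 1 \<in> null_sets lborel" by (auto simp: null_sets_def)
  then have "negligible (cball (0::'a) 1)"
    using negligible_iff_null_sets null_sets_completionI by blast
  then have "negligible (ball (0::'a) 1)" by (rule negligible_subset) auto
  then show False using open_not_negligible[of "ball (0::'a) 1"] by simp
qed

text \<open>The case m = 1 of the homogeneous integral formula, read from right to left later:
  moments on the ball are obtained from Gaussian ones.\<close>

lemma nn_integral_gauss_power:
  fixes x :: "complex ^ 'n::finite"
  shows "(\<integral>\<^sup>+y. ennreal (norm (cinner x y) ^ k * exp (- (norm y)\<^sup>2)) \<partial>lborel)
    = (\<integral>\<^sup>+y. ennreal (norm (cinner x y) ^ k) * indicator (cball 0 1) y \<partial>lborel)
        * ennreal (Gamma (real k / 2 + CARD('n) + 1))"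
proof -
  have "(\<integral>\<^sup>+y. ennreal (norm (cinner x y) ^ k * exp (- (norm y)\<^sup>2)) \<partial>lborel)
     = (\<integral>\<^sup>+y. ennreal (norm (cinner x y) ^ k) * ennreal (exp (- 1 * norm y powr (2 * 1))) \<partial>lborel)"
    by (intro nn_integral_cong) (simp add: ennreal_mult powr_numeral)
  also have "\<dots> = (\<integral>\<^sup>+y. ennreal (norm (cinner x y) ^ k) * indicator (cball 0 1) y \<partial>lborel) *
      ennreal (1 powr (- (real k + DIM(complex ^ 'n)) / (2 * 1)) * Gamma ((real k + DIM(complex ^ 'n)) / (2 * 1) + 1))"
    by (intro nn_integral_homogeneous_exp)
      (auto simp: cinner_scaleR norm_mult power_mult_distrib powr_realpow ennreal_mult)
  finally show ?thesis by (simp add: add_divide_distrib mult.commute)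
qed

lemma ball_power_moment_finite:
  fixes x :: "complex ^ 'n::finite"
  shows "(\<integral>\<^sup>+y. ennreal (norm (cinner x y) ^ k) * indicator (cball 0 1) y \<partial>lborel) < \<infinity>"
proof -
  have "(\<integral>\<^sup>+y. ennreal (norm (cinner x y) ^ k) * indicator (cball 0 1) y \<partial>lborel)
    \<le> (\<integral>\<^sup>+y. ennreal (norm x ^ k) * indicator (cball 0 1) y \<partial>(lborel :: (complex ^ 'n) measure))"
  proof (intro nn_integral_mono)
    fix y :: "complex ^ 'n"
    show "ennreal (norm (cinner x y) ^ k) * indicator (cball 0 1) y \<le> ennreal (norm x ^ k) * indicator (cball 0 1) y"
    proof (cases "norm y \<le> 1")
      case True
      have "norm (cinner x y) \<le> norm x * 1"
        using norm_cinner_le[of x y] mult_left_mono[OF True, of "norm x"] by simp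
      then show ?thesis by (auto intro!: mult_right_mono ennreal_leI power_mono)
    qed (simp add: indicator_def)
  qed
  also have "\<dots> = ennreal (norm x ^ k) * emeasure lborel (cball (0 :: complex ^ 'n) 1)"
    by (simp add: nn_integral_cmult_indicator)
  also have "\<dots> < \<infinity>"
    using emeasure_lborel_cball_finite[of "0 :: complex ^ 'n" 1] by (simp add: ennreal_mult_less_top)
  finally show ?thesis .
qed

lemma integrable_gauss_power:
  fixes x :: "complex ^ 'n::finite"
  shows "integrable lborel (\<lambda>y. norm (cinner x y) ^ k * exp (- (norm y)\<^sup>2))"
proof (rule integrableI_nonneg)
  show "(\<integral>\<^sup>+y. ennreal (norm (cinner x y) ^ k * exp (- (norm y)\<^sup>2)) \<partial>lborel) < \<infinity>"
    unfolding nn_integral_gauss_power using ball_power_moment_finite[of x k] by (simp add: ennreal_mult_less_top)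
qed auto

text \<open>Completing the square: the exponent equals t^2 |x|^2 - |y - t x|^2, and the translation
  by t x is harmless.\<close>

lemma nn_integral_gauss_exp:
  fixes x :: "complex ^ 'n::finite"
  shows "(\<integral>\<^sup>+y. ennreal (exp (2 * t * Re (cinner x y)) * exp (- (norm y)\<^sup>2)) \<partial>lborel)
    = ennreal (exp (t\<^sup>2 * (norm x)\<^sup>2)) * ennreal (gauss_mass TYPE('n))"
proof -
  have fin: "(\<integral>\<^sup>+y. ennreal (exp (- (norm (y :: complex ^ 'n))\<^sup>2)) \<partial>lborel) < \<infinity>"
    using integrable_gauss_power[of "0 :: complex ^ 'n" 0] unfolding integrable_iff_bounded by simp
  have "exp (2 * t * Re (cinner x y)) * exp (- (norm y)\<^sup>2)
      = exp (t\<^sup>2 * (norm x)\<^sup>2) * exp (- (norm (- (t *\<^sub>R x) + y))\<^sup>2)" for y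
  proof -
    have "(norm (- (t *\<^sub>R x) + y))\<^sup>2 = (norm y)\<^sup>2 - 2 * t * (x \<bullet> y) + t\<^sup>2 * (norm x)\<^sup>2"
      unfolding power2_norm_eq_inner
      by (simp add: inner_simps inner_commute power2_eq_square algebra_simps)
    then show ?thesis by (simp add: exp_add[symmetric] Re_cinner)
  qed
  then have "(\<integral>\<^sup>+y. ennreal (exp (2 * t * Re (cinner x y)) * exp (- (norm y)\<^sup>2)) \<partial>lborel)
     = ennreal (exp (t\<^sup>2 * (norm x)\<^sup>2)) * (\<integral>\<^sup>+y. ennreal (exp (- (norm (- (t *\<^sub>R x) + y))\<^sup>2)) \<partial>lborel)"
    by (simp add: ennreal_mult nn_integral_cmult)
  also have "(\<integral>\<^sup>+y. ennreal (exp (- (norm (- (t *\<^sub>R x) + y))\<^sup>2)) \<partial>lborel)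
     = (\<integral>\<^sup>+y. ennreal (exp (- (norm (y :: complex ^ 'n))\<^sup>2)) \<partial>lborel)"
    by (rule nn_integral_lborel_translate[where f = "\<lambda>y. ennreal (exp (- (norm y)\<^sup>2))"]) measurable
  finally show ?thesis unfolding gauss_mass_def using fin by simp
qed

text \<open>Comparing coefficients of t^(2k) in the Gaussian exponential integral gives the moments
  of 2 Re <x, y>. Expanding (<x, y> + conjugate)^(2k), phase invariance leaves only the balanced
  term, so these moments are (2k choose k) times the wanted ones.\<close>

lemma gauss_moment_even:
  fixes x :: "complex ^ 'n::finite"
  shows "(\<integral>y. norm (cinner x y) ^ (2 * k) * exp (- (norm y)\<^sup>2) \<partial>lborel)
    = fact k * norm x ^ (2 * k) * gauss_mass TYPE('n)"
proof -
  let ?w = "\<lambda>y :: complex ^ 'n. exp (- (norm y)\<^sup>2)"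
  let ?X = "\<lambda>y. cinner x y"
  define c where "c = gauss_mass TYPE('n)"
  define M where "M N = (\<integral>y. (2 * Re (?X y)) ^ N * ?w y \<partial>lborel) / fact N" for N
  have c0: "c \<ge> 0" by (simp add: c_def gauss_mass_def)
  have int_exp: "integrable lborel (\<lambda>y. exp (2 * t * Re (?X y)) * ?w y)"
    and integral_exp: "(\<integral>y. exp (2 * t * Re (?X y)) * ?w y \<partial>lborel) = exp (t\<^sup>2 * (norm x)\<^sup>2) * c" for t
  proof -
    have "(\<integral>\<^sup>+y. ennreal (exp (2 * t * Re (?X y)) * ?w y) \<partial>lborel) = ennreal (exp (t\<^sup>2 * (norm x)\<^sup>2) * c)"
      unfolding nn_integral_gauss_exp c_def using c0 by (simp add: ennreal_mult c_def)
    moreover have "exp (t\<^sup>2 * (norm x)\<^sup>2) * c \<ge> 0" using c0 by simp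
    ultimately have "has_bochner_integral lborel (\<lambda>y. exp (2 * t * Re (?X y)) * ?w y) (exp (t\<^sup>2 * (norm x)\<^sup>2) * c)"
      by (intro has_bochner_integral_nn_integral) auto
    then show "integrable lborel (\<lambda>y. exp (2 * t * Re (?X y)) * ?w y)"
      "(\<integral>y. exp (2 * t * Re (?X y)) * ?w y \<partial>lborel) = exp (t\<^sup>2 * (norm x)\<^sup>2) * c"
      by (auto simp: has_bochner_integral_iff)
  qed
  have int_Re: "integrable lborel (\<lambda>y. (2 * Re (?X y)) ^ N * ?w y)" for N
  proof (rule Bochner_Integration.integrable_bound[OF integrable_mult_right[OF integrable_gauss_power[of x N], of "2 ^ N"]])
    show "AE y in lborel. norm ((2 * Re (?X y)) ^ N * ?w y) \<le> norm (2 ^ N * (norm (?X y) ^ N * ?w y))"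
    proof (intro always_eventually allI)
      fix y
      have "\<bar>2 * Re (?X y)\<bar> ^ N \<le> (2 * norm (?X y)) ^ N"
        using abs_Re_le_cmod[of "?X y"] by (intro power_mono) auto
      then show "norm ((2 * Re (?X y)) ^ N * ?w y) \<le> norm (2 ^ N * (norm (?X y) ^ N * ?w y))"
        by (simp add: abs_mult power_abs power_mult_distrib)
    qed
  qed auto
  have expo: "(\<lambda>N. u ^ N / fact N) sums exp u" for u :: real
    using exp_converges[of u] by (simp add: field_simps)
  have M_sums: "(\<lambda>N. M N * t ^ N) sums (exp (t\<^sup>2 * (norm x)\<^sup>2) * c)" for t
  proof -
    define f where "f N y = (t * (2 * Re (?X y))) ^ N / fact N * ?w y" for N y
    have f_alt: "f N y = (t ^ N / fact N) * ((2 * Re (?X y)) ^ N * ?w y)" for N y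
      by (simp add: f_def power_mult_distrib)
    have int_f: "integrable lborel (f N)" for N
      unfolding f_alt[abs_def] by (intro integrable_mult_right int_Re)
    have fs: "(\<lambda>N. f N y) sums (exp (2 * t * Re (?X y)) * ?w y)" for y
      unfolding f_def using sums_mult2[OF expo[of "t * (2 * Re (?X y))"], of "?w y"] by (simp add: mult_ac)
    have nfs: "(\<lambda>N. norm (f N y)) sums (exp \<bar>t * (2 * Re (?X y))\<bar> * ?w y)" for y
      unfolding f_def using sums_mult2[OF expo[of "\<bar>t * (2 * Re (?X y))\<bar>"], of "?w y"]
      by (simp add: abs_mult power_abs)
    have "summable (\<lambda>N. \<integral>y. norm (f N y) \<partial>lborel)"
    proof (rule bounded_imp_summable)
      fix K
      \<comment> \<open>Integrable majorant of exp |u|, namely exp u + exp (- u); both summands are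
        instances of the exponential integral, at t and - t.\<close>
      let ?g = "\<lambda>y. exp (2 * t * Re (?X y)) * ?w y + exp (2 * (- t) * Re (?X y)) * ?w y"
      have "(\<Sum>N\<le>K. \<integral>y. norm (f N y) \<partial>lborel) = (\<integral>y. (\<Sum>N\<le>K. norm (f N y)) \<partial>lborel)"
        using int_f by simp
      also have "\<dots> \<le> (\<integral>y. ?g y \<partial>lborel)"
      proof (intro integral_mono)
        fix y
        have "(\<Sum>N\<le>K. norm (f N y)) \<le> (\<Sum>N. norm (f N y))"
          using nfs[of y] by (intro sum_le_suminf) (auto simp: sums_iff)
        also have "\<dots> = exp \<bar>t * (2 * Re (?X y))\<bar> * ?w y" using nfs[of y] by (simp add: sums_iff)
        also have "\<dots> \<le> ?g y"
        proof (cases "t * (2 * Re (?X y)) \<ge> 0")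
          case True
          then show ?thesis by (simp add: mult_ac)
        next
          case False
          then show ?thesis by (simp add: mult_ac)
        qed
        finally show "(\<Sum>N\<le>K. norm (f N y)) \<le> ?g y" .
      qed (use int_f int_exp[of t] int_exp[of "- t"] in auto)
      finally show "(\<Sum>N\<le>K. \<integral>y. norm (f N y) \<partial>lborel) \<le> (\<integral>y. ?g y \<partial>lborel)" .
    qed auto
    then have "(\<lambda>N. \<integral>y. f N y \<partial>lborel) sums (\<integral>y. (\<Sum>N. f N y) \<partial>lborel)"
      using int_f nfs by (intro sums_integral) (auto simp: sums_iff)
    moreover have "(\<Sum>N. f N y) = exp (2 * t * Re (?X y)) * ?w y" for y using fs[of y] by (simp add: sums_iff)
    moreover have "(\<integral>y. f N y \<partial>lborel) = M N * t ^ N" for N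
      unfolding f_alt[abs_def] by (simp add: M_def)
    ultimately show ?thesis using integral_exp[of t] by simp
  qed
  \<comment> \<open>Taylor coefficients in t of the other side, exp (t^2 |x|^2) times the Gaussian
    mass.\<close>
  define e where "e N = (if even N then norm x ^ N / fact (N div 2) * c else 0)" for N
  have e_sums: "(\<lambda>N. e N * t ^ N) sums (exp (t\<^sup>2 * (norm x)\<^sup>2) * c)" for t
  proof -
    have "(\<lambda>N. (if even N then (t\<^sup>2 * (norm x)\<^sup>2) ^ (N div 2) / fact (N div 2) * c else 0)) sums (0 + exp (t\<^sup>2 * (norm x)\<^sup>2) * c)"
      using sums_if[OF sums_zero sums_mult2[OF expo[of "t\<^sup>2 * (norm x)\<^sup>2"], of c]] by simp
    moreover have "(if even N then (t\<^sup>2 * (norm x)\<^sup>2) ^ (N div 2) / fact (N div 2) * c else 0) = e N * t ^ N" for N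
      by (auto simp: e_def power_mult_distrib power_mult[symmetric] elim!: evenE)
    ultimately show ?thesis by simp
  qed
  have "M (2 * k) - e (2 * k) = 0"
  proof (rule powser_eq_zero)
    fix t show "(\<lambda>k. (M k - e k) * t ^ k) sums 0"
      using sums_diff[OF M_sums[of t] e_sums[of t]] by (simp add: left_diff_distrib)
  qed
  then have M2k: "(\<integral>y. (2 * Re (?X y)) ^ (2 * k) * ?w y \<partial>lborel) = fact (2 * k) * (norm x ^ (2 * k) / fact k * c)"
    by (simp add: M_def e_def field_simps)
  define I where "I i = (\<integral>y. ?X y ^ i * cnj (?X y) ^ (2 * k - i) * complex_of_real (?w y) \<partial>lborel)" for i
  have int_I: "integrable lborel (\<lambda>y. ?X y ^ i * cnj (?X y) ^ (2 * k - i) * complex_of_real (?w y))" if "i \<le> 2 * k" for i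
    by (rule Bochner_Integration.integrable_bound[OF integrable_gauss_power[of x "2 * k"]])
      (use that in \<open>auto simp: norm_mult norm_power power_add[symmetric]\<close>)
  have "complex_of_real (\<integral>y. (2 * Re (?X y)) ^ (2 * k) * ?w y \<partial>lborel)
      = (\<integral>y. (?X y + cnj (?X y)) ^ (2 * k) * complex_of_real (?w y) \<partial>lborel)"
    by (simp add: integral_complex_of_real[symmetric] complex_add_cnj del: integral_complex_of_real)
  also have "\<dots> = (\<integral>y. (\<Sum>i\<le>2*k. of_nat ((2 * k) choose i) * (?X y ^ i * cnj (?X y) ^ (2 * k - i) * complex_of_real (?w y))) \<partial>lborel)"
  proof (rule Bochner_Integration.integral_cong[OF refl])
    fix y
    show "(?X y + cnj (?X y)) ^ (2 * k) * complex_of_real (?w y)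
      = (\<Sum>i\<le>2*k. of_nat ((2 * k) choose i) * (?X y ^ i * cnj (?X y) ^ (2 * k - i) * complex_of_real (?w y)))"
      by (subst binomial_ring, subst sum_distrib_right) (intro sum.cong refl, simp only: mult.assoc)
  qed
  also have "\<dots> = (\<Sum>i\<le>2*k. of_nat ((2 * k) choose i) * I i)"
    unfolding I_def by (subst Bochner_Integration.integral_sum) (auto intro!: integrable_mult_right int_I)
  \<comment> \<open>The summand with index i has bidegree (2k - i, i) in y, hence integrates to 0
    unless i = k.\<close>
  also have "\<dots> = of_nat ((2 * k) choose k) * I k"
  proof -
    have "I i = 0" if "i \<le> 2 * k" "i \<noteq> k" for i
      unfolding I_def
      by (rule integral_bidegree_eq_0[where i = i and l = "2 * k - i"])
        (use that in \<open>auto simp: cinner_cmul power_mult_distrib norm_cmul mult_ac\<close>)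
    then have "(\<Sum>i\<le>2*k. of_nat ((2 * k) choose i) * I i) = (\<Sum>i\<in>{k}. of_nat ((2 * k) choose i) * I i)"
      by (intro sum.mono_neutral_right) auto
    then show ?thesis by simp
  qed
  also have "I k = complex_of_real (\<integral>y. norm (?X y) ^ (2 * k) * ?w y \<partial>lborel)"
  proof -
    have "?X y ^ k * cnj (?X y) ^ (2 * k - k) * complex_of_real (?w y) = complex_of_real (norm (?X y) ^ (2 * k) * ?w y)" for y
    proof -
      have "?X y ^ k * cnj (?X y) ^ k = complex_of_real ((norm (?X y))\<^sup>2) ^ k"
        by (simp only: power_mult_distrib[symmetric] complex_norm_square)
      then show ?thesis by (simp add: power_mult)
    qed
    then show ?thesis unfolding I_def by (simp only: integral_complex_of_real)
  qed
  also have "of_nat ((2 * k) choose k) * complex_of_real (\<integral>y. norm (?X y) ^ (2 * k) * ?w y \<partial>lborel)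
      = complex_of_real (real ((2 * k) choose k) * (\<integral>y. norm (?X y) ^ (2 * k) * ?w y \<partial>lborel))"
    by (simp only: of_real_mult of_real_of_nat_eq)
  finally have "(\<integral>y. (2 * Re (?X y)) ^ (2 * k) * ?w y \<partial>lborel)
      = real ((2 * k) choose k) * (\<integral>y. norm (?X y) ^ (2 * k) * ?w y \<partial>lborel)"
    by (simp only: of_real_eq_iff)
  then have "fact (2 * k) * (norm x ^ (2 * k) / fact k * c)
      = real ((2 * k) choose k) * (\<integral>y. norm (?X y) ^ (2 * k) * ?w y \<partial>lborel)"
    by (simp only: M2k)
  moreover have "real ((2 * k) choose k) = fact (2 * k) / (fact k * fact k)"
    by (subst binomial_fact) auto
  ultimately have eq: "fact (2 * k) * (norm x ^ (2 * k) / fact k * c)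
      = fact (2 * k) / (fact k * fact k) * (\<integral>y. norm (?X y) ^ (2 * k) * ?w y \<partial>lborel)"
    by (simp only:)
  have fin: "I = f * Y * c" if "g * (Y / f * c) = g / (f * f) * I" "g \<noteq> 0" "f \<noteq> 0" for g f Y I :: real
    using that by (simp add: field_simps)
  show ?thesis unfolding c_def[symmetric] by (rule fin[OF eq]) auto
qed

lemma gauss_mass_pos: "gauss_mass TYPE('n::finite) > 0"
proof -
  \<comment> \<open>The trivial moment: x = 0 and exponent 0, where 0 ^ 0 = 1.\<close>
  have "(\<integral>\<^sup>+y. ennreal (norm (cinner (0 :: complex ^ 'n) y) ^ 0 * exp (- (norm (y :: complex ^ 'n))\<^sup>2)) \<partial>lborel)
     = emeasure lborel (cball (0 :: complex ^ 'n) 1) * ennreal (Gamma (real CARD('n) + 1))"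
    unfolding nn_integral_gauss_power by simp
  then have *: "(\<integral>\<^sup>+y. ennreal (exp (- (norm (y :: complex ^ 'n))\<^sup>2)) \<partial>lborel)
     = emeasure lborel (cball (0 :: complex ^ 'n) 1) * ennreal (Gamma (real CARD('n) + 1))"
    by simp
  have "Gamma (real CARD('n) + 1) > 0" by (intro Gamma_real_pos) simp
  then have "ennreal (Gamma (real CARD('n) + 1)) \<noteq> 0" by (metis ennreal_eq_0_iff linorder_not_le)
  then have "(\<integral>\<^sup>+y. ennreal (exp (- (norm (y :: complex ^ 'n))\<^sup>2)) \<partial>lborel) \<noteq> 0"
    unfolding * using emeasure_cball_pos[where 'a = "complex ^ 'n"] by (metis mult_eq_0_iff)
  moreover have "(\<integral>\<^sup>+y. ennreal (exp (- (norm (y :: complex ^ 'n))\<^sup>2)) \<partial>lborel) < \<infinity>"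
    using integrable_gauss_power[of "0 :: complex ^ 'n" 0] unfolding integrable_iff_bounded by simp
  ultimately show ?thesis unfolding gauss_mass_def by (simp add: enn2real_positive_iff zero_less_iff_neq_zero)
qed

text \<open>The Gaussian moment divided by Gamma (k + n + 1); for even exponents this is exact, and
  real exponents are compared with it below.\<close>

lemma ball_power_moment_even:
  fixes x :: "complex ^ 'n::finite"
  shows "(\<integral>\<^sup>+y. ennreal (norm (cinner x y) ^ (2 * k)) * indicator (cball 0 1) y \<partial>lborel)
    = ennreal (gauss_mass TYPE('n) * fact k / fact (k + CARD('n)) * norm x ^ (2 * k))"
proof -
  let ?\<nu> = "(\<integral>\<^sup>+y. ennreal (norm (cinner x y) ^ (2 * k)) * indicator (cball 0 1) y \<partial>lborel)"
  have G: "Gamma (real (2 * k) / 2 + CARD('n) + 1) = fact (k + CARD('n))"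
    using Gamma_fact[of "k + CARD('n)", where ?'a = real] by (simp add: add_ac)
  have "ennreal (fact k * norm x ^ (2 * k) * gauss_mass TYPE('n))
     = (\<integral>\<^sup>+y. ennreal (norm (cinner x y) ^ (2 * k) * exp (- (norm y)\<^sup>2)) \<partial>lborel)"
    unfolding gauss_moment_even[symmetric]
    by (rule nn_integral_eq_integral[symmetric]) (auto intro!: integrable_gauss_power)
  also have "\<dots> = ?\<nu> * ennreal (fact (k + CARD('n)))"
    unfolding nn_integral_gauss_power G ..
  finally have e: "?\<nu> * ennreal (fact (k + CARD('n))) = ennreal (fact k * norm x ^ (2 * k) * gauss_mass TYPE('n))" ..
  obtain v where v: "v \<ge> 0" "?\<nu> = ennreal v"
    using ball_power_moment_finite[of x "2 * k"] by (cases ?\<nu>) auto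
  have "ennreal (v * fact (k + CARD('n))) = ennreal (fact k * norm x ^ (2 * k) * gauss_mass TYPE('n))"
    using e v by (simp add: ennreal_mult)
  then have "v * fact (k + CARD('n)) = fact k * norm x ^ (2 * k) * gauss_mass TYPE('n)"
    using v gauss_mass_pos[where 'n = 'n] by (subst (asm) ennreal_inj) auto
  then have "v = gauss_mass TYPE('n) * fact k / fact (k + CARD('n)) * norm x ^ (2 * k)"
    by (simp add: field_simps)
  then show ?thesis unfolding v(2) by simp
qed

subsection \<open>Integrals of the kernel\<close>

lemma ball_measurable[measurable]:
  fixes c :: "'a::euclidean_space"
  shows "cball c r \<in> sets borel" "ball c r \<in> sets borel"
  by simp_all

lemma power_mult_fact_le: "real (k + 1) ^ n * fact k \<le> fact (k + n)"
proof (induction n)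
  case (Suc n)
  have "real (k + 1) ^ Suc n * fact k = real (k + 1) * (real (k + 1) ^ n * fact k)" by simp
  also have "\<dots> \<le> real (k + Suc n) * fact (k + n)"
    using Suc by (intro mult_mono) auto
  finally show ?case by simp
qed simp

lemma fact_add_le_power: "(fact (k + n) :: real) \<le> real (k + n) ^ n * fact k"
proof (induction n)
  case (Suc n)
  have "(fact (k + Suc n) :: real) = real (k + Suc n) * fact (k + n)" by simp
  also have "\<dots> \<le> real (k + Suc n) * (real (k + n) ^ n * fact k)"
    using Suc by (intro mult_left_mono) auto
  also have "\<dots> \<le> real (k + Suc n) * (real (k + Suc n) ^ n * fact k)"
    by (intro mult_left_mono mult_right_mono power_mono) auto
  finally show ?case by (simp add: mult_ac)
qed simp

lemma norm_cinner_normalize: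
  fixes x :: "complex ^ 'n::finite"
  assumes "x \<noteq> 0"
  shows "norm (cinner x y) = norm x * norm (cinner (x /\<^sub>R norm x) y)"
  using assms by (simp add: cinner_scaleR norm_mult norm_inverse)

text \<open>For unit x the modulus of <x, y> is at most 1 on the ball, so rounding j down to an even
  integer 2 k only increases the moment. The quotient k! / (k + n)! gives the power - n, and k + 1
  >= (j + 1) / 3 gives the constant 3^n.\<close>

lemma ball_moment_le:
  obtains C where "C > 0"
    "\<And>(x :: complex ^ 'n::finite) j. j > 0 \<Longrightarrow>
       ball_moment j x \<le> ennreal (C * (j + 1) powr (- real CARD('n)) * norm x powr j)"
proof -
  define C where "C = gauss_mass TYPE('n) * 3 ^ CARD('n)"
  have C: "C > 0" using gauss_mass_pos[where 'n = 'n] by (simp add: C_def)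
  show ?thesis
  proof (rule that[OF C])
    fix x :: "complex ^ 'n" and j :: real
    assume j: "j > 0"
    show "ball_moment j x \<le> ennreal (C * (j + 1) powr (- real CARD('n)) * norm x powr j)"
    proof (cases "x = 0")
      case True
      then show ?thesis by (simp add: ball_moment_def cinner_def)
    next
      case False
      define k where "k = nat \<lfloor>j / 2\<rfloor>"
      have k: "real (2 * k) \<le> j" "j < 2 * real k + 2" using j unfolding k_def by linarith+
      define \<omega> where "\<omega> = x /\<^sub>R norm x"
      have \<omega>: "norm \<omega> = 1" using False by (simp add: \<omega>_def)
      have "ball_moment j x \<le> (\<integral>\<^sup>+y. ennreal (norm x powr j) * (ennreal (norm (cinner \<omega> y) ^ (2 * k)) * indicator (cball 0 1) y) \<partial>lborel)"
        unfolding ball_moment_def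
      proof (intro nn_integral_mono)
        fix y :: "complex ^ 'n"
        show "ennreal (norm (cinner x y) powr j) * indicator (cball 0 1) y
          \<le> ennreal (norm x powr j) * (ennreal (norm (cinner \<omega> y) ^ (2 * k)) * indicator (cball 0 1) y)"
        proof (cases "norm y \<le> 1")
          case True
          define s where "s = norm (cinner \<omega> y)"
          have s: "0 \<le> s" "s \<le> 1" using norm_cinner_le[of \<omega> y] True \<omega> by (auto simp: s_def)
          have "s powr j \<le> s ^ (2 * k)"
          proof (cases "s = 0")
            case True
            then show ?thesis using j by simp
          next
            case False
            then have "s powr j \<le> s powr (real (2 * k))" using s k by (intro powr_mono') auto
            then show ?thesis using s False by (simp add: powr_realpow del: of_nat_mult)
          qed
          then have "(norm x * s) powr j \<le> norm x powr j * s ^ (2 * k)"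
            using s by (simp add: powr_mult mult_left_mono)
          then have "norm (cinner x y) powr j \<le> norm x powr j * s ^ (2 * k)"
            using norm_cinner_normalize[OF False, of y] by (simp add: s_def \<omega>_def)
          then show ?thesis using True s by (auto simp: s_def ennreal_mult[symmetric] intro!: ennreal_leI)
        qed (simp add: indicator_def)
      qed
      also have "\<dots> = ennreal (norm x powr j) * (\<integral>\<^sup>+y. ennreal (norm (cinner \<omega> y) ^ (2 * k)) * indicator (cball 0 1) y \<partial>lborel)"
        by (rule nn_integral_cmult) measurable
      also have "\<dots> = ennreal (norm x powr j * (gauss_mass TYPE('n) * (fact k / fact (k + CARD('n)))))"
        unfolding ball_power_moment_even using \<omega> gauss_mass_pos[where 'n = 'n] by (simp add: ennreal_mult[symmetric])
      also have "\<dots> \<le> ennreal (norm x powr j * (gauss_mass TYPE('n) * (3 ^ CARD('n) * (j + 1) powr (- real CARD('n)))))"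
      proof (intro ennreal_leI mult_left_mono)
        have "fact k / fact (k + CARD('n)) \<le> fact k / (real (k + 1) ^ CARD('n) * fact k)"
          using power_mult_fact_le[of k "CARD('n)"] by (intro divide_left_mono) auto
        also have "\<dots> = 1 / real (k + 1) ^ CARD('n)" by simp
        also have "\<dots> \<le> 1 / ((j + 1) / 3) ^ CARD('n)"
          using k j by (intro divide_left_mono power_mono) auto
        also have "\<dots> = 3 ^ CARD('n) * (j + 1) powr (- real CARD('n))"
          using j by (simp add: powr_minus powr_realpow power_divide field_simps)
        finally show "fact k / fact (k + CARD('n)) \<le> 3 ^ CARD('n) * (j + 1) powr (- real CARD('n))" .
      qed (use gauss_mass_pos[where 'n = 'n] in auto)
      also have "norm x powr j * (gauss_mass TYPE('n) * (3 ^ CARD('n) * (j + 1) powr (- real CARD('n))))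
         = C * (j + 1) powr (- real CARD('n)) * norm x powr j"
        by (simp add: C_def mult_ac)
      finally show ?thesis .
    qed
  qed
qed

text \<open>Legendre's duplication formula. The kernel coefficients contain 1 / Gamma (2 z) with z =
  (n + k) / (2 m) whereas the moments contain a Gamma near z; after the duplication a single 1 /
  Gamma z survives, and 4^(-z) accounts for the 4 in b^2 / (4 A).\<close>

lemma Gamma_double_ge:
  fixes x0 :: real
  assumes "x0 > 0"
  obtains C where "C > 0" "\<And>z. z \<ge> x0 \<Longrightarrow> 1 / Gamma (2 * z) \<le> C * 4 powr (- z) * z powr (- 1/2) / (Gamma z)\<^sup>2"
proof -
  obtain C where C: "C > 0" "\<And>x. x \<ge> x0 \<Longrightarrow> Gamma (x + 1/2) \<le> C * (Gamma x * x powr (1/2))"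
    "\<And>x. x \<ge> x0 \<Longrightarrow> Gamma x * x powr (1/2) \<le> C * Gamma (x + 1/2)"
    by (rule Gamma_add_asymp[OF assms, of "1/2"]) auto
  show ?thesis
  proof (rule that[of "2 * sqrt pi * C"])
    fix z assume z: "z \<ge> x0"
    then have z0: "z > 0" using assms by simp
    have G: "Gamma z > 0" "Gamma (z + 1/2) > 0" "Gamma (2 * z) > 0"
      using z0 by (auto intro!: Gamma_real_pos)
    have nonpos: "complex_of_real x \<notin> \<int>\<^sub>\<le>\<^sub>0" if "x > 0" for x
      using that by (auto elim!: nonpos_Ints_cases' simp: complex_eq_iff)
    have "complex_of_real (Gamma z * Gamma (z + 1/2)) = complex_of_real (exp ((1 - 2 * z) * ln 2) * sqrt pi * Gamma (2 * z))"
      using Gamma_legendre_duplication[of "complex_of_real z"] nonpos[OF z0] nonpos[of "z + 1/2"] z0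
      by (simp add: Gamma_complex_of_real[symmetric] exp_of_real[symmetric])
    then have dup: "Gamma z * Gamma (z + 1/2) = exp ((1 - 2 * z) * ln 2) * sqrt pi * Gamma (2 * z)"
      unfolding of_real_eq_iff .
    have "exp ((1 - 2 * z) * ln 2) = 2 * 4 powr (- z)"
    proof -
      have "(4::real) powr (- z) = (2 powr 2) powr (- z)" by simp
      also have "\<dots> = exp ((- 2 * z) * ln 2)" unfolding powr_powr by (simp add: powr_def)
      finally show ?thesis by (simp add: left_diff_distrib exp_diff exp_minus field_simps)
    qed
    with dup have d: "Gamma z * Gamma (z + 1/2) = 2 * 4 powr (- z) * sqrt pi * Gamma (2 * z)" by simp
    have "Gamma z * (Gamma z * z powr (1/2)) \<le> Gamma z * (C * Gamma (z + 1/2))"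
      using C(3)[OF z] G by (intro mult_left_mono) auto
    also have "\<dots> = C * (2 * 4 powr (- z) * sqrt pi * Gamma (2 * z))"
      unfolding d[symmetric] by (simp add: mult_ac)
    finally have "(Gamma z)\<^sup>2 * z powr (1/2) \<le> (2 * sqrt pi * C) * 4 powr (- z) * Gamma (2 * z)"
      by (simp add: power2_eq_square mult_ac)
    then have "1 * ((Gamma z)\<^sup>2 * z powr (1/2)) \<le> ((2 * sqrt pi * C) * 4 powr (- z)) * Gamma (2 * z)"
      by simp
    moreover have "(Gamma z)\<^sup>2 * z powr (1/2) > 0" using G(1) z0 by (intro mult_pos_pos zero_less_power) auto
    ultimately have "1 / Gamma (2 * z) \<le> ((2 * sqrt pi * C) * 4 powr (- z)) / ((Gamma z)\<^sup>2 * z powr (1/2))"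
      using G by (simp only: frac_le_eq divide_le_eq pos_le_divide_eq pos_divide_le_eq) (simp add: field_simps)
    then show "1 / Gamma (2 * z) \<le> 2 * sqrt pi * C * 4 powr (- z) * z powr (- 1/2) / (Gamma z)\<^sup>2"
      using z0 by (simp add: powr_minus_divide mult_ac)
  qed (use C in auto)
qed

text \<open>In the variable z = (n + k) / (2 m) the summand is bounded by a constant times V^w z^e
  V^z / Gamma z with w = \<tau> / 2 - 1 / 4 - v0. Summation over z gives V^(e + 1) exp V, and w + e
  + 1 = 0: no power of V is left over, which is exactly what the critical exponent demands.\<close>

lemma kcoef_series_bound:
  fixes \<tau> m :: real
  assumes m: "m > 0" "m \<le> 1" and n: "n \<ge> 1" and \<tau>: "\<tau> \<ge> 0"
  obtains C where "C > 0"
    "\<And>V K. V \<ge> 1 \<Longrightarrow>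
      (\<Sum>k<K. kcoef m n k * real (k + 1) powr (- \<tau>) * (real k + 1/2) powr (- real n) *
         (4 * V) powr ((real k + m * (\<tau> - 1/2)) / (2 * m)) *
         Gamma ((real k + m * (\<tau> - 1/2) + 2 * n) / (2 * m) + 1)) \<le> C * exp V"
proof -
  define v0 where "v0 = real n / (2 * m)"
  define D where "D = 1 / (2 * m)"
  \<comment> \<open>The Gamma argument in the summand is z + d. The exponent \<open>e\<close>
    collects - 1 - \<tau> from the powers of n + k, - 1/2 from duplication and d from Gamma (z +
    d).\<close>
  define d where "d = v0 + \<tau> / 2 + 3 / 4"
  define e where "e = v0 - \<tau> / 2 - 3 / 4"
  have v0: "v0 > 0" and D: "D \<ge> 1/2" and d: "d \<ge> 0" using m n \<tau> by (auto simp: v0_def D_def d_def field_simps)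
  obtain C1 where C1: "C1 > 0" "\<And>x. x \<ge> v0 \<Longrightarrow> Gamma (x + d) \<le> C1 * (Gamma x * x powr d)"
    "\<And>x. x \<ge> v0 \<Longrightarrow> Gamma x * x powr d \<le> C1 * Gamma (x + d)"
    by (rule Gamma_add_asymp[OF v0 d]) blast
  obtain C2 where C2: "C2 > 0"
    "\<And>z. z \<ge> v0 \<Longrightarrow> 1 / Gamma (2 * z) \<le> C2 * 4 powr (- z) * z powr (- 1/2) / (Gamma z)\<^sup>2"
    by (rule Gamma_double_ge[OF v0]) blast
  obtain C3 where C3: "C3 > 0"
    "\<And>u K. u \<ge> 1 \<Longrightarrow> (\<Sum>k<K. (v0 + real k * D) powr e * u powr (v0 + real k * D) / Gamma (v0 + real k * D))
      \<le> C3 * u powr (e + 1) * exp u"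
    by (rule sum_powr_over_Gamma_le[OF v0 D, of e]) blast
  define C4 where "C4 = (real n) powr \<tau> * (2 * real n) powr n * (2 * m) powr (- 1 - \<tau>) * C2 * C1 * 4 powr (\<tau> / 2 - 1 / 4 - v0)"
  have C4: "C4 > 0" using m n C1 C2 by (simp add: C4_def)
  show ?thesis
  proof (rule that[of "C4 * C3"])
    fix V :: real and K :: nat
    assume V: "V \<ge> 1"
    have term_le: "kcoef m n k * real (k + 1) powr (- \<tau>) * (real k + 1/2) powr (- real n) *
         (4 * V) powr ((real k + m * (\<tau> - 1/2)) / (2 * m)) *
         Gamma ((real k + m * (\<tau> - 1/2) + 2 * n) / (2 * m) + 1)
       \<le> C4 * V powr (\<tau> / 2 - 1 / 4 - v0) * ((v0 + real k * D) powr e * V powr (v0 + real k * D) / Gamma (v0 + real k * D))" for k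
    proof -
      define z where "z = v0 + real k * D"
      have z: "z \<ge> v0" "z > 0" using v0 D by (auto simp: z_def add_pos_nonneg)
      have nk: "real (n + k) = 2 * m * z" using m by (simp add: z_def v0_def D_def field_simps)
      have nk0: "real (n + k) > 0" using n by simp
      have Gz: "Gamma z > 0" using z by (intro Gamma_real_pos)
      have E1: "(real k + m * (\<tau> - 1/2)) / (2 * m) = z + (\<tau> / 2 - 1 / 4 - v0)"
        using m by (simp add: z_def v0_def D_def field_simps)
      have E2: "(real k + m * (\<tau> - 1/2) + 2 * n) / (2 * m) + 1 = z + d"
        using m by (simp add: z_def d_def v0_def D_def field_simps)
      have t1: "kcoef m n k \<le> real (n + k) powr (real n - 1) * (C2 * 4 powr (- z) * z powr (- 1/2) / (Gamma z)\<^sup>2)"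
      proof -
        have "real (n + k) / m = 2 * z" unfolding nk using m by simp
        then have "kcoef m n k \<le> real (n + k) powr (real n - 1) * (1 / Gamma (2 * z))"
          using kcoef_le_powr[OF m n, of k] by simp
        also have "\<dots> \<le> real (n + k) powr (real n - 1) * (C2 * 4 powr (- z) * z powr (- 1/2) / (Gamma z)\<^sup>2)"
          by (intro mult_left_mono C2 z) simp
        finally show ?thesis .
      qed
      have t2: "real (k + 1) powr (- \<tau>) \<le> real n powr \<tau> * real (n + k) powr (- \<tau>)"
      proof -
        have "real (n + k) / real n \<le> real (k + 1)"
        proof -
          have "real k * 1 \<le> real k * real n" using n by (intro mult_left_mono) auto
          then show ?thesis using n by (simp add: field_simps)
        qed
        then have "real (k + 1) powr (- \<tau>) \<le> (real (n + k) / real n) powr (- \<tau>)"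
          using n \<tau> by (intro powr_mono2') auto
        also have "\<dots> = real n powr \<tau> * real (n + k) powr (- \<tau>)"
          using n by (simp add: powr_divide powr_minus field_simps)
        finally show ?thesis .
      qed
      have t3: "(real k + 1/2) powr (- real n) \<le> (2 * real n) powr n * real (n + k) powr (- real n)"
      proof -
        have "real (n + k) / (2 * real n) \<le> real k + 1/2"
        proof -
          have "real k * 1 \<le> real k * (2 * real n)" using n by (intro mult_left_mono) auto
          then show ?thesis using n by (simp add: field_simps)
        qed
        then have "(real k + 1/2) powr (- real n) \<le> (real (n + k) / (2 * real n)) powr (- real n)"
          using n by (intro powr_mono2') auto
        also have "\<dots> = (2 * real n) powr n * real (n + k) powr (- real n)"
          using n by (simp add: powr_divide powr_minus field_simps)
        finally show ?thesis .
      qed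
      have t5: "Gamma (z + d) \<le> C1 * (Gamma z * z powr d)" by (intro C1 z)
      have "kcoef m n k * real (k + 1) powr (- \<tau>) * (real k + 1/2) powr (- real n) * (4 * V) powr (z + (\<tau> / 2 - 1 / 4 - v0)) * Gamma (z + d)
        \<le> (real (n + k) powr (real n - 1) * (C2 * 4 powr (- z) * z powr (- 1/2) / (Gamma z)\<^sup>2))
          * (real n powr \<tau> * real (n + k) powr (- \<tau>)) * ((2 * real n) powr n * real (n + k) powr (- real n))
          * (4 * V) powr (z + (\<tau> / 2 - 1 / 4 - v0)) * (C1 * (Gamma z * z powr d))"
      proof -
        have mono5: "x1 * x2 * x3 * w * x5 \<le> y1 * y2 * y3 * w * y5"
          if "x1 \<le> y1" "x2 \<le> y2" "x3 \<le> y3" "x5 \<le> y5" "0 \<le> x1" "0 \<le> x2" "0 \<le> x3" "0 \<le> w" "0 \<le> x5"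
          for x1 x2 x3 x5 y1 y2 y3 y5 w :: real
          using that by (intro mult_mono mult_nonneg_nonneg order_refl) auto
        have "Gamma (z + d) > 0" using z d by (intro Gamma_real_pos) auto
        then show ?thesis
          using kcoef_pos[OF m(1) n, of k] by (intro mono5 t1 t2 t3 t5) auto
      qed
      also have "\<dots> = (real n powr \<tau> * (2 * real n) powr n * C2 * C1) * (real (n + k) powr (real n - 1) * real (n + k) powr (- \<tau>) * real (n + k) powr (- real n))
          * (4 powr (- z) * (4 * V) powr (z + (\<tau> / 2 - 1 / 4 - v0))) * (z powr (- 1/2) * z powr d) / Gamma z"
        using Gz by (simp add: power2_eq_square)
      also have "real (n + k) powr (real n - 1) * real (n + k) powr (- \<tau>) * real (n + k) powr (- real n) = (2 * m) powr (- 1 - \<tau>) * z powr (- 1 - \<tau>)"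
      proof -
        have "real (n + k) powr (real n - 1) * real (n + k) powr (- \<tau>) * real (n + k) powr (- real n) = real (n + k) powr (- 1 - \<tau>)"
          by (simp add: powr_add[symmetric])
        also have "\<dots> = (2 * m) powr (- 1 - \<tau>) * z powr (- 1 - \<tau>)" unfolding nk by (rule powr_mult)
        finally show ?thesis .
      qed
      also have "4 powr (- z) * (4 * V) powr (z + (\<tau> / 2 - 1 / 4 - v0)) = 4 powr (\<tau> / 2 - 1 / 4 - v0) * V powr (\<tau> / 2 - 1 / 4 - v0) * V powr z"
      proof -
        have key: "4 powr (- z) * (4 * V) powr (z + w) = 4 powr w * V powr w * V powr z" for w
        proof -
          have e1: "(4::real) powr (- z) * 4 powr (z + w) = 4 powr w" by (simp add: powr_add[symmetric])
          have e2: "V powr (z + w) = V powr w * V powr z" by (simp add: powr_add mult.commute)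
          show ?thesis by (simp only: powr_mult mult.assoc[symmetric] e1) (simp only: e2 mult.assoc)
        qed
        show ?thesis by (rule key)
      qed
      also have "z powr (- 1/2) * z powr d = z powr (d - 1/2)"
        by (simp add: powr_add[symmetric])
      also have "(real n powr \<tau> * (2 * real n) powr n * C2 * C1) * ((2 * m) powr (- 1 - \<tau>) * z powr (- 1 - \<tau>))
          * (4 powr (\<tau> / 2 - 1 / 4 - v0) * V powr (\<tau> / 2 - 1 / 4 - v0) * V powr z) * z powr (d - 1/2) / Gamma z
          = C4 * V powr (\<tau> / 2 - 1 / 4 - v0) * ((z powr (- 1 - \<tau>) * z powr (d - 1/2)) * V powr z / Gamma z)"
        unfolding C4_def by (simp only: mult_ac times_divide_eq_left times_divide_eq_right)
      also have "z powr (- 1 - \<tau>) * z powr (d - 1/2) = z powr e"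
        by (simp add: powr_add[symmetric] e_def d_def)
      finally show ?thesis unfolding E1 E2 z_def .
    qed
    have "(\<Sum>k<K. kcoef m n k * real (k + 1) powr (- \<tau>) * (real k + 1/2) powr (- real n) *
         (4 * V) powr ((real k + m * (\<tau> - 1/2)) / (2 * m)) *
         Gamma ((real k + m * (\<tau> - 1/2) + 2 * n) / (2 * m) + 1))
       \<le> (\<Sum>k<K. C4 * V powr (\<tau> / 2 - 1 / 4 - v0) * ((v0 + real k * D) powr e * V powr (v0 + real k * D) / Gamma (v0 + real k * D)))"
      by (intro sum_mono term_le)
    also have "\<dots> = C4 * V powr (\<tau> / 2 - 1 / 4 - v0) * (\<Sum>k<K. (v0 + real k * D) powr e * V powr (v0 + real k * D) / Gamma (v0 + real k * D))"
      by (simp only: sum_distrib_left)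
    also have "\<dots> \<le> C4 * V powr (\<tau> / 2 - 1 / 4 - v0) * (C3 * V powr (e + 1) * exp V)"
      using C4 by (intro mult_left_mono C3 V) auto
    also have "\<dots> = C4 * C3 * (V powr (\<tau> / 2 - 1 / 4 - v0) * V powr (e + 1)) * exp V"
      by simp
    \<comment> \<open>The exact cancellation of powers of V.\<close>
    also have "V powr (\<tau> / 2 - 1 / 4 - v0) * V powr (e + 1) = 1"
      using V by (simp add: powr_add[symmetric] e_def)
    finally show "(\<Sum>k<K. kcoef m n k * real (k + 1) powr (- \<tau>) * (real k + 1/2) powr (- real n) *
         (4 * V) powr ((real k + m * (\<tau> - 1/2)) / (2 * m)) *
         Gamma ((real k + m * (\<tau> - 1/2) + 2 * n) / (2 * m) + 1)) \<le> C4 * C3 * exp V"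
      by simp
  qed (use C3 C4 in auto)
qed

lemma kfun_measurable[measurable]:
  assumes [measurable]: "f \<in> borel_measurable M"
  shows "(\<lambda>x. kfun m n (f x)) \<in> borel_measurable M"
  unfolding kfun_def by measurable

lemma cis_measurable[measurable]: "cis \<in> borel_measurable borel"
  by (intro borel_measurable_continuous_onI continuous_intros)

lemma nn_integral_radial_moment:
  fixes x :: "complex ^ 'n::finite"
  assumes "j > 0" "A > 0" "m > 0"
  shows "(\<integral>\<^sup>+y. ennreal (norm (cinner x y) powr j) * ennreal (exp (- A * norm y powr (2 * m))) \<partial>lborel)
    = ball_moment j x * ennreal (A powr (- (j + 2 * CARD('n)) / (2 * m)) * Gamma ((j + 2 * CARD('n)) / (2 * m) + 1))"
proof -
  have "(\<integral>\<^sup>+y. ennreal (norm (cinner x y) powr j) * ennreal (exp (- A * norm y powr (2 * m))) \<partial>lborel)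
    = (\<integral>\<^sup>+y. ennreal (norm (cinner x y) powr j) * indicator (cball 0 1) y \<partial>lborel) *
      ennreal (A powr (- (j + DIM(complex ^ 'n)) / (2 * m)) * Gamma ((j + DIM(complex ^ 'n)) / (2 * m) + 1))"
    using assms by (intro nn_integral_homogeneous_exp)
      (auto simp: cinner_scaleR norm_mult powr_mult ennreal_mult)
  then show ?thesis by (simp add: ball_moment_def mult.commute)
qed

lemma nn_integral_exp_radial_finite:
  assumes "A > 0" "m > 0"
  shows "(\<integral>\<^sup>+y. ennreal (exp (- A * norm (y :: complex ^ 'n::finite) powr (2 * m))) \<partial>lborel) < \<infinity>"
proof -
  have "(\<integral>\<^sup>+y. 1 * ennreal (exp (- A * norm (y :: complex ^ 'n) powr (2 * m))) \<partial>lborel)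
    = (\<integral>\<^sup>+y. 1 * indicator (cball 0 1) (y :: complex ^ 'n) \<partial>lborel) *
      ennreal (A powr (- ((0::real) + DIM(complex ^ 'n)) / (2 * m)) * Gamma (((0::real) + DIM(complex ^ 'n)) / (2 * m) + 1))"
    using assms by (intro nn_integral_homogeneous_exp) auto
  then have e: "(\<integral>\<^sup>+y. ennreal (exp (- A * norm (y :: complex ^ 'n) powr (2 * m))) \<partial>lborel)
    = emeasure lborel (cball (0 :: complex ^ 'n) 1) *
      ennreal (A powr (- ((0::real) + DIM(complex ^ 'n)) / (2 * m)) * Gamma (((0::real) + DIM(complex ^ 'n)) / (2 * m) + 1))"
    by simp
  show ?thesis unfolding e
    using emeasure_lborel_cball_finite[of "0 :: complex ^ 'n" 1] by (simp add: ennreal_mult_less_top)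
qed

text \<open>Both series of the circle estimate have this form: \<tau> = 0 is the sum of the
  coefficients times the angular width, \<tau> = 1 the weighted sum divided by it. The index k0
  removes a term whose exponent would not be positive.\<close>

lemma weighted_series_integral_bound:
  fixes \<tau> m A b :: real and k0 :: nat
  assumes m: "m > 0" "m \<le> 1" and \<tau>: "\<tau> \<ge> 0" and A: "A > 0" and b: "b > 0"
    and k0: "real k0 + m * (\<tau> - 1/2) > 0"
  obtains C where "C > 0"
    "\<And>x :: complex ^ 'n::finite.
      (\<Sum>k. \<integral>\<^sup>+y. ennreal (kcoef m CARD('n) (k + k0) * real (k + k0 + 1) powr (- \<tau>)
           * norm (complex_of_real (b powr (1 / m)) * cinner x y) powr (real (k + k0) + m * (\<tau> - 1/2)))
         * ennreal (exp (- A * norm y powr (2 * m))) \<partial>lborel)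
      \<le> ennreal (C * exp (b\<^sup>2 / (4 * A) * norm x powr (2 * m)))"
proof -
  let ?n = "CARD('n)"
  have n: "?n \<ge> 1" by (simp add: Suc_le_eq)
  define \<beta> where "\<beta> = b powr (1 / m)"
  have \<beta>: "\<beta> > 0" using b by (simp add: \<beta>_def)
  define j where "j k = real k + m * (\<tau> - 1/2)" for k
  obtain C1 where C1: "C1 > 0"
    "\<And>(x :: complex ^ 'n) j. j > 0 \<Longrightarrow> ball_moment j x \<le> ennreal (C1 * (j + 1) powr (- real ?n) * norm x powr j)"
    by (rule ball_moment_le[where 'n = 'n]) blast
  define a where "a V k = kcoef m ?n k * real (k + 1) powr (- \<tau>) * (real k + 1/2) powr (- real ?n) *
         (4 * V) powr (j k / (2 * m)) * Gamma ((j k + 2 * ?n) / (2 * m) + 1)" for V k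
  obtain C2 where C2: "C2 > 0" "\<And>V K. V \<ge> 1 \<Longrightarrow> (\<Sum>k<K. a V k) \<le> C2 * exp V"
    unfolding a_def j_def by (rule kcoef_series_bound[OF m n \<tau>]) blast
  have jn: "j k + 2 * real ?n > 0" for k
  proof -
    have "m * (\<tau> - 1/2) \<ge> m * (- 1/2)" using m \<tau> by (intro mult_left_mono) auto
    moreover have "real ?n \<ge> 1" using n by linarith
    ultimately show ?thesis using m(2) unfolding j_def by linarith
  qed
  have kc: "kcoef m ?n k > 0" for k by (rule kcoef_pos[OF m(1) n])
  have Gp: "Gamma ((j k + 2 * ?n) / (2 * m) + 1) > 0" for k
  proof -
    have "0 < j k + 2 * ?n" using jn[of k] by simp
    then have "0 < (j k + 2 * ?n) / (2 * m)" by (rule divide_pos_pos) (use m in simp)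
    then have "0 < (j k + 2 * ?n) / (2 * m) + 1" by linarith
    then show ?thesis by (rule Gamma_real_pos)
  qed
  have a0: "a V k \<ge> 0" for V k unfolding a_def using kc[of k] Gp[of k] by (simp add: less_imp_le)
  define C3 where "C3 = C1 * A powr (- real ?n / m)"
  have C3: "C3 > 0" using C1 A by (simp add: C3_def)
  show ?thesis
  proof (rule that[of "C3 * C2 * exp 1"])
    fix x :: "complex ^ 'n"
    define V where "V = b\<^sup>2 / (4 * A) * norm x powr (2 * m)"
    have V: "V \<ge> 0" using A by (simp add: V_def)
    \<comment> \<open>The series bound requires V >= 1; passing to max V 1 costs only the factor exp
      1.\<close>
    define V' where "V' = max V 1"
    define I where "I k = (\<integral>\<^sup>+y. ennreal (kcoef m ?n k * real (k + 1) powr (- \<tau>)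
           * norm (complex_of_real \<beta> * cinner x y) powr j k) * ennreal (exp (- A * norm y powr (2 * m))) \<partial>lborel)" for k
    have I_le: "I k \<le> ennreal (C3 * a V' k)" if k: "k \<ge> k0" for k
    proof -
      have jk: "j k > 0" using k0 k by (simp add: j_def)
      have nb: "norm (complex_of_real \<beta> * z) powr j k = \<beta> powr j k * norm z powr j k" for z :: complex
        using \<beta> by (simp add: norm_mult powr_mult)
      have "I k = (\<integral>\<^sup>+y. ennreal (kcoef m ?n k * real (k + 1) powr (- \<tau>) * \<beta> powr j k)
          * (ennreal (norm (cinner x y) powr j k) * ennreal (exp (- A * norm y powr (2 * m)))) \<partial>lborel)"
        unfolding I_def nb using kc[of k]
        by (intro nn_integral_cong) (simp add: ennreal_mult[symmetric] mult_ac)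
      also have "\<dots> = ennreal (kcoef m ?n k * real (k + 1) powr (- \<tau>) * \<beta> powr j k)
          * (\<integral>\<^sup>+y. ennreal (norm (cinner x y) powr j k) * ennreal (exp (- A * norm y powr (2 * m))) \<partial>lborel)"
        by (rule nn_integral_cmult) measurable
      also have "\<dots> = ennreal (kcoef m ?n k * real (k + 1) powr (- \<tau>) * \<beta> powr j k) *
         (ball_moment (j k) x * ennreal (A powr (- (j k + 2 * ?n) / (2 * m)) * Gamma ((j k + 2 * ?n) / (2 * m) + 1)))"
        by (subst nn_integral_radial_moment[OF jk A m(1)]) simp
      also have "\<dots> \<le> ennreal (kcoef m ?n k * real (k + 1) powr (- \<tau>) * \<beta> powr j k) *
         (ennreal (C1 * (j k + 1) powr (- real ?n) * norm x powr j k) *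
          ennreal (A powr (- (j k + 2 * ?n) / (2 * m)) * Gamma ((j k + 2 * ?n) / (2 * m) + 1)))"
        by (intro mult_left_mono mult_right_mono C1(2) jk) auto
      also have "\<dots> = ennreal ((kcoef m ?n k * real (k + 1) powr (- \<tau>) * \<beta> powr j k) *
         ((C1 * (j k + 1) powr (- real ?n) * norm x powr j k) *
          (A powr (- (j k + 2 * ?n) / (2 * m)) * Gamma ((j k + 2 * ?n) / (2 * m) + 1))))"
        using kc[of k] C1(1) Gp[of k] by (simp add: ennreal_mult[symmetric] less_imp_le)
      also have "\<dots> \<le> ennreal (C3 * a V' k)"
      proof (rule ennreal_leI)
        \<comment> \<open>For \<open>V\<close> in place of \<open>V'\<close> this is an equality:
          every power of b, |x| and A combines into the single parameter V. Monotonicity in V uses j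
          k > 0.\<close>
        have pw: "\<beta> powr j k * norm x powr j k * A powr (- (j k + 2 * ?n) / (2 * m)) \<le> A powr (- real ?n / m) * (4 * V') powr (j k / (2 * m))"
        proof -
          have "(4 * V) powr (j k / (2 * m)) = (b\<^sup>2 * norm x powr (2 * m) / A) powr (j k / (2 * m))"
            using A by (simp add: V_def)
          also have "\<dots> = b powr (2 * (j k / (2 * m))) * norm x powr j k * A powr (- (j k / (2 * m)))"
          proof -
            have "b\<^sup>2 powr E = b powr (2 * E)" for E
              using b powr_powr[of b 2 E] by simp
            moreover have "(norm x powr (2 * m)) powr (j k / (2 * m)) = norm x powr j k"
              using m by (simp add: powr_powr)
            moreover have "(z / A) powr E = z powr E * A powr (- E)" for z E
              by (simp add: powr_divide powr_minus_divide)
            ultimately show ?thesis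
              by (simp only: powr_mult)
          qed
          also have "b powr (2 * (j k / (2 * m))) = \<beta> powr j k"
            by (simp add: \<beta>_def powr_powr)
          finally have e1: "(4 * V) powr (j k / (2 * m)) = \<beta> powr j k * norm x powr j k * A powr (- (j k / (2 * m)))" .
          have "- (j k + 2 * ?n) / (2 * m) = - (j k / (2 * m)) + - real ?n / m"
            using m by (simp add: field_simps)
          then have "A powr (- (j k + 2 * ?n) / (2 * m)) = A powr (- (j k / (2 * m))) * A powr (- real ?n / m)"
            by (simp only: powr_add)
          then have "\<beta> powr j k * norm x powr j k * A powr (- (j k + 2 * ?n) / (2 * m)) = A powr (- real ?n / m) * (4 * V) powr (j k / (2 * m))"
            unfolding e1 by (simp only: mult_ac)
          also have "\<dots> \<le> A powr (- real ?n / m) * (4 * V') powr (j k / (2 * m))"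
            using V jk m by (intro mult_left_mono powr_mono2) (auto simp: V'_def)
          finally show ?thesis .
        qed
        \<comment> \<open>The exponent j k is at least k - 1/2 because m <= 1 and \<tau> >= 0; this
          is the origin of the base k + 1/2 in the series.\<close>
        have jj: "(j k + 1) powr (- real ?n) \<le> (real k + 1/2) powr (- real ?n)"
        proof (rule powr_mono2')
          have "m * (\<tau> - 1/2) \<ge> m * (- 1/2)" using m \<tau> by (intro mult_left_mono) auto
          then show "real k + 1/2 \<le> j k + 1" using m(2) unfolding j_def by linarith
        qed auto
        define c where "c = kcoef m ?n k * real (k + 1) powr (- \<tau>) * C1 * Gamma ((j k + 2 * ?n) / (2 * m) + 1)"
        have c: "c \<ge> 0" using kc[of k] C1(1) Gp[of k] by (simp add: c_def less_imp_le)
        have "(kcoef m ?n k * real (k + 1) powr (- \<tau>) * \<beta> powr j k) *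
         ((C1 * (j k + 1) powr (- real ?n) * norm x powr j k) *
          (A powr (- (j k + 2 * ?n) / (2 * m)) * Gamma ((j k + 2 * ?n) / (2 * m) + 1)))
          = c * ((j k + 1) powr (- real ?n) * (\<beta> powr j k * norm x powr j k * A powr (- (j k + 2 * ?n) / (2 * m))))"
          unfolding c_def by (simp only: mult_ac)
        also have "\<dots> \<le> c * ((real k + 1/2) powr (- real ?n) * (A powr (- real ?n / m) * (4 * V') powr (j k / (2 * m))))"
          by (intro mult_left_mono mult_mono jj pw c) auto
        also have "\<dots> = C3 * a V' k"
          unfolding c_def C3_def a_def by (simp only: mult_ac)
        finally show "(kcoef m ?n k * real (k + 1) powr (- \<tau>) * \<beta> powr j k) *
         ((C1 * (j k + 1) powr (- real ?n) * norm x powr j k) *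
          (A powr (- (j k + 2 * ?n) / (2 * m)) * Gamma ((j k + 2 * ?n) / (2 * m) + 1))) \<le> C3 * a V' k" .
      qed
      finally show ?thesis .
    qed
    have "(\<Sum>k. I (k + k0)) \<le> ennreal (C3 * C2 * exp 1 * exp V)"
    proof (rule suminf_le_const[OF summableI])
      fix K
      have "(\<Sum>k<K. I (k + k0)) \<le> (\<Sum>k<K. ennreal (C3 * a V' (k + k0)))"
        by (intro sum_mono I_le) simp
      also have "\<dots> = ennreal (\<Sum>k<K. C3 * a V' (k + k0))"
        using C3 a0 by (intro sum_ennreal) simp
      also have "\<dots> \<le> ennreal (C3 * C2 * exp 1 * exp V)"
      proof (rule ennreal_leI)
        have "(\<Sum>k<K. a V' (k + k0)) = (\<Sum>k\<in>(\<lambda>k. k + k0) ` {..<K}. a V' k)"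
          by (simp add: sum.reindex)
        also have "\<dots> \<le> (\<Sum>k<K+k0. a V' k)"
          using a0 by (intro sum_mono2) auto
        also have "\<dots> \<le> C2 * exp V'" by (rule C2) (simp add: V'_def)
        also have "\<dots> \<le> C2 * (exp 1 * exp V)"
          using C2 V by (intro mult_left_mono) (auto simp: V'_def exp_add[symmetric])
        finally have "C3 * (\<Sum>k<K. a V' (k + k0)) \<le> C3 * (C2 * (exp 1 * exp V))"
          using C3 by (intro mult_left_mono) auto
        then show "(\<Sum>k<K. C3 * a V' (k + k0)) \<le> C3 * C2 * exp 1 * exp V"
          by (simp add: sum_distrib_left mult_ac)
      qed
      finally show "(\<Sum>k<K. I (k + k0)) \<le> ennreal (C3 * C2 * exp 1 * exp V)" .
    qed
    then show "(\<Sum>k. \<integral>\<^sup>+y. ennreal (kcoef m CARD('n) (k + k0) * real (k + k0 + 1) powr (- \<tau>)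
           * norm (complex_of_real (b powr (1 / m)) * cinner x y) powr (real (k + k0) + m * (\<tau> - 1/2)))
         * ennreal (exp (- A * norm y powr (2 * m))) \<partial>lborel)
      \<le> ennreal (C3 * C2 * exp 1 * exp (b\<^sup>2 / (4 * A) * norm x powr (2 * m)))"
      unfolding I_def \<beta>_def j_def V_def .
  qed (use C2 C3 in auto)
qed

text \<open>The weight depends on |y| only, so the integral does not change when y is multiplied by
  a phase. Averaging over all phases and exchanging the integrals brings the circle mean of the
  kernel function inside.\<close>

lemma kfun_integral_bound:
  fixes m A b :: real
  assumes m: "m > 0" "m \<le> 1" and A: "A > 0" and b: "b > 0"
  obtains C where "C > 0"
    "\<And>x :: complex ^ 'n::finite.
      (\<integral>\<^sup>+y. ennreal (norm (kfun m CARD('n) (complex_of_real (b powr (1 / m)) * cinner x y)))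
         * ennreal (exp (- A * norm y powr (2 * m))) \<partial>lborel)
      \<le> ennreal (C * exp (b\<^sup>2 / (4 * A) * norm x powr (2 * m)))"
proof -
  let ?n = "CARD('n)"
  have n: "?n \<ge> 1" by (simp add: Suc_le_eq)
  define \<beta> where "\<beta> = b powr (1 / m)"
  define w where "w y = ennreal (exp (- A * norm y powr (2 * m)))" for y :: "complex ^ 'n"
  have [measurable]: "w \<in> borel_measurable borel" unfolding w_def by measurable
  \<comment> \<open>For \<tau> = 0 the term k = 0 would have exponent - m / 2, hence k0 = 1; for
    \<tau> = 1 all exponents k + m / 2 are positive, hence k0 = 0.\<close>
  obtain C1 where C1: "C1 > 0"
    "\<And>x :: complex ^ 'n.
      (\<Sum>k. \<integral>\<^sup>+y. ennreal (kcoef m ?n (k + 1) * real (k + 1 + 1) powr (- 0)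
           * norm (complex_of_real (b powr (1 / m)) * cinner x y) powr (real (k + 1) + m * (0 - 1/2)))
         * ennreal (exp (- A * norm y powr (2 * m))) \<partial>lborel)
      \<le> ennreal (C1 * exp (b\<^sup>2 / (4 * A) * norm x powr (2 * m)))"
    by (rule weighted_series_integral_bound[OF m order_refl A b, of 1, where 'n = 'n]) (use m in auto)
  obtain C2 where C2: "C2 > 0"
    "\<And>x :: complex ^ 'n.
      (\<Sum>k. \<integral>\<^sup>+y. ennreal (kcoef m ?n (k + 0) * real (k + 0 + 1) powr (- 1)
           * norm (complex_of_real (b powr (1 / m)) * cinner x y) powr (real (k + 0) + m * (1 - 1/2)))
         * ennreal (exp (- A * norm y powr (2 * m))) \<partial>lborel)
      \<le> ennreal (C2 * exp (b\<^sup>2 / (4 * A) * norm x powr (2 * m)))"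
    by (rule weighted_series_integral_bound[OF m zero_le_one A b, of 0, where 'n = 'n]) (use m in auto)
  obtain C3 where C3: "C3 > 0"
    "\<And>t. (\<integral>\<^sup>+\<theta>. ennreal (norm (kfun m ?n (cis \<theta> * t))) * indicator {- pi..pi} \<theta> \<partial>lborel) \<le>
       ennreal C3 * (1 + (\<Sum>k. ennreal (kcoef m ?n (k + 1) * norm t powr (real (k + 1) - m / 2)))
         + (\<Sum>k. ennreal (kcoef m ?n k / real (k + 1) * norm t powr (real k + m / 2))))"
    by (rule kfun_circle_integral_le[OF m n]) blast
  define W where "W = enn2real (\<integral>\<^sup>+y. w y \<partial>lborel)"
  have W: "(\<integral>\<^sup>+y. w y \<partial>lborel) = ennreal W" "W \<ge> 0"
    using nn_integral_exp_radial_finite[OF A m(1), where 'n = 'n] unfolding W_def w_def by auto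
  show ?thesis
  proof (rule that[of "C3 * (W + C1 + C2)"])
    fix x :: "complex ^ 'n"
    define e where "e = exp (b\<^sup>2 / (4 * A) * norm x powr (2 * m))"
    have e: "e \<ge> 1" using A by (simp add: e_def)
    define t where "t y = complex_of_real \<beta> * cinner x y" for y
    have [measurable]: "t \<in> borel_measurable borel" unfolding t_def by measurable
    define J where "J = (\<integral>\<^sup>+y. ennreal (norm (kfun m ?n (t y))) * w y \<partial>lborel)"
    \<comment> \<open>The product is conjugate linear in y, so y is turned by - \<theta> in order to
      turn <x, y> by \<theta>.\<close>
    have rot: "J = (\<integral>\<^sup>+y. ennreal (norm (kfun m ?n (cis \<theta> * t y))) * w y \<partial>lborel)" for \<theta>
    proof -
      have "J = (\<integral>\<^sup>+y. ennreal (norm (kfun m ?n (t (cmul (cis (- \<theta>)) y)))) * w (cmul (cis (- \<theta>)) y) \<partial>lborel)"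
        unfolding J_def by (rule nn_integral_phase[symmetric, where f = "\<lambda>y. ennreal (norm (kfun m ?n (t y))) * w y"]) auto
      then show ?thesis by (simp add: t_def w_def cinner_cmul norm_cmul cis_cnj mult_ac)
    qed
    define S1 where "S1 k y = ennreal (kcoef m ?n (k + 1) * norm (t y) powr (real (k + 1) - m / 2))" for k y
    define S2 where "S2 k y = ennreal (kcoef m ?n k / real (k + 1) * norm (t y) powr (real k + m / 2))" for k y
    have [measurable]: "S1 k \<in> borel_measurable borel" "S2 k \<in> borel_measurable borel" for k
      unfolding S1_def S2_def by measurable
    define T1 where "T1 k y = S1 k y * w y" for k y
    define T2 where "T2 k y = S2 k y * w y" for k y
    have [measurable]: "T1 k \<in> borel_measurable borel" "T2 k \<in> borel_measurable borel" for k
      unfolding T1_def T2_def by measurable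
    \<comment> \<open>J is replaced by its own integral over an interval of length 2 pi >=
      1.\<close>
    have "J * 1 \<le> J * ennreal (2 * pi)"
      using pi_gt3 ennreal_leI[of 1 "2 * pi"] by (intro mult_left_mono) auto
    also have "J * ennreal (2 * pi) = (\<integral>\<^sup>+\<theta>. J * indicator {- pi..pi} \<theta> \<partial>lborel)"
      by (simp add: nn_integral_cmult_indicator)
    also have "\<dots> = (\<integral>\<^sup>+\<theta>. (\<integral>\<^sup>+y. ennreal (norm (kfun m ?n (cis \<theta> * t y))) * w y * indicator {- pi..pi} \<theta> \<partial>lborel) \<partial>lborel)"
      by (subst nn_integral_multc) (auto simp: rot[symmetric])
    also have "\<dots> = (\<integral>\<^sup>+y. (\<integral>\<^sup>+\<theta>. ennreal (norm (kfun m ?n (cis \<theta> * t y))) * w y * indicator {- pi..pi} \<theta> \<partial>lborel) \<partial>lborel)"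
      by (rule lborel_pair.Fubini') measurable
    also have "\<dots> = (\<integral>\<^sup>+y. w y * (\<integral>\<^sup>+\<theta>. ennreal (norm (kfun m ?n (cis \<theta> * t y))) * indicator {- pi..pi} \<theta> \<partial>lborel) \<partial>lborel)"
      by (intro nn_integral_cong, subst nn_integral_cmult[symmetric]) (auto simp: mult_ac)
    also have "\<dots> \<le> (\<integral>\<^sup>+y. w y * (ennreal C3 * (1 + (\<Sum>k. S1 k y) + (\<Sum>k. S2 k y))) \<partial>lborel)"
      unfolding S1_def S2_def by (intro nn_integral_mono mult_left_mono C3) auto
    also have "\<dots> = (\<integral>\<^sup>+y. ennreal C3 * (w y + (\<Sum>k. T1 k y) + (\<Sum>k. T2 k y)) \<partial>lborel)"
      unfolding T1_def T2_def by (intro nn_integral_cong) (simp add: distrib_left mult_ac)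
    also have "\<dots> = ennreal C3 * ((\<integral>\<^sup>+y. w y \<partial>lborel) + (\<Sum>k. \<integral>\<^sup>+y. T1 k y \<partial>lborel) + (\<Sum>k. \<integral>\<^sup>+y. T2 k y \<partial>lborel))"
      by (simp add: nn_integral_cmult nn_integral_add nn_integral_suminf)
    also have "\<dots> \<le> ennreal C3 * (ennreal W + ennreal (C1 * e) + ennreal (C2 * e))"
    proof (intro mult_left_mono add_mono)
      show "(\<Sum>k. \<integral>\<^sup>+y. T1 k y \<partial>lborel) \<le> ennreal (C1 * e)"
        using C1(2)[of x] unfolding T1_def S1_def w_def e_def t_def \<beta>_def by simp
      show "(\<Sum>k. \<integral>\<^sup>+y. T2 k y \<partial>lborel) \<le> ennreal (C2 * e)"
        using C2(2)[of x] unfolding T2_def S2_def w_def e_def t_def \<beta>_def by (simp add: powr_minus_divide)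
    qed (simp_all add: W)
    also have "\<dots> = ennreal (C3 * (W + C1 * e + C2 * e))"
      using C1 C2 C3 W e by (simp add: ennreal_mult ennreal_plus)
    also have "\<dots> \<le> ennreal (C3 * (W + C1 + C2) * e)"
    proof (rule ennreal_leI)
      have "W * 1 \<le> W * e" using W e by (intro mult_left_mono) auto
      then have "C3 * (W + C1 * e + C2 * e) \<le> C3 * (W * e + C1 * e + C2 * e)"
        using C3 by (intro mult_left_mono) auto
      then show "C3 * (W + C1 * e + C2 * e) \<le> C3 * (W + C1 + C2) * e"
        by (simp add: algebra_simps)
    qed
    finally show "(\<integral>\<^sup>+y. ennreal (norm (kfun m CARD('n) (complex_of_real (b powr (1 / m)) * cinner x y)))
         * ennreal (exp (- A * norm y powr (2 * m))) \<partial>lborel)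
      \<le> ennreal (C3 * (W + C1 + C2) * exp (b\<^sup>2 / (4 * A) * norm x powr (2 * m)))"
      by (simp add: J_def w_def t_def e_def \<beta>_def)
  qed (use C1 C2 C3 W in \<open>auto intro!: mult_pos_pos add_nonneg_pos\<close>)
qed

subsection \<open>Boundedness below and at the critical exponent\<close>

lemma sigma_finite_lebesgue: "sigma_finite_measure (lebesgue :: 'a::euclidean_space measure)"
proof -
  obtain A :: "'a set set" where A: "countable A" "A \<subseteq> sets lborel" "\<Union>A = space lborel" "\<forall>a\<in>A. emeasure lborel a \<noteq> \<infinity>"
    using sigma_finite_lborel unfolding sigma_finite_measure_def by blast
  then show ?thesis
    by (intro sigma_finite_measure.intro exI[of _ A]) auto
qed

section \<open>Schur's test from L^p to L^q\<close>

lemma le_threshold_split: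
  fixes u l p :: real
  assumes "u \<ge> 0" "l > 0" "p \<ge> 1"
  shows "u \<le> l + l powr (1 - p) * u powr p"
proof (cases "u \<le> l")
  case True
  then show ?thesis by (simp add: add_increasing2)
next
  case False
  then have u: "u > 0" "l \<le> u" using assms by auto
  have "u = u powr (1 - p) * u powr p" using u by (simp add: powr_add[symmetric])
  also have "\<dots> \<le> l powr (1 - p) * u powr p"
    using u assms by (intro mult_right_mono powr_mono2') auto
  finally show ?thesis using assms by linarith
qed

text \<open>Together with \<open>le_threshold_split\<close> this does the work of Hoelder's
  inequality: integrating u <= l + l^(1 - p) u^p gives the assumption, and the threshold l = J^(1/p)
  makes both terms multiples of J^(1/p). For J = 0 that threshold is not positive, and l tends to 0
  instead.\<close>

lemma le_powr_of_threshold: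
  fixes v X J p :: real
  assumes v: "v \<ge> 0" and X: "X \<ge> 0" and J: "J \<ge> 0" and p: "p \<ge> 1"
    and le: "\<And>l. l > 0 \<Longrightarrow> v \<le> l * X + l powr (1 - p) * J"
  shows "v \<le> (X + 1) * J powr (1 / p)"
proof (cases "J = 0")
  case True
  have "v \<le> 0"
  proof (rule field_le_epsilon)
    fix e :: real assume e: "e > 0"
    have "v \<le> e / (X + 1) * X" using le[of "e / (X + 1)"] True e X by (simp add: add_nonneg_pos)
    also have "\<dots> \<le> e" using e X by (simp add: field_simps add_nonneg_pos)
    finally show "v \<le> 0 + e" by simp
  qed
  then show ?thesis using True by simp
next
  case False
  define l where "l = J powr (1 / p)"
  have l: "l > 0" using False by (simp add: l_def)
  have "l powr (1 - p) * J = l"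
  proof -
    have "J = l powr p" using False J p by (simp add: l_def powr_powr)
    then show ?thesis using l by (simp add: powr_add[symmetric])
  qed
  then show ?thesis using le[OF l] by (simp add: l_def algebra_simps)
qed

text \<open>Interpolation between \<open>L\<^sup>1\<close> and \<open>L\<^sup>\<infinity>\<close> by hand: Schur's test for the diagonal part and
  the uniform bound of the kernel for the surplus \<open>q - p\<close>.\<close>

lemma (in pair_sigma_finite) Schur_test_Lp_Lq:
  fixes T :: "'a \<Rightarrow> 'b \<Rightarrow> real" and u :: "'b \<Rightarrow> real" and v :: "'a \<Rightarrow> real" and C p q \<Phi> :: real
  assumes T[measurable]: "case_prod T \<in> borel_measurable (M1 \<Otimes>\<^sub>M M2)" and u[measurable]: "u \<in> borel_measurable M2"
    and space: "space M1 = UNIV" and T0: "\<And>x y. 0 \<le> T x y" and u0: "\<And>y. 0 \<le> u y" and v0: "\<And>x. 0 \<le> v x"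
    and C: "C \<ge> 0" and p: "1 \<le> p" and pq: "p \<le> q" and \<Phi>: "\<Phi> \<ge> 0"
    and row: "\<And>x. (\<integral>\<^sup>+y. ennreal (T x y) \<partial>M2) \<le> ennreal C"
    and col: "\<And>y. (\<integral>\<^sup>+x. ennreal (T x y) \<partial>M1) \<le> ennreal C"
    and sup: "\<And>x y. T x y \<le> C"
    and up: "(\<integral>\<^sup>+y. ennreal (u y powr p) \<partial>M2) = ennreal \<Phi>"
    and v: "\<And>x. ennreal (v x) \<le> (\<integral>\<^sup>+y. ennreal (T x y * u y) \<partial>M2)"
  shows "(\<integral>\<^sup>+x. ennreal (v x powr q) \<partial>M1) \<le> ennreal ((C + 1) powr q * C powr (q / p) * \<Phi> powr (q / p))"
proof -
  \<comment> \<open>The operator applied to u^p. The row bound and the threshold argument give v <=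
    (C + 1) J^(1/p), a form of Jensen's inequality.\<close>
  define J where "J x = (\<integral>\<^sup>+y. ennreal (T x y * u y powr p) \<partial>M2)" for x
  have [measurable]: "J \<in> borel_measurable M1" unfolding J_def by measurable
  have [measurable]: "(\<lambda>y. T x y) \<in> borel_measurable M2" for x
  proof -
    have "x \<in> space M1" by (simp add: space)
    then show ?thesis by measurable
  qed
  have J_le: "J x \<le> ennreal (C * \<Phi>)" for x
  proof -
    have "J x \<le> (\<integral>\<^sup>+y. ennreal C * ennreal (u y powr p) \<partial>M2)"
      unfolding J_def
    proof (rule nn_integral_mono)
      fix y
      have "ennreal (T x y * u y powr p) \<le> ennreal (C * u y powr p)"
        using sup[of x y] by (intro ennreal_leI mult_right_mono) auto
      also have "\<dots> = ennreal C * ennreal (u y powr p)" using C by (intro ennreal_mult) auto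
      finally show "ennreal (T x y * u y powr p) \<le> ennreal C * ennreal (u y powr p)" .
    qed
    also have "\<dots> = ennreal (C * \<Phi>)"
      using C \<Phi> by (simp add: nn_integral_cmult up ennreal_mult)
    finally show ?thesis .
  qed
  define r where "r x = enn2real (J x)" for x
  have r0: "r x \<ge> 0" for x by (simp add: r_def)
  have Jr: "J x = ennreal (r x)" for x
    using le_less_trans[OF J_le[of x] ennreal_less_top] by (simp add: r_def)
  have r_le: "r x \<le> C * \<Phi>" for x
    using J_le[of x] C \<Phi> unfolding Jr by (subst (asm) ennreal_le_iff) auto
  have v_le: "v x \<le> (C + 1) * r x powr (1 / p)" for x
  proof (rule le_powr_of_threshold[OF v0 C r0 p])
    fix l :: real assume l: "l > 0"
    have "ennreal (v x) \<le> (\<integral>\<^sup>+y. ennreal (T x y * u y) \<partial>M2)" by (rule v)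
    also have "\<dots> \<le> (\<integral>\<^sup>+y. ennreal l * ennreal (T x y) + ennreal (l powr (1 - p)) * ennreal (T x y * u y powr p) \<partial>M2)"
    proof (rule nn_integral_mono)
      fix y
      have "T x y * u y \<le> T x y * (l + l powr (1 - p) * u y powr p)"
        by (intro mult_left_mono le_threshold_split u0 l p T0)
      also have "\<dots> = l * T x y + l powr (1 - p) * (T x y * u y powr p)"
        by (simp add: algebra_simps)
      finally have "ennreal (T x y * u y) \<le> ennreal (l * T x y + l powr (1 - p) * (T x y * u y powr p))"
        by (rule ennreal_leI)
      also have "\<dots> = ennreal (l * T x y) + ennreal (l powr (1 - p) * (T x y * u y powr p))"
        using l T0[of x y] by (intro ennreal_plus) auto
      also have "\<dots> = ennreal l * ennreal (T x y) + ennreal (l powr (1 - p)) * ennreal (T x y * u y powr p)"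
        using l T0[of x y] by (intro arg_cong2[where f = "(+)"] ennreal_mult) auto
      finally show "ennreal (T x y * u y) \<le> ennreal l * ennreal (T x y) + ennreal (l powr (1 - p)) * ennreal (T x y * u y powr p)" .
    qed
    also have "\<dots> = ennreal l * (\<integral>\<^sup>+y. ennreal (T x y) \<partial>M2) + ennreal (l powr (1 - p)) * J x"
      unfolding J_def by (subst nn_integral_add) (auto simp: nn_integral_cmult)
    also have "\<dots> \<le> ennreal l * ennreal C + ennreal (l powr (1 - p)) * ennreal (r x)"
      unfolding Jr by (intro add_mono mult_left_mono row) auto
    also have "\<dots> = ennreal (l * C + l powr (1 - p) * r x)"
      using l C r0 by (simp add: ennreal_mult ennreal_plus)
    finally show "v x \<le> l * C + l powr (1 - p) * r x"
      using l C r0[of x] by (subst (asm) ennreal_le_iff) auto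
  qed
  have vq: "v x powr q \<le> (C + 1) powr q * (C * \<Phi>) powr (q / p - 1) * r x" for x
  proof -
    have "v x powr q \<le> ((C + 1) * r x powr (1 / p)) powr q"
      using v_le[of x] v0 p pq by (intro powr_mono2) auto
    also have "\<dots> = (C + 1) powr q * r x powr (q / p)"
      by (simp add: powr_mult powr_powr)
    \<comment> \<open>Here p <= q enters: the surplus power q/p - 1 >= 0 is estimated by the uniform
      bound r <= C \<Phi>, and the remaining first power is integrated by the column bound.\<close>
    also have "r x powr (q / p) = r x powr (q / p - 1) * r x"
    proof (cases "r x = 0")
      case False
      then have "r x powr (q / p - 1) * r x powr 1 = r x powr (q / p)" by (simp only: powr_add[symmetric]) simp
      then show ?thesis using r0[of x] by simp
    qed (use p pq in auto)
    also have "\<dots> \<le> (C * \<Phi>) powr (q / p - 1) * r x"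
      using r_le[of x] r0 p pq by (intro mult_right_mono powr_mono2) (auto simp: field_simps)
    finally show ?thesis by (simp add: mult.assoc mult_left_mono)
  qed
  have "(\<integral>\<^sup>+x. ennreal (v x powr q) \<partial>M1) \<le> (\<integral>\<^sup>+x. ennreal ((C + 1) powr q * (C * \<Phi>) powr (q / p - 1)) * J x \<partial>M1)"
  proof (rule nn_integral_mono)
    fix x
    have "ennreal (v x powr q) \<le> ennreal ((C + 1) powr q * (C * \<Phi>) powr (q / p - 1) * r x)"
      by (intro ennreal_leI vq)
    also have "\<dots> = ennreal ((C + 1) powr q * (C * \<Phi>) powr (q / p - 1)) * ennreal (r x)"
      using r0[of x] by (intro ennreal_mult) auto
    finally show "ennreal (v x powr q) \<le> ennreal ((C + 1) powr q * (C * \<Phi>) powr (q / p - 1)) * J x"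
      by (simp only: Jr)
  qed
  also have "\<dots> = ennreal ((C + 1) powr q * (C * \<Phi>) powr (q / p - 1)) * (\<integral>\<^sup>+x. J x \<partial>M1)"
    by (rule nn_integral_cmult) measurable
  also have "(\<integral>\<^sup>+x. J x \<partial>M1) = (\<integral>\<^sup>+y. (\<integral>\<^sup>+x. ennreal (T x y * u y powr p) \<partial>M1) \<partial>M2)"
    unfolding J_def by (rule Fubini'[symmetric]) measurable
  also have "\<dots> = (\<integral>\<^sup>+y. ennreal (u y powr p) * (\<integral>\<^sup>+x. ennreal (T x y) \<partial>M1) \<partial>M2)"
  proof (rule nn_integral_cong)
    fix y assume y: "y \<in> space M2"
    have [measurable]: "(\<lambda>x. T x y) \<in> borel_measurable M1" using y by measurable
    have "(\<integral>\<^sup>+x. ennreal (T x y * u y powr p) \<partial>M1) = (\<integral>\<^sup>+x. ennreal (u y powr p) * ennreal (T x y) \<partial>M1)"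
      using T0 by (intro nn_integral_cong, subst mult.commute, intro ennreal_mult) auto
    then show "(\<integral>\<^sup>+x. ennreal (T x y * u y powr p) \<partial>M1) = ennreal (u y powr p) * (\<integral>\<^sup>+x. ennreal (T x y) \<partial>M1)"
      by (simp add: nn_integral_cmult)
  qed
  also have "\<dots> \<le> (\<integral>\<^sup>+y. ennreal (u y powr p) * ennreal C \<partial>M2)"
    by (intro nn_integral_mono mult_left_mono col) auto
  also have "\<dots> = ennreal (C * \<Phi>)"
    using C \<Phi> by (subst nn_integral_multc) (auto simp: up ennreal_mult mult.commute)
  also have "ennreal ((C + 1) powr q * (C * \<Phi>) powr (q / p - 1)) * ennreal (C * \<Phi>)
      = ennreal ((C + 1) powr q * ((C * \<Phi>) powr (q / p - 1) * (C * \<Phi>)))"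
    using C \<Phi> by (subst ennreal_mult[symmetric]) (auto simp: mult.assoc)
  also have "(C * \<Phi>) powr (q / p - 1) * (C * \<Phi>) = (C * \<Phi>) powr (q / p)"
  proof (cases "C * \<Phi> = 0")
    case False
    then have "(C * \<Phi>) powr (q / p - 1) * (C * \<Phi>) powr 1 = (C * \<Phi>) powr (q / p)" by (simp only: powr_add[symmetric]) simp
    then show ?thesis using C \<Phi> by simp
  qed (use p pq in auto)
  also have "(C + 1) powr q * (C * \<Phi>) powr (q / p) = (C + 1) powr q * C powr (q / p) * \<Phi> powr (q / p)"
    by (simp add: powr_mult)
  finally show ?thesis by (simp add: mult_left_mono)
qed

section \<open>Reduction of the projection to a positive kernel with the weights moved into
  it\<close>

lemma norm_integral_le_nn_integral:
  fixes f :: "'a \<Rightarrow> 'b::{banach, second_countable_topology}"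
  shows "ennreal (norm (integral\<^sup>L M f)) \<le> (\<integral>\<^sup>+x. ennreal (norm (f x)) \<partial>M)"
proof (cases "integrable M f")
  case True
  then show ?thesis by (rule integral_norm_bound_ennreal)
next
  case False
  then show ?thesis by (simp add: not_integrable_integral_eq)
qed

lemma kernel_measurable[measurable]:
  assumes [measurable]: "f \<in> borel_measurable M" "g \<in> borel_measurable M"
  shows "(\<lambda>w. kernel b m (f w) (g w :: complex ^ 'n::finite)) \<in> borel_measurable M"
  unfolding kernel_eq_kfun by measurable

lemma sets_mu: "sets (mu a m) = sets lebesgue"
  by (simp add: mu_def)

lemma borel_imp_lebesgue: "f \<in> borel_measurable borel \<Longrightarrow> f \<in> borel_measurable lebesgue"
  by (simp add: measurable_completion)

lemma id_lebesgue_borel[measurable]: "(\<lambda>x::'a::euclidean_space. x) \<in> lebesgue \<rightarrow>\<^sub>M borel"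
  using borel_imp_lebesgue[of "\<lambda>x. x"] by simp

lemma nn_integral_mu:
  fixes f :: "complex ^ 'n::finite \<Rightarrow> ennreal"
  assumes [measurable]: "f \<in> borel_measurable lebesgue"
  shows "(\<integral>\<^sup>+x. f x \<partial>mu a m) = (\<integral>\<^sup>+x. ennreal (exp (- a * norm x powr (2 * m))) * f x \<partial>lebesgue)"
  unfolding mu_def by (rule nn_integral_density) measurable

lemma in_Lp_measurable:
  "in_Lp f (mu a m :: (complex ^ 'n::finite) measure) p \<Longrightarrow> f \<in> borel_measurable lebesgue"
  unfolding in_Lp_def by (simp add: measurable_cong_sets[OF sets_mu refl])

text \<open>The weight is distributed into f, so that the domain side becomes an unweighted L^p norm
  on Lebesgue measure.\<close>

lemma in_Lp_nn_integral:
  fixes f :: "complex ^ 'n::finite \<Rightarrow> complex"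
  assumes f: "in_Lp f (mu a m) p" and p: "p > 0"
  shows "(\<integral>\<^sup>+y. ennreal ((norm (f y) * exp (- (a / p) * norm y powr (2 * m))) powr p) \<partial>lebesgue)
    = ennreal (Lp_norm f (mu a m) p powr p)"
proof -
  have [measurable]: "f \<in> borel_measurable lebesgue" by (rule in_Lp_measurable[OF f])
  define \<Phi> where "\<Phi> = (\<integral>x. norm (f x) powr p \<partial>mu a m)"
  have \<Phi>: "\<Phi> \<ge> 0" by (simp add: \<Phi>_def)
  have "(\<integral>\<^sup>+y. ennreal ((norm (f y) * exp (- (a / p) * norm y powr (2 * m))) powr p) \<partial>lebesgue)
    = (\<integral>\<^sup>+y. ennreal (exp (- a * norm y powr (2 * m))) * ennreal (norm (f y) powr p) \<partial>lebesgue)"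
  proof (intro nn_integral_cong)
    fix y :: "complex ^ 'n"
    have "exp (- (a / p) * norm y powr (2 * m)) powr p = exp (- a * norm y powr (2 * m))"
      using p by (simp add: exp_powr_real field_simps)
    then show "ennreal ((norm (f y) * exp (- (a / p) * norm y powr (2 * m))) powr p)
      = ennreal (exp (- a * norm y powr (2 * m))) * ennreal (norm (f y) powr p)"
      by (simp add: powr_mult ennreal_mult[symmetric] mult.commute)
  qed
  also have "\<dots> = (\<integral>\<^sup>+y. ennreal (norm (f y) powr p) \<partial>mu a m)"
    by (rule nn_integral_mu[symmetric]) measurable
  also have "\<dots> = ennreal \<Phi>"
    using f unfolding in_Lp_def \<Phi>_def by (intro nn_integral_eq_integral) auto
  also have "\<Phi> = Lp_norm f (mu a m) p powr p"
    using \<Phi> p by (simp add: Lp_norm_def \<Phi>_def[symmetric] powr_powr)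
  finally show ?thesis .
qed

lemma proj_measurable:
  fixes f :: "complex ^ 'n::finite \<Rightarrow> complex"
  assumes f[measurable]: "f \<in> borel_measurable lebesgue"
  shows "proj b m f \<in> borel_measurable lebesgue"
proof -
  interpret sigma_finite_measure "lebesgue :: (complex ^ 'n) measure" by (rule sigma_finite_lebesgue)
  have "proj b m f x = (\<integral>y. exp (- b * norm y powr (2 * m)) *\<^sub>R (f y * kernel b m x y) \<partial>lebesgue)" for x
    unfolding proj_def mu_def by (rule integral_density) auto
  moreover have "(\<lambda>x. \<integral>y. exp (- b * norm y powr (2 * m)) *\<^sub>R (f y * kernel b m x y) \<partial>lebesgue) \<in> borel_measurable lebesgue"
    by measurable
  ultimately show ?thesis by (simp cong: measurable_cong)
qed

text \<open>The weight of exponent b in the integral is split into c for f and b - c for the kernel.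
  With c = a / p the kernel keeps the weight A in y, and B = g / q is the weight in x from the
  target space.\<close>

lemma proj_bound:
  fixes f :: "complex ^ 'n::finite \<Rightarrow> complex"
  assumes f[measurable]: "f \<in> borel_measurable lebesgue"
  shows "ennreal (norm (proj b m f x) * exp (- B * norm x powr (2 * m)))
    \<le> (\<integral>\<^sup>+y. ennreal ((norm (kernel b m x y) * exp (- (b - c) * norm y powr (2 * m)) * exp (- B * norm x powr (2 * m)))
          * (norm (f y) * exp (- c * norm y powr (2 * m)))) \<partial>lebesgue)"
proof -
  have "ennreal (norm (proj b m f x)) \<le> (\<integral>\<^sup>+y. ennreal (norm (f y * kernel b m x y)) \<partial>mu b m)"
    unfolding proj_def by (rule norm_integral_le_nn_integral)
  also have "\<dots> = (\<integral>\<^sup>+y. ennreal (exp (- b * norm y powr (2 * m))) * ennreal (norm (f y * kernel b m x y)) \<partial>lebesgue)"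
    by (rule nn_integral_mu) measurable
  finally have "ennreal (norm (proj b m f x)) * ennreal (exp (- B * norm x powr (2 * m)))
    \<le> (\<integral>\<^sup>+y. ennreal (exp (- b * norm y powr (2 * m))) * ennreal (norm (f y * kernel b m x y)) \<partial>lebesgue) * ennreal (exp (- B * norm x powr (2 * m)))"
    by (intro mult_right_mono) auto
  also have "\<dots> = (\<integral>\<^sup>+y. ennreal (exp (- b * norm y powr (2 * m))) * ennreal (norm (f y * kernel b m x y)) * ennreal (exp (- B * norm x powr (2 * m))) \<partial>lebesgue)"
    by (rule nn_integral_multc[symmetric]) measurable
  also have "\<dots> = (\<integral>\<^sup>+y. ennreal ((norm (kernel b m x y) * exp (- (b - c) * norm y powr (2 * m)) * exp (- B * norm x powr (2 * m)))
          * (norm (f y) * exp (- c * norm y powr (2 * m)))) \<partial>lebesgue)"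
  proof (intro nn_integral_cong)
    fix y :: "complex ^ 'n"
    have "exp (- b * norm y powr (2 * m)) = exp (- (b - c) * norm y powr (2 * m)) * exp (- c * norm y powr (2 * m))"
      by (simp add: exp_add[symmetric] algebra_simps)
    then show "ennreal (exp (- b * norm y powr (2 * m))) * ennreal (norm (f y * kernel b m x y)) * ennreal (exp (- B * norm x powr (2 * m)))
      = ennreal ((norm (kernel b m x y) * exp (- (b - c) * norm y powr (2 * m)) * exp (- B * norm x powr (2 * m)))
          * (norm (f y) * exp (- c * norm y powr (2 * m))))"
      by (simp add: ennreal_mult[symmetric] norm_mult mult_ac)
  qed
  finally show ?thesis by (simp add: ennreal_mult)
qed

lemma proj_boundedI:
  assumes q: "q \<ge> 1" and C: "C \<ge> 0"
    and le: "\<And>f :: complex ^ 'n::finite \<Rightarrow> complex. in_Lp f (mu a m) p \<Longrightarrow>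
      (\<integral>\<^sup>+x. ennreal ((norm (proj b m f x) * exp (- (g / q) * norm x powr (2 * m))) powr q) \<partial>lebesgue)
        \<le> ennreal (C * Lp_norm f (mu a m) p powr q)"
  shows "proj_bounded b m a p g q TYPE('n)"
  unfolding proj_bounded_def
proof (intro exI[of _ "C powr (1 / q)"] allI impI)
  fix f :: "complex ^ 'n \<Rightarrow> complex"
  assume asm: "in_Lp f (mu b m) 2 \<and> in_Lp f (mu a m) p"
  define N where "N = Lp_norm f (mu a m) p"
  have N: "N \<ge> 0" by (simp add: N_def Lp_norm_def)
  have [measurable]: "f \<in> borel_measurable lebesgue" using asm in_Lp_measurable by blast
  have pm[measurable]: "proj b m f \<in> borel_measurable lebesgue" by (rule proj_measurable) measurable
  have pm': "proj b m f \<in> borel_measurable (mu g m)"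
    using pm by (simp add: measurable_cong_sets[OF sets_mu refl])
  have "(\<integral>\<^sup>+x. ennreal (norm (proj b m f x) powr q) \<partial>mu g m)
      = (\<integral>\<^sup>+x. ennreal (exp (- g * norm x powr (2 * m))) * ennreal (norm (proj b m f x) powr q) \<partial>lebesgue)"
    by (rule nn_integral_mu) measurable
  also have "\<dots> = (\<integral>\<^sup>+x. ennreal ((norm (proj b m f x) * exp (- (g / q) * norm x powr (2 * m))) powr q) \<partial>lebesgue)"
  proof (intro nn_integral_cong)
    fix x :: "complex ^ 'n"
    have "exp (- (g / q) * norm x powr (2 * m)) powr q = exp (- g * norm x powr (2 * m))"
      using q by (simp add: exp_powr_real field_simps)
    then show "ennreal (exp (- g * norm x powr (2 * m))) * ennreal (norm (proj b m f x) powr q)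
      = ennreal ((norm (proj b m f x) * exp (- (g / q) * norm x powr (2 * m))) powr q)"
      by (simp add: powr_mult ennreal_mult[symmetric] mult.commute)
  qed
  also have "\<dots> \<le> ennreal (C * N powr q)"
    unfolding N_def using asm by (intro le) auto
  finally have fin: "(\<integral>\<^sup>+x. ennreal (norm (proj b m f x) powr q) \<partial>mu g m) \<le> ennreal (C * N powr q)" .
  have int: "integrable (mu g m) (\<lambda>x. norm (proj b m f x) powr q)"
  proof (rule integrableI_nonneg)
    show "(\<integral>\<^sup>+x. ennreal (norm (proj b m f x) powr q) \<partial>mu g m) < \<infinity>"
      using le_less_trans[OF fin ennreal_less_top] by simp
  qed (use pm' in auto)
  define X where "X = (\<integral>x. norm (proj b m f x) powr q \<partial>mu g m)"
  have X0: "X \<ge> 0" by (simp add: X_def)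
  have "ennreal X \<le> ennreal (C * N powr q)"
    using fin nn_integral_eq_integral[OF int] by (simp add: X_def)
  then have X: "X \<le> C * N powr q"
    using C by (subst (asm) ennreal_le_iff) auto
  have "Lp_norm (proj b m f) (mu g m) q = X powr (1 / q)"
    by (simp add: Lp_norm_def X_def)
  also have "\<dots> \<le> (C * N powr q) powr (1 / q)"
    using X X0 q by (intro powr_mono2) auto
  also have "\<dots> = C powr (1 / q) * N"
    using q N by (simp add: powr_mult powr_powr)
  finally show "in_Lp (proj b m f) (mu g m) q \<and> Lp_norm (proj b m f) (mu g m) q \<le> C powr (1 / q) * Lp_norm f (mu a m) p"
    using int pm' by (simp add: in_Lp_def N_def)
qed

lemma kfun_cnj:
  assumes m: "m > 0" "m \<le> 1" and n: "n \<ge> 1"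
  shows "kfun m n (cnj t) = cnj (kfun m n t)"
proof -
  have "summable (\<lambda>k. norm (complex_of_real (kcoef m n k) * t ^ k))"
    using kcoef_summable[OF m n, of "norm t"] kcoef_pos[OF m(1) n]
    by (simp add: norm_mult norm_power less_imp_le)
  then have "summable (\<lambda>k. complex_of_real (kcoef m n k) * t ^ k)" by (rule summable_norm_cancel)
  from bounded_linear.suminf[OF bounded_linear_cnj this] show ?thesis
    by (simp add: kfun_def)
qed

definition kconst :: "real \<Rightarrow> real \<Rightarrow> nat \<Rightarrow> real" where
  "kconst b m n = m * b powr (real n / m) / pi ^ n"

lemma kconst_pos: "b > 0 \<Longrightarrow> m > 0 \<Longrightarrow> kconst b m n > 0"
  by (simp add: kconst_def)

lemma norm_kernel:
  assumes "b > 0" "m > 0"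
  shows "norm (kernel b m x (y :: complex ^ 'n::finite))
    = kconst b m CARD('n) * norm (kfun m CARD('n) (complex_of_real (b powr (1 / m)) * cinner x y))"
  using kconst_pos[OF assms, of "CARD('n)"]
  unfolding kernel_eq_kfun kconst_def[symmetric] norm_mult by simp

text \<open>Hermitian symmetry, a consequence of the real Taylor coefficients; it turns column
  integrals in Schur's test into row integrals.\<close>

lemma norm_kernel_commute:
  assumes b: "b > 0" and m: "m > 0" "m \<le> 1"
  shows "norm (kernel b m y x) = norm (kernel b m x (y :: complex ^ 'n::finite))"
proof -
  have n: "CARD('n) \<ge> 1" by (simp add: Suc_le_eq)
  have "complex_of_real (b powr (1 / m)) * cinner y x = cnj (complex_of_real (b powr (1 / m)) * cinner x y)"
    by (simp add: cinner_commute[of y x])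
  then show ?thesis
    unfolding norm_kernel[OF b m(1)] by (simp only: kfun_cnj[OF m n] complex_mod_cnj)
qed

lemma kernel_integral_bound:
  fixes m A b :: real
  assumes m: "m > 0" "m \<le> 1" and A: "A > 0" and b: "b > 0"
  obtains C where "C > 0"
    "\<And>x :: complex ^ 'n::finite.
      (\<integral>\<^sup>+y. ennreal (norm (kernel b m x y) * exp (- A * norm y powr (2 * m))) \<partial>lebesgue)
      \<le> ennreal (C * exp (b\<^sup>2 / (4 * A) * norm x powr (2 * m)))"
proof -
  let ?n = "CARD('n)"
  obtain C where C: "C > 0"
    "\<And>x :: complex ^ 'n.
      (\<integral>\<^sup>+y. ennreal (norm (kfun m ?n (complex_of_real (b powr (1 / m)) * cinner x y)))
         * ennreal (exp (- A * norm y powr (2 * m))) \<partial>lborel)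
      \<le> ennreal (C * exp (b\<^sup>2 / (4 * A) * norm x powr (2 * m)))"
    by (rule kfun_integral_bound[OF m A b, where 'n = 'n]) blast
  define \<kappa> where "\<kappa> = kconst b m ?n"
  have \<kappa>: "\<kappa> > 0" unfolding \<kappa>_def by (rule kconst_pos[OF b m(1)])
  show ?thesis
  proof (rule that[of "\<kappa> * C"])
    fix x :: "complex ^ 'n"
    have "(\<integral>\<^sup>+y. ennreal (norm (kernel b m x y) * exp (- A * norm y powr (2 * m))) \<partial>lebesgue)
      = (\<integral>\<^sup>+y. ennreal (norm (kernel b m x y) * exp (- A * norm y powr (2 * m))) \<partial>lborel)"
      by (rule nn_integral_completion)
    also have "\<dots> = (\<integral>\<^sup>+y. ennreal \<kappa> * (ennreal (norm (kfun m ?n (complex_of_real (b powr (1 / m)) * cinner x y)))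
         * ennreal (exp (- A * norm y powr (2 * m)))) \<partial>lborel)"
    proof (rule nn_integral_cong)
      fix y :: "complex ^ 'n"
      show "ennreal (norm (kernel b m x y) * exp (- A * norm y powr (2 * m)))
        = ennreal \<kappa> * (ennreal (norm (kfun m ?n (complex_of_real (b powr (1 / m)) * cinner x y))) * ennreal (exp (- A * norm y powr (2 * m))))"
        unfolding norm_kernel[OF b m(1)] \<kappa>_def[symmetric] mult.assoc
        using \<kappa> by (intro trans[OF ennreal_mult] arg_cong2[where f = "(*)"] refl ennreal_mult) auto
    qed
    also have "\<dots> = ennreal \<kappa> * (\<integral>\<^sup>+y. ennreal (norm (kfun m ?n (complex_of_real (b powr (1 / m)) * cinner x y)))
         * ennreal (exp (- A * norm y powr (2 * m))) \<partial>lborel)"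
      by (rule nn_integral_cmult) simp
    also have "\<dots> \<le> ennreal \<kappa> * ennreal (C * exp (b\<^sup>2 / (4 * A) * norm x powr (2 * m)))"
      by (intro mult_left_mono C(2)) simp
    also have "\<dots> = ennreal (\<kappa> * C * exp (b\<^sup>2 / (4 * A) * norm x powr (2 * m)))"
      unfolding mult.assoc using \<kappa> C(1) by (intro ennreal_mult[symmetric]) auto
    finally show "(\<integral>\<^sup>+y. ennreal (norm (kernel b m x y) * exp (- A * norm y powr (2 * m))) \<partial>lebesgue)
      \<le> ennreal (\<kappa> * C * exp (b\<^sup>2 / (4 * A) * norm x powr (2 * m)))" .
  qed (use \<kappa> C in auto)
qed

lemma norm_kernel_le:
  assumes b: "b > 0" and m: "m > 0" "m \<le> 1"
  obtains C where "C > 0"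
    "\<And>x y :: complex ^ 'n::finite. norm (kernel b m x y) \<le> C * exp (b * norm x powr m * norm y powr m)"
proof -
  let ?n = "CARD('n)"
  have n: "?n \<ge> 1" by (simp add: Suc_le_eq)
  obtain C where C: "C > 0" "\<And>t. norm (kfun m ?n t) \<le> C * exp (norm t powr m)"
    by (rule norm_kfun_le_exp[OF m n]) blast
  define \<kappa> where "\<kappa> = kconst b m ?n"
  have \<kappa>: "\<kappa> > 0" unfolding \<kappa>_def by (rule kconst_pos[OF b m(1)])
  show ?thesis
  proof (rule that[of "\<kappa> * C"])
    fix x y :: "complex ^ 'n"
    let ?t = "complex_of_real (b powr (1 / m)) * cinner x y"
    have "norm ?t \<le> b powr (1 / m) * (norm x * norm y)"
      using norm_cinner_le[of x y] by (simp add: norm_mult mult_left_mono)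
    then have "norm ?t powr m \<le> (b powr (1 / m) * (norm x * norm y)) powr m"
      using m by (intro powr_mono2) auto
    also have "\<dots> = b * norm x powr m * norm y powr m"
      using b m by (simp add: powr_mult powr_powr)
    finally have "C * exp (norm ?t powr m) \<le> C * exp (b * norm x powr m * norm y powr m)"
      using C(1) by (intro mult_left_mono) auto
    then have "norm (kfun m ?n ?t) \<le> C * exp (b * norm x powr m * norm y powr m)"
      using C(2)[of ?t] by linarith
    then show "norm (kernel b m x y) \<le> \<kappa> * C * exp (b * norm x powr m * norm y powr m)"
      unfolding norm_kernel[OF b m(1)] \<kappa>_def[symmetric] using \<kappa> by (simp add: mult.assoc)
  qed (use \<kappa> C in auto)
qed

text \<open>The hypothesis says that the discriminant of the quadratic form is not positive;
  multiply by 4 A and complete the square.\<close>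

lemma quadratic_form_bound:
  fixes A B b X Y :: real
  assumes "A > 0" "b\<^sup>2 \<le> 4 * A * B"
  shows "b * X * Y \<le> A * Y\<^sup>2 + B * X\<^sup>2"
proof -
  have "0 \<le> (2 * A * Y - b * X)\<^sup>2" by simp
  also have "\<dots> = 4 * A * (A * Y\<^sup>2) - 4 * A * (b * X * Y) + b\<^sup>2 * X\<^sup>2"
    by (simp add: power2_eq_square algebra_simps)
  also have "b\<^sup>2 * X\<^sup>2 \<le> 4 * A * B * X\<^sup>2" using assms by (intro mult_right_mono) auto
  finally have "0 \<le> 4 * A * (A * Y\<^sup>2 + B * X\<^sup>2 - b * X * Y)" by (simp add: algebra_simps)
  then show ?thesis using assms(1) by (simp add: zero_le_mult_iff)
qed

lemma kernel_weighted_le: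
  fixes x y :: "complex ^ 'n::finite"
  assumes "A > 0" "b\<^sup>2 \<le> 4 * A * B"
  shows "exp (b * norm x powr m * norm y powr m) * exp (- A * norm y powr (2 * m)) * exp (- B * norm x powr (2 * m)) \<le> 1"
proof -
  have sq: "r powr (2 * m) = (r powr m)\<^sup>2" for r :: real
    by (simp add: power2_eq_square powr_add[symmetric])
  have "b * norm x powr m * norm y powr m \<le> A * (norm y powr m)\<^sup>2 + B * (norm x powr m)\<^sup>2"
    by (rule quadratic_form_bound[OF assms])
  then show ?thesis unfolding sq by (simp add: exp_add[symmetric])
qed

text \<open>At equality the growth rate b^2 / (4 A) of the row integrals is exactly B, and that of
  the column integrals is exactly A. The weights therefore cancel completely, leaving the two
  constants for Schur's test.\<close>

lemma proj_bounded_critical: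
  fixes a b g p q m :: real
  assumes b: "b > 0" and g: "g > 0" and p: "1 \<le> p" and q: "p \<le> q" and m: "0 < m" "m \<le> 1"
    and crit: "b\<^sup>2 = 4 * (b - a / p) * (g / q)"
  shows "proj_bounded b m a p g q TYPE('n::finite)"
proof -
  define A where "A = b - a / p"
  define B where "B = g / q"
  have B: "B > 0" using g p q by (simp add: B_def)
  have AB: "b\<^sup>2 = 4 * A * B" using crit by (simp add: A_def B_def)
  have "4 * A * B > 0" using b by (simp flip: AB)
  then have A: "A > 0" using B by (simp add: zero_less_mult_iff)
  obtain C1 where C1: "C1 > 0" "\<And>x :: complex ^ 'n. (\<integral>\<^sup>+y. ennreal (norm (kernel b m x y) * exp (- A * norm y powr (2 * m))) \<partial>lebesgue)
      \<le> ennreal (C1 * exp (b\<^sup>2 / (4 * A) * norm x powr (2 * m)))"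
    by (rule kernel_integral_bound[OF m A b, where 'n = 'n]) blast
  obtain C2 where C2: "C2 > 0" "\<And>x :: complex ^ 'n. (\<integral>\<^sup>+y. ennreal (norm (kernel b m x y) * exp (- B * norm y powr (2 * m))) \<partial>lebesgue)
      \<le> ennreal (C2 * exp (b\<^sup>2 / (4 * B) * norm x powr (2 * m)))"
    by (rule kernel_integral_bound[OF m B b, where 'n = 'n]) blast
  obtain C3 where C3: "C3 > 0" "\<And>x y :: complex ^ 'n. norm (kernel b m x y) \<le> C3 * exp (b * norm x powr m * norm y powr m)"
    by (rule norm_kernel_le[OF b m, where 'n = 'n]) blast
  \<comment> \<open>The only use of criticality for the integrals: growth and weight have equal
    rates in both variables.\<close>
  have BA: "b\<^sup>2 / (4 * A) = B" "b\<^sup>2 / (4 * B) = A" using A B by (simp_all add: AB)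
  define C where "C = C1 + C2 + C3"
  have C: "C \<ge> 0" using C1 C2 C3 by (simp add: C_def)
  interpret L: sigma_finite_measure "lebesgue :: (complex ^ 'n) measure" by (rule sigma_finite_lebesgue)
  interpret P: pair_sigma_finite "lebesgue :: (complex ^ 'n) measure" "lebesgue :: (complex ^ 'n) measure" ..
  define T where "T x y = norm (kernel b m x y) * exp (- A * norm y powr (2 * m)) * exp (- B * norm x powr (2 * m))"
    for x y :: "complex ^ 'n"
  have T0: "T x y \<ge> 0" for x y by (simp add: T_def)
  have Tm: "case_prod T \<in> borel_measurable (lebesgue \<Otimes>\<^sub>M lebesgue)" unfolding T_def by measurable
  have int_bound: "(\<integral>\<^sup>+y. ennreal (norm (kernel b m x y) * exp (- A' * norm y powr (2 * m)) * exp (- B' * norm x powr (2 * m))) \<partial>lebesgue) \<le> ennreal C'"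
    if le: "(\<integral>\<^sup>+y. ennreal (norm (kernel b m x y) * exp (- A' * norm y powr (2 * m))) \<partial>lebesgue) \<le> ennreal (C' * exp (B' * norm x powr (2 * m)))"
      and C': "C' > 0" for A' B' C' :: real and x :: "complex ^ 'n"
  proof -
    have "(\<integral>\<^sup>+y. ennreal (norm (kernel b m x y) * exp (- A' * norm y powr (2 * m)) * exp (- B' * norm x powr (2 * m))) \<partial>lebesgue)
      = (\<integral>\<^sup>+y. ennreal (norm (kernel b m x y) * exp (- A' * norm y powr (2 * m))) * ennreal (exp (- B' * norm x powr (2 * m))) \<partial>lebesgue)"
      by (intro nn_integral_cong ennreal_mult) auto
    also have "\<dots> = (\<integral>\<^sup>+y. ennreal (norm (kernel b m x y) * exp (- A' * norm y powr (2 * m))) \<partial>lebesgue) * ennreal (exp (- B' * norm x powr (2 * m)))"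
      by (rule nn_integral_multc) measurable
    also have "\<dots> \<le> ennreal (C' * exp (B' * norm x powr (2 * m))) * ennreal (exp (- B' * norm x powr (2 * m)))"
      by (intro mult_right_mono le) auto
    also have "\<dots> = ennreal (C' * exp (B' * norm x powr (2 * m)) * exp (- B' * norm x powr (2 * m)))"
      using C' by (intro ennreal_mult[symmetric]) auto
    also have "C' * exp (B' * norm x powr (2 * m)) * exp (- B' * norm x powr (2 * m)) = C'"
      by (simp add: mult.assoc exp_add[symmetric])
    finally show ?thesis .
  qed
  show ?thesis
  proof (rule proj_boundedI)
    show "1 \<le> q" using p q by simp
    show "(C + 1) powr q * C powr (q / p) \<ge> 0" by simp
    fix f :: "complex ^ 'n \<Rightarrow> complex"
    assume f: "in_Lp f (mu a m) p"
    have [measurable]: "f \<in> borel_measurable lebesgue" by (rule in_Lp_measurable[OF f])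
    define N where "N = Lp_norm f (mu a m) p"
    have N: "N \<ge> 0" by (simp add: N_def Lp_norm_def)
    have "(\<integral>\<^sup>+x. ennreal ((norm (proj b m f x) * exp (- B * norm x powr (2 * m))) powr q) \<partial>lebesgue)
      \<le> ennreal ((C + 1) powr q * C powr (q / p) * (N powr p) powr (q / p))"
    proof (rule P.Schur_test_Lp_Lq[where T = T and u = "\<lambda>y. norm (f y) * exp (- (a / p) * norm y powr (2 * m))", OF Tm])
      show "(\<lambda>y. norm (f y) * exp (- (a / p) * norm y powr (2 * m))) \<in> borel_measurable lebesgue" by measurable
      show "(\<integral>\<^sup>+y. ennreal (T x y) \<partial>lebesgue) \<le> ennreal C" for x
      proof -
        have "(\<integral>\<^sup>+y. ennreal (T x y) \<partial>lebesgue) \<le> ennreal C1"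
          unfolding T_def using C1(2)[of x] C1(1) by (intro int_bound) (simp_all only: BA)
        also have "\<dots> \<le> ennreal C" using C2 C3 by (intro ennreal_leI) (simp add: C_def)
        finally show ?thesis .
      qed
      show "(\<integral>\<^sup>+x. ennreal (T x y) \<partial>lebesgue) \<le> ennreal C" for y
      proof -
        have "T x y = norm (kernel b m y x) * exp (- B * norm x powr (2 * m)) * exp (- A * norm y powr (2 * m))" for x
          by (simp add: T_def norm_kernel_commute[OF b m, of y x] mult_ac)
        then have "(\<integral>\<^sup>+x. ennreal (T x y) \<partial>lebesgue)
            = (\<integral>\<^sup>+x. ennreal (norm (kernel b m y x) * exp (- B * norm x powr (2 * m)) * exp (- A * norm y powr (2 * m))) \<partial>lebesgue)"
          by simp
        also have "\<dots> \<le> ennreal C2"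
          using C2(2)[of y] C2(1) by (intro int_bound) (simp_all only: BA)
        also have "\<dots> \<le> ennreal C" using C1 C3 by (intro ennreal_leI) (simp add: C_def)
        finally show ?thesis .
      qed
      show "T x y \<le> C" for x y
      proof -
        have "T x y \<le> (C3 * exp (b * norm x powr m * norm y powr m)) * exp (- A * norm y powr (2 * m)) * exp (- B * norm x powr (2 * m))"
          unfolding T_def by (intro mult_right_mono C3) auto
        also have "\<dots> = C3 * (exp (b * norm x powr m * norm y powr m) * exp (- A * norm y powr (2 * m)) * exp (- B * norm x powr (2 * m)))"
          by (simp only: mult.assoc)
        also have "\<dots> \<le> C3 * 1"
          using A AB C3(1) by (intro mult_left_mono kernel_weighted_le) auto
        also have "\<dots> \<le> C" using C1 C2 by (simp add: C_def)
        finally show ?thesis .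
      qed
      show "(\<integral>\<^sup>+y. ennreal ((norm (f y) * exp (- (a / p) * norm y powr (2 * m))) powr p) \<partial>lebesgue) = ennreal (N powr p)"
        unfolding N_def using p by (intro in_Lp_nn_integral[OF f]) simp
      show "ennreal (norm (proj b m f x) * exp (- B * norm x powr (2 * m)))
         \<le> (\<integral>\<^sup>+y. ennreal (T x y * (norm (f y) * exp (- (a / p) * norm y powr (2 * m)))) \<partial>lebesgue)" for x
        unfolding T_def A_def by (rule proj_bound) measurable
    qed (use C p q T0 in auto)
    also have "(N powr p) powr (q / p) = N powr q" using p by (simp add: powr_powr)
    finally show "(\<integral>\<^sup>+x. ennreal ((norm (proj b m f x) * exp (- (g / q) * norm x powr (2 * m))) powr q) \<partial>lebesgue)
        \<le> ennreal ((C + 1) powr q * C powr (q / p) * Lp_norm f (mu a m) p powr q)"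
      by (simp only: B_def N_def)
  qed
qed

text \<open>The slack in the discriminant allows a rate \<open>e\<close> to be taken from both
  weights. The kernel is then dominated by a product of a decaying function of x and one of y, and
  such a majorant maps L^p to L^q in either order of p and q.\<close>

lemma proj_bounded_subcritical:
  fixes a b g p q m :: real
  assumes b: "b > 0" and g: "g > 0" and p: "1 \<le> p" and q: "1 \<le> q" and m: "0 < m" "m \<le> 1"
    and sub: "b\<^sup>2 < 4 * (b - a / p) * (g / q)"
  shows "proj_bounded b m a p g q TYPE('n::finite)"
proof -
  define A where "A = b - a / p"
  define B where "B = g / q"
  have B: "B > 0" using g q by (simp add: B_def)
  have AB: "b\<^sup>2 < 4 * A * B" using sub by (simp add: A_def B_def)
  have "4 * A * B > 0" using AB by (smt (verit) zero_le_power2)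
  then have A: "A > 0" using B by (simp add: zero_less_mult_iff)
  \<comment> \<open>Solves the discriminant condition up to second order: 4 (A - e) (B - e) = b^2 +
    4 e^2. It is also smaller than A, so that the reduced form stays positive in y.\<close>
  define e where "e = (4 * A * B - b\<^sup>2) / (4 * (A + B))"
  have e: "e > 0" using A B AB by (simp add: e_def)
  have eA: "e < A"
  proof -
    have "4 * A * B - b\<^sup>2 < A * (4 * (A + B))" using A b by (simp add: algebra_simps add_pos_pos)
    then show ?thesis using A B by (simp add: e_def pos_divide_less_eq)
  qed
  have eAB: "b\<^sup>2 \<le> 4 * (A - e) * (B - e)"
  proof -
    have "e * (4 * (A + B)) = 4 * A * B - b\<^sup>2" using A B by (simp add: e_def)
    moreover have "4 * (A - e) * (B - e) = 4 * A * B - e * (4 * (A + B)) + 4 * e\<^sup>2"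
      by (simp add: power2_eq_square algebra_simps)
    ultimately show ?thesis by simp
  qed
  obtain C3 where C3: "C3 > 0" "\<And>x y :: complex ^ 'n. norm (kernel b m x y) \<le> C3 * exp (b * norm x powr m * norm y powr m)"
    by (rule norm_kernel_le[OF b m, where 'n = 'n]) blast
  have ker: "norm (kernel b m x y) * exp (- A * norm y powr (2 * m)) * exp (- B * norm x powr (2 * m))
      \<le> C3 * exp (- e * norm x powr (2 * m)) * exp (- e * norm y powr (2 * m))" for x y :: "complex ^ 'n"
  proof -
    let ?X = "norm x powr (2 * m)" and ?Y = "norm y powr (2 * m)"
    have "norm (kernel b m x y) * exp (- A * ?Y) * exp (- B * ?X) \<le> (C3 * exp (b * norm x powr m * norm y powr m)) * exp (- A * ?Y) * exp (- B * ?X)"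
      by (intro mult_right_mono C3) auto
    also have "\<dots> = (C3 * exp (- e * ?X) * exp (- e * ?Y)) * (exp (b * norm x powr m * norm y powr m) * exp (- (A - e) * ?Y) * exp (- (B - e) * ?X))"
    proof -
      have "exp (- A * ?Y) = exp (- e * ?Y) * exp (- (A - e) * ?Y)" "exp (- B * ?X) = exp (- e * ?X) * exp (- (B - e) * ?X)"
        by (simp_all add: exp_add[symmetric] algebra_simps)
      then show ?thesis by (simp only: mult_ac)
    qed
    also have "\<dots> \<le> (C3 * exp (- e * ?X) * exp (- e * ?Y)) * 1"
      using C3(1) eA eAB by (intro mult_left_mono kernel_weighted_le) auto
    finally show ?thesis by simp
  qed
  have eq: "e * q > 0" using e q by simp
  define W where "W = enn2real (\<integral>\<^sup>+y. ennreal (exp (- e * norm (y :: complex ^ 'n) powr (2 * m))) \<partial>lebesgue)"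
  have W: "(\<integral>\<^sup>+y. ennreal (exp (- e * norm (y :: complex ^ 'n) powr (2 * m))) \<partial>lebesgue) = ennreal W" "W \<ge> 0"
    using nn_integral_exp_radial_finite[OF e m(1), where 'n = 'n] unfolding W_def nn_integral_completion by auto
  define W2 where "W2 = enn2real (\<integral>\<^sup>+y. ennreal (exp (- (e * q) * norm (y :: complex ^ 'n) powr (2 * m))) \<partial>lebesgue)"
  have W2: "(\<integral>\<^sup>+y. ennreal (exp (- (e * q) * norm (y :: complex ^ 'n) powr (2 * m))) \<partial>lebesgue) = ennreal W2" "W2 \<ge> 0"
    using nn_integral_exp_radial_finite[OF eq m(1), where 'n = 'n] unfolding W2_def nn_integral_completion by auto
  show ?thesis
  proof (rule proj_boundedI[OF q])
    show "(C3 * (W + 1)) powr q * W2 \<ge> 0" using W2 by simp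
    fix f :: "complex ^ 'n \<Rightarrow> complex"
    assume f: "in_Lp f (mu a m) p"
    have [measurable]: "f \<in> borel_measurable lebesgue" by (rule in_Lp_measurable[OF f])
    define N where "N = Lp_norm f (mu a m) p"
    have N: "N \<ge> 0" by (simp add: N_def Lp_norm_def)
    define u where "u y = norm (f y) * exp (- (a / p) * norm y powr (2 * m))" for y
    have [measurable]: "u \<in> borel_measurable lebesgue" unfolding u_def by measurable
    have u0: "u y \<ge> 0" for y by (simp add: u_def)
    have up: "(\<integral>\<^sup>+y. ennreal (u y powr p) \<partial>lebesgue) = ennreal (N powr p)"
      unfolding N_def u_def using p by (intro in_Lp_nn_integral[OF f]) simp
    \<comment> \<open>The single linear functional of f that controls the projection at every x; it
      is bounded by the L^p norm through the threshold argument.\<close>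
    define h where "h = (\<integral>\<^sup>+y. ennreal (exp (- e * norm y powr (2 * m)) * u y) \<partial>lebesgue)"
    have h_le: "h \<le> ennreal (l * W + l powr (1 - p) * N powr p)" if l: "l > 0" for l
    proof -
      have "h \<le> (\<integral>\<^sup>+y. ennreal l * ennreal (exp (- e * norm y powr (2 * m))) + ennreal (l powr (1 - p)) * ennreal (u y powr p) \<partial>lebesgue)"
        unfolding h_def
      proof (rule nn_integral_mono)
        fix y :: "complex ^ 'n"
        let ?w = "exp (- e * norm y powr (2 * m))"
        have w1: "?w \<le> 1" using e by simp
        have "?w * u y \<le> ?w * (l + l powr (1 - p) * u y powr p)"
          by (intro mult_left_mono le_threshold_split u0 l p) simp
        also have "\<dots> \<le> l * ?w + l powr (1 - p) * u y powr p"
          using w1 mult_right_mono[OF w1, of "l powr (1 - p) * u y powr p"] by (simp add: algebra_simps)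
        finally have "ennreal (?w * u y) \<le> ennreal (l * ?w + l powr (1 - p) * u y powr p)"
          by (rule ennreal_leI)
        also have "\<dots> = ennreal (l * ?w) + ennreal (l powr (1 - p) * u y powr p)"
          using l by (intro ennreal_plus) auto
        also have "\<dots> = ennreal l * ennreal ?w + ennreal (l powr (1 - p)) * ennreal (u y powr p)"
          using l by (intro arg_cong2[where f = "(+)"] ennreal_mult) auto
        finally show "ennreal (?w * u y) \<le> ennreal l * ennreal ?w + ennreal (l powr (1 - p)) * ennreal (u y powr p)" .
      qed
      also have "\<dots> = ennreal l * ennreal W + ennreal (l powr (1 - p)) * ennreal (N powr p)"
        by (subst nn_integral_add) (auto simp: nn_integral_cmult W(1)[simplified] up)
      also have "\<dots> = ennreal (l * W + l powr (1 - p) * N powr p)"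
        using l W by (simp add: ennreal_mult ennreal_plus)
      finally show ?thesis .
    qed
    have "h < \<infinity>" using le_less_trans[OF h_le[OF zero_less_one] ennreal_less_top] by simp
    then obtain r where r: "r \<ge> 0" "h = ennreal r" by (cases h) auto
    have "r \<le> (W + 1) * (N powr p) powr (1 / p)"
    proof (rule le_powr_of_threshold[OF r(1) W(2) _ p])
      fix l :: real assume l: "l > 0"
      show "r \<le> l * W + l powr (1 - p) * N powr p"
        using h_le[OF l] l W unfolding r(2) by (subst (asm) ennreal_le_iff) auto
    qed simp
    then have rN: "r \<le> (W + 1) * N" using p N by (simp add: powr_powr)
    have v_le: "norm (proj b m f x) * exp (- B * norm x powr (2 * m)) \<le> C3 * (W + 1) * N * exp (- e * norm x powr (2 * m))" for x
    proof -
      have "ennreal (norm (proj b m f x) * exp (- B * norm x powr (2 * m)))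
        \<le> (\<integral>\<^sup>+y. ennreal ((norm (kernel b m x y) * exp (- (b - a / p) * norm y powr (2 * m)) * exp (- B * norm x powr (2 * m)))
          * (norm (f y) * exp (- (a / p) * norm y powr (2 * m)))) \<partial>lebesgue)"
        by (rule proj_bound) measurable
      also have "\<dots> \<le> (\<integral>\<^sup>+y. ennreal (C3 * exp (- e * norm x powr (2 * m))) * ennreal (exp (- e * norm y powr (2 * m)) * u y) \<partial>lebesgue)"
      proof (rule nn_integral_mono)
        fix y :: "complex ^ 'n"
        have "(norm (kernel b m x y) * exp (- (b - a / p) * norm y powr (2 * m)) * exp (- B * norm x powr (2 * m)))
          * (norm (f y) * exp (- (a / p) * norm y powr (2 * m)))
          \<le> (C3 * exp (- e * norm x powr (2 * m)) * exp (- e * norm y powr (2 * m))) * u y"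
          unfolding A_def[symmetric] u_def by (intro mult_right_mono ker) auto
        then have "ennreal ((norm (kernel b m x y) * exp (- (b - a / p) * norm y powr (2 * m)) * exp (- B * norm x powr (2 * m)))
          * (norm (f y) * exp (- (a / p) * norm y powr (2 * m))))
          \<le> ennreal ((C3 * exp (- e * norm x powr (2 * m))) * (exp (- e * norm y powr (2 * m)) * u y))"
          by (intro ennreal_leI) (simp only: mult.assoc)
        also have "\<dots> = ennreal (C3 * exp (- e * norm x powr (2 * m))) * ennreal (exp (- e * norm y powr (2 * m)) * u y)"
          using C3(1) u0 by (intro ennreal_mult) auto
        finally show "ennreal ((norm (kernel b m x y) * exp (- (b - a / p) * norm y powr (2 * m)) * exp (- B * norm x powr (2 * m)))
          * (norm (f y) * exp (- (a / p) * norm y powr (2 * m))))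
          \<le> ennreal (C3 * exp (- e * norm x powr (2 * m))) * ennreal (exp (- e * norm y powr (2 * m)) * u y)" .
      qed
      also have "\<dots> = ennreal (C3 * exp (- e * norm x powr (2 * m))) * h"
        unfolding h_def by (rule nn_integral_cmult) measurable
      also have "\<dots> = ennreal (C3 * exp (- e * norm x powr (2 * m)) * r)"
        unfolding r(2) using C3(1) r(1) by (intro ennreal_mult[symmetric]) auto
      finally have "norm (proj b m f x) * exp (- B * norm x powr (2 * m)) \<le> C3 * exp (- e * norm x powr (2 * m)) * r"
        using C3(1) r(1) by (subst (asm) ennreal_le_iff) auto
      also have "\<dots> \<le> C3 * exp (- e * norm x powr (2 * m)) * ((W + 1) * N)"
        using C3(1) by (intro mult_left_mono rN) auto
      finally show ?thesis by (simp only: mult_ac)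
    qed
    have "(\<integral>\<^sup>+x. ennreal ((norm (proj b m f x) * exp (- B * norm x powr (2 * m))) powr q) \<partial>lebesgue)
      \<le> (\<integral>\<^sup>+x. ennreal ((C3 * (W + 1) * N) powr q) * ennreal (exp (- (e * q) * norm (x :: complex ^ 'n) powr (2 * m))) \<partial>lebesgue)"
    proof (rule nn_integral_mono)
      fix x :: "complex ^ 'n"
      have "(norm (proj b m f x) * exp (- B * norm x powr (2 * m))) powr q
        \<le> (C3 * (W + 1) * N * exp (- e * norm x powr (2 * m))) powr q"
        using q by (intro powr_mono2 v_le) auto
      also have "\<dots> = (C3 * (W + 1) * N) powr q * exp (- (e * q) * norm x powr (2 * m))"
        by (subst powr_mult) (simp add: exp_powr_real mult_ac)
      finally have "ennreal ((norm (proj b m f x) * exp (- B * norm x powr (2 * m))) powr q)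
        \<le> ennreal ((C3 * (W + 1) * N) powr q * exp (- (e * q) * norm x powr (2 * m)))"
        by (rule ennreal_leI)
      also have "\<dots> = ennreal ((C3 * (W + 1) * N) powr q) * ennreal (exp (- (e * q) * norm x powr (2 * m)))"
        by (intro ennreal_mult) auto
      finally show "ennreal ((norm (proj b m f x) * exp (- B * norm x powr (2 * m))) powr q)
        \<le> ennreal ((C3 * (W + 1) * N) powr q) * ennreal (exp (- (e * q) * norm x powr (2 * m)))" .
    qed
    also have "\<dots> = ennreal ((C3 * (W + 1) * N) powr q) * ennreal W2"
      by (subst nn_integral_cmult) (auto simp only: W2, measurable)
    also have "\<dots> = ennreal ((C3 * (W + 1) * N) powr q * W2)"
      using W2(2) by (intro ennreal_mult[symmetric]) auto
    also have "(C3 * (W + 1) * N) powr q * W2 = (C3 * (W + 1)) powr q * W2 * N powr q"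
      by (subst powr_mult) simp
    finally show "(\<integral>\<^sup>+x. ennreal ((norm (proj b m f x) * exp (- (g / q) * norm x powr (2 * m))) powr q) \<partial>lebesgue)
        \<le> ennreal ((C3 * (W + 1)) powr q * W2 * Lp_norm f (mu a m) p powr q)"
      by (simp only: B_def N_def)
  qed
qed

subsection \<open>Test functions and necessity\<close>

text \<open>Mirror image of \<open>ball_moment_le\<close>: j is rounded up to an even integer 2 k,
  and k + n <= (n + 1) (j + 1) yields the constant.\<close>

lemma ball_moment_ge:
  obtains C where "C > 0"
    "\<And>(x :: complex ^ 'n::finite) j. norm x = 1 \<Longrightarrow> j > 0 \<Longrightarrow>
       ennreal (C * (j + 1) powr (- real CARD('n))) \<le> ball_moment j x"
proof -
  define C where "C = gauss_mass TYPE('n) * (real CARD('n) + 1) powr (- real CARD('n))"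
  have C: "C > 0" using gauss_mass_pos[where 'n = 'n] by (simp add: C_def add_nonneg_pos)
  show ?thesis
  proof (rule that[OF C])
    fix x :: "complex ^ 'n" and j :: real
    assume x: "norm x = 1" and j: "j > 0"
    define k where "k = nat \<lceil>j / 2\<rceil>"
    have k: "j \<le> real (2 * k)" "real k < j / 2 + 1" using j unfolding k_def by linarith+
    have "C * (j + 1) powr (- real CARD('n)) \<le> gauss_mass TYPE('n) * fact k / fact (k + CARD('n))"
    proof -
      have "real (k + CARD('n)) \<le> (real CARD('n) + 1) * (j + 1)"
      proof -
        have "(real CARD('n) + 1) * (j + 1) = real CARD('n) * j + real CARD('n) + j + 1" by (simp add: algebra_simps)
        moreover have "0 \<le> real CARD('n) * j" using j by simp
        moreover have "real (k + CARD('n)) = real k + real CARD('n)" by simp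
        ultimately show ?thesis using k j by linarith
      qed
      moreover have k0: "real (k + CARD('n)) > 0" by (simp add: add_nonneg_pos)
      ultimately have "((real CARD('n) + 1) * (j + 1)) powr (- real CARD('n)) \<le> real (k + CARD('n)) powr (- real CARD('n))"
        by (intro powr_mono2') auto
      also have "\<dots> = 1 / real (k + CARD('n)) ^ CARD('n)"
        using k0 by (simp add: powr_minus powr_realpow divide_inverse del: of_nat_add)
      also have "\<dots> = fact k / (real (k + CARD('n)) ^ CARD('n) * fact k)" by simp
      also have "\<dots> \<le> fact k / fact (k + CARD('n))"
        using fact_add_le_power[of k "CARD('n)"]
        by (intro divide_left_mono mult_pos_pos zero_less_power k0) auto
      finally have "gauss_mass TYPE('n) * ((real CARD('n) + 1) * (j + 1)) powr (- real CARD('n)) \<le> gauss_mass TYPE('n) * (fact k / fact (k + CARD('n)))"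
        using gauss_mass_pos[where 'n = 'n] by (intro mult_left_mono) auto
      then show ?thesis by (simp add: C_def powr_mult mult.assoc)
    qed
    then have "ennreal (C * (j + 1) powr (- real CARD('n))) \<le> ennreal (gauss_mass TYPE('n) * fact k / fact (k + CARD('n)) * norm x ^ (2 * k))"
      using x by (intro ennreal_leI) simp
    also have "\<dots> = (\<integral>\<^sup>+y. ennreal (norm (cinner x y) ^ (2 * k)) * indicator (cball 0 1) y \<partial>lborel)"
      by (rule ball_power_moment_even[symmetric])
    also have "\<dots> \<le> ball_moment j x"
      unfolding ball_moment_def
    proof (rule nn_integral_mono)
      fix y :: "complex ^ 'n"
      show "ennreal (norm (cinner x y) ^ (2 * k)) * indicator (cball 0 1) y \<le> ennreal (norm (cinner x y) powr j) * indicator (cball 0 1) y"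
      proof (cases "norm y \<le> 1")
        case True
        define s where "s = norm (cinner x y)"
        have s: "0 \<le> s" "s \<le> 1" using norm_cinner_le[of x y] True x by (auto simp: s_def)
        have k1: "k > 0" using k j by (cases k) auto
        have "s ^ (2 * k) \<le> s powr j"
        proof (cases "s = 0")
          case True
          then show ?thesis using k1 by (simp add: zero_power)
        next
          case False
          have "s powr (real (2 * k)) \<le> s powr j" using s k by (intro powr_mono') auto
          then show ?thesis using s False by (simp add: powr_realpow del: of_nat_mult)
        qed
        then show ?thesis by (auto simp: s_def intro!: mult_right_mono ennreal_leI)
      qed (simp add: indicator_def)
    qed
    finally show "ennreal (C * (j + 1) powr (- real CARD('n))) \<le> ball_moment j x" .
  qed
qed

text \<open>The integral of |<x, y>|^j exp (- |y|^(2m)), for positive j. A rate A in the exponential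
  contributes only an explicit power of A, so growth in j and dependence on A are separated.\<close>

definition radial_const :: "real \<Rightarrow> real \<Rightarrow> complex ^ 'n::finite \<Rightarrow> real" where
  "radial_const m j x = enn2real (ball_moment j x) * Gamma ((j + 2 * CARD('n)) / (2 * m) + 1)"

text \<open>With z = j / (2m) the ball moment behaves like z^(-n), and Gamma (z + n/m + 1) like z^(z
  - 1/2 + n/m + 1) exp (- z). This gives the power n/m - n + 1/2, the exponent that decides the
  critical case.\<close>

lemma radial_const_asymp:
  fixes m j0 :: real
  assumes m: "m > 0" and j0: "j0 > 0"
  obtains C where "C > 0"
    "\<And>(x :: complex ^ 'n::finite) j. norm x = 1 \<Longrightarrow> j \<ge> j0 \<Longrightarrow>
       radial_const m j x \<le> C * ((j / (2 * m)) powr (j / (2 * m) + (CARD('n) / m - CARD('n) + 1/2)) * exp (- (j / (2 * m))))"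
    "\<And>(x :: complex ^ 'n::finite) j. norm x = 1 \<Longrightarrow> j \<ge> j0 \<Longrightarrow>
       (j / (2 * m)) powr (j / (2 * m) + (CARD('n) / m - CARD('n) + 1/2)) * exp (- (j / (2 * m))) \<le> C * radial_const m j x"
proof -
  let ?n = "real CARD('n)"
  define z0 where "z0 = j0 / (2 * m)"
  define d where "d = ?n / m + 1"
  have z0: "z0 > 0" and d: "d \<ge> 0" using m j0 by (auto simp: z0_def d_def)
  obtain C1 where C1: "C1 > 0" "\<And>(x :: complex ^ 'n) j. j > 0 \<Longrightarrow>
       ball_moment j x \<le> ennreal (C1 * (j + 1) powr (- ?n) * norm x powr j)"
    by (rule ball_moment_le[where 'n = 'n]) blast
  obtain C2 where C2: "C2 > 0" "\<And>(x :: complex ^ 'n) j. norm x = 1 \<Longrightarrow> j > 0 \<Longrightarrow>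
       ennreal (C2 * (j + 1) powr (- ?n)) \<le> ball_moment j x"
    by (rule ball_moment_ge[where 'n = 'n]) blast
  obtain C3 where C3: "C3 > 0" "\<And>z. z \<ge> z0 \<Longrightarrow> Gamma (z + d) \<le> C3 * (Gamma z * z powr d)"
    "\<And>z. z \<ge> z0 \<Longrightarrow> Gamma z * z powr d \<le> C3 * Gamma (z + d)"
    by (rule Gamma_add_asymp[OF z0 d]) blast
  obtain C4 where C4: "C4 > 0" "\<And>z. z \<ge> z0 \<Longrightarrow> Gamma z \<le> C4 * (z powr (z - 1/2) * exp (- z))"
    "\<And>z. z \<ge> z0 \<Longrightarrow> z powr (z - 1/2) * exp (- z) \<le> C4 * Gamma z"
    by (rule Gamma_Stirling_bounds[OF z0]) blast
  define c5 where "c5 = (2 * m) powr (- ?n)"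
  define c6 where "c6 = (1 + 1 / j0) powr ?n / c5"
  have c5: "c5 > 0" and c6: "c6 > 0" 
  proof -
    have "1 + 1 / j0 > 0" using j0 by (intro add_pos_pos) auto
    then show "c5 > 0" "c6 > 0" using m unfolding c5_def c6_def by (auto intro!: divide_pos_pos)
  qed
  have S: "z powr (- ?n) * ((z powr (z - 1/2) * exp (- z)) * z powr d) = z powr (z + (?n / m - ?n + 1/2)) * exp (- z)" for z
  proof -
    have "z powr (- ?n) * z powr (z - 1/2) * z powr d = z powr (z + (?n / m - ?n + 1/2))"
    proof -
      have "- ?n + (z - 1/2) + d = z + (?n / m - ?n + 1/2)" by (simp add: d_def)
      then show ?thesis by (simp only: powr_add[symmetric])
    qed
    then show ?thesis by (simp add: mult_ac)
  qed
  show ?thesis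
  proof (rule that[of "C1 * c5 * C3 * C4 + c6 * C3 * C4 / C2"])
    show "C1 * c5 * C3 * C4 + c6 * C3 * C4 / C2 > 0"
      using C1 C2 C3 C4 c5 c6 by (intro add_pos_pos) auto
  next
    fix x :: "complex ^ 'n" and j :: real
    assume x: "norm x = 1" and j: "j \<ge> j0"
    define z where "z = j / (2 * m)"
    have z: "z \<ge> z0" "z > 0" "j = 2 * m * z" "j > 0" using j j0 m by (auto simp: z_def z0_def divide_right_mono)
    have G: "Gamma z > 0" "Gamma (z + d) > 0" using z d by (auto intro!: Gamma_real_pos)
    have arg: "(j + 2 * CARD('n)) / (2 * m) + 1 = z + d"
      using m by (simp add: z_def d_def add_divide_distrib)
    define \<nu> where "\<nu> = enn2real (ball_moment j x)"
    have bm: "ball_moment j x \<le> ennreal (C1 * (j + 1) powr (- ?n))"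
      using C1(2)[OF z(4), of x] x by simp
    have \<nu>: "ball_moment j x = ennreal \<nu>"
      unfolding \<nu>_def using le_less_trans[OF bm ennreal_less_top] by simp
    have \<nu>0: "\<nu> \<ge> 0" by (simp add: \<nu>_def)
    have up: "\<nu> \<le> C1 * (j + 1) powr (- ?n)"
      using bm C1(1) unfolding \<nu> by (subst (asm) ennreal_le_iff) auto
    have lo: "C2 * (j + 1) powr (- ?n) \<le> \<nu>"
      using C2(2)[OF x z(4)] \<nu>0 unfolding \<nu> by (subst (asm) ennreal_le_iff) auto
    have j1: "(j + 1) powr (- ?n) \<le> c5 * z powr (- ?n)"
    proof -
      have "(j + 1) powr (- ?n) \<le> j powr (- ?n)" using z by (intro powr_mono2') auto
      also have "\<dots> = c5 * z powr (- ?n)" unfolding z(3) c5_def by (rule powr_mult)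
      finally show ?thesis .
    qed
    have j2: "z powr (- ?n) \<le> c6 * (j + 1) powr (- ?n)"
    proof -
      have "1 \<le> j * (1 / j0)" using j j0 by (simp add: field_simps)
      then have "j + 1 \<le> j * (1 + 1 / j0)" by (simp add: distrib_left)
      then have "(j * (1 + 1 / j0)) powr (- ?n) \<le> (j + 1) powr (- ?n)"
        using z j0 by (intro powr_mono2') (auto intro!: mult_pos_pos add_pos_pos)
      then have "j powr (- ?n) * (1 + 1 / j0) powr (- ?n) \<le> (j + 1) powr (- ?n)"
        by (simp only: powr_mult)
      moreover have "j powr (- ?n) = c5 * z powr (- ?n)" unfolding z(3) c5_def by (rule powr_mult)
      ultimately have "c5 * z powr (- ?n) / (1 + 1 / j0) powr ?n \<le> (j + 1) powr (- ?n)"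
        by (simp only: powr_minus_divide) simp
      moreover have "(1 + 1 / j0) powr ?n > 0" using j0 by (simp add: add_pos_pos less_imp_neq[THEN not_sym])
      ultimately have "c5 * z powr (- ?n) \<le> (j + 1) powr (- ?n) * (1 + 1 / j0) powr ?n"
        by (simp add: pos_divide_le_eq)
      then show ?thesis using c5 by (simp add: c6_def field_simps)
    qed
    have SS: "z powr (z + (?n / m - ?n + 1/2)) * exp (- z) \<ge> 0" by simp
    have "radial_const m j x = \<nu> * Gamma (z + d)"
      unfolding radial_const_def \<nu>_def[symmetric] arg ..
    note rc = this
    have "\<nu> * Gamma (z + d) \<le> (C1 * (c5 * z powr (- ?n))) * (C3 * ((C4 * (z powr (z - 1/2) * exp (- z))) * z powr d))"
    proof (rule mult_mono)
      show "\<nu> \<le> C1 * (c5 * z powr (- ?n))"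
        using up mult_left_mono[OF j1, of C1] C1(1) by linarith
      have "Gamma z * z powr d \<le> (C4 * (z powr (z - 1/2) * exp (- z))) * z powr d"
        by (intro mult_right_mono C4 z) simp
      then have "C3 * (Gamma z * z powr d) \<le> C3 * ((C4 * (z powr (z - 1/2) * exp (- z))) * z powr d)"
        using C3(1) by (intro mult_left_mono) auto
      then show "Gamma (z + d) \<le> C3 * ((C4 * (z powr (z - 1/2) * exp (- z))) * z powr d)"
        using C3(2)[OF z(1)] by linarith
    qed (use C1 c5 G \<nu>0 in auto)
    also have "\<dots> = (C1 * c5 * C3 * C4) * (z powr (- ?n) * ((z powr (z - 1/2) * exp (- z)) * z powr d))"
      by (simp only: mult_ac)
    also have "\<dots> \<le> (C1 * c5 * C3 * C4 + c6 * C3 * C4 / C2) * (z powr (z + (?n / m - ?n + 1/2)) * exp (- z))"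
      unfolding S using C2 C3 C4 c6 by (intro mult_right_mono SS) auto
    finally show "radial_const m j x \<le> (C1 * c5 * C3 * C4 + c6 * C3 * C4 / C2) * ((j / (2 * m)) powr (j / (2 * m) + (?n / m - ?n + 1/2)) * exp (- (j / (2 * m))))"
      unfolding rc z_def .
    have "z powr (- ?n) * ((z powr (z - 1/2) * exp (- z)) * z powr d) \<le> (c6 * (\<nu> / C2)) * (C4 * (C3 * Gamma (z + d)))"
    proof (rule mult_mono)
      have "(j + 1) powr (- ?n) \<le> \<nu> / C2" using lo C2(1) by (simp add: field_simps)
      then show "z powr (- ?n) \<le> c6 * (\<nu> / C2)"
        using j2 mult_left_mono[of "(j + 1) powr (- ?n)" "\<nu> / C2" c6] c6 by linarith
      have "(z powr (z - 1/2) * exp (- z)) * z powr d \<le> (C4 * Gamma z) * z powr d"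
        by (intro mult_right_mono C4 z) simp
      also have "\<dots> = C4 * (Gamma z * z powr d)" by simp
      also have "\<dots> \<le> C4 * (C3 * Gamma (z + d))" using C4(1) by (intro mult_left_mono C3 z) auto
      finally show "(z powr (z - 1/2) * exp (- z)) * z powr d \<le> C4 * (C3 * Gamma (z + d))" .
    qed (use c6 C2 \<nu>0 in auto)
    also have "\<dots> = (c6 * C3 * C4 / C2) * (\<nu> * Gamma (z + d))" by simp
    also have "\<dots> \<le> (C1 * c5 * C3 * C4 + c6 * C3 * C4 / C2) * (\<nu> * Gamma (z + d))"
      using C1 C3 C4 c5 G \<nu>0 by (intro mult_right_mono) auto
    finally show "(j / (2 * m)) powr (j / (2 * m) + (?n / m - ?n + 1/2)) * exp (- (j / (2 * m))) \<le> (C1 * c5 * C3 * C4 + c6 * C3 * C4 / C2) * radial_const m j x"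
      unfolding rc S z_def .
  qed
qed

lemma nn_integral_radial_const:
  fixes x :: "complex ^ 'n::finite"
  assumes j: "j > 0" and A: "A > 0" and m: "m > 0"
  shows "(\<integral>\<^sup>+y. ennreal (norm (cinner x y) powr j * exp (- A * norm y powr (2 * m))) \<partial>lborel)
    = ennreal (A powr (- (j + 2 * CARD('n)) / (2 * m)) * radial_const m j x)"
proof -
  obtain C1 where C1: "C1 > 0" "\<And>(x :: complex ^ 'n) j. j > 0 \<Longrightarrow>
       ball_moment j x \<le> ennreal (C1 * (j + 1) powr (- real CARD('n)) * norm x powr j)"
    by (rule ball_moment_le[where 'n = 'n]) blast
  have \<nu>: "ball_moment j x = ennreal (enn2real (ball_moment j x))"
    using le_less_trans[OF C1(2)[OF j, of x] ennreal_less_top] by simp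
  have "Gamma ((j + 2 * CARD('n)) / (2 * m) + 1) > 0" using j m by (intro Gamma_real_pos add_nonneg_pos) auto
  then have "ball_moment j x * ennreal (A powr (- (j + 2 * CARD('n)) / (2 * m)) * Gamma ((j + 2 * CARD('n)) / (2 * m) + 1))
    = ennreal (A powr (- (j + 2 * CARD('n)) / (2 * m)) * radial_const m j x)"
    by (subst \<nu>, subst ennreal_mult[symmetric]) (auto simp: radial_const_def mult_ac)
  then show ?thesis
    unfolding nn_integral_radial_moment[OF assms, symmetric]
    by (simp add: ennreal_mult)
qed

section \<open>Action of the projection on truncated monomials\<close>

lemma integral_eq_0_of_antisymmetry:
  fixes F :: "'a::euclidean_space \<Rightarrow> 'b::{banach, second_countable_topology}" and T :: "'a \<Rightarrow> 'a"
  assumes [measurable]: "F \<in> borel_measurable borel" and T: "linear T" and iso: "\<And>x. norm (T x) = norm x"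
    and anti: "\<And>y. F (T y) = - F y"
  shows "(\<integral>y. F y \<partial>lborel) = 0"
proof -
  have "(\<integral>y. F y \<partial>lborel) = (\<integral>y. F (T y) \<partial>lborel)"
    by (intro integral_lborel_isometry[symmetric] T iso) measurable
  also have "\<dots> = - (\<integral>y. F y \<partial>lborel)" by (simp add: anti)
  finally have "(\<integral>y. F y \<partial>lborel) = - (\<integral>y. F y \<partial>lborel)" .
  then have "2 *\<^sub>R (\<integral>y. F y \<partial>lborel) = 0"
    by (metis add.right_inverse scaleR_2)
  then show ?thesis by simp
qed

text \<open>The coordinate i is separated from the rest R of the product. In the binomial expansion
  every term containing R vanishes by a rotation of the other coordinates, which changes neither y_i
  nor |y|.\<close>

lemma integral_cinner_monomial:
  fixes x :: "complex ^ 'n::finite" and w :: "real \<Rightarrow> real" and i :: 'n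
  assumes [measurable]: "w \<in> borel_measurable borel"
    and int: "\<And>j. integrable lborel (\<lambda>y :: complex ^ 'n. norm y ^ j * w (norm y))"
  shows "(\<integral>y. complex_of_real (w (norm y)) * y $ i ^ k * cinner x y ^ k \<partial>lborel)
    = x $ i ^ k * complex_of_real (\<integral>y. w (norm y) * norm ((y :: complex ^ 'n) $ i) ^ (2 * k) \<partial>lborel)"
proof -
  define R where "R y = (\<Sum>l\<in>UNIV - {i}. x $ l * cnj (y $ l))" for y :: "complex ^ 'n"
  have split: "cinner x y = R y + x $ i * cnj (y $ i)" for y
    unfolding cinner_def R_def by (subst sum.remove[of _ i]) auto
  have [measurable]: "R \<in> borel_measurable borel"
    unfolding R_def by (intro borel_measurable_continuous_onI continuous_intros)
  have comp[measurable]: "(\<lambda>y :: complex ^ 'n. y $ i) \<in> borel_measurable borel"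
    by (intro borel_measurable_continuous_onI continuous_intros)
  define F where "F l y = complex_of_real (w (norm y)) * y $ i ^ k * (R y ^ l * (x $ i * cnj (y $ i)) ^ (k - l))"
    for l and y :: "complex ^ 'n"
  have Fm[measurable]: "F l \<in> borel_measurable borel" for l unfolding F_def by measurable
  have R_le: "norm (R y) \<le> (2 * norm x) * norm y" for y
  proof -
    have "norm (R y) = norm (cinner x y - x $ i * cnj (y $ i))" by (simp add: split)
    also have "\<dots> \<le> norm (cinner x y) + norm (x $ i) * norm (y $ i)"
      by (intro order_trans[OF norm_triangle_ineq4]) (simp add: norm_mult)
    also have "\<dots> \<le> norm x * norm y + norm x * norm y"
      by (intro add_mono norm_cinner_le mult_mono Finite_Cartesian_Product.norm_nth_le) auto
    finally show ?thesis by simp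
  qed
  have Fi: "integrable lborel (F l)" if "l \<le> k" for l
  proof (rule Bochner_Integration.integrable_bound[OF integrable_mult_right[OF int[of "2 * k"], of "(2 * norm x) ^ k"]])
    show "AE y in lborel. norm (F l y) \<le> norm ((2 * norm x) ^ k * (norm y ^ (2 * k) * w (norm y)))"
    proof (intro always_eventually allI)
      fix y :: "complex ^ 'n"
      have "norm (x $ i) * norm (y $ i) \<le> norm x * norm y" by (intro mult_mono Finite_Cartesian_Product.norm_nth_le) auto
      also have "\<dots> \<le> 2 * norm x * norm y" by simp
      finally have "(norm (x $ i) * norm (y $ i)) ^ (k - l) \<le> (2 * norm x * norm y) ^ (k - l)"
        by (intro power_mono) auto
      moreover have "norm (R y) ^ l \<le> (2 * norm x * norm y) ^ l" by (intro power_mono R_le) auto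
      ultimately have "norm (R y) ^ l * (norm (x $ i) * norm (y $ i)) ^ (k - l) \<le> (2 * norm x * norm y) ^ l * (2 * norm x * norm y) ^ (k - l)"
        by (intro mult_mono) auto
      also have "\<dots> = (2 * norm x * norm y) ^ k" using that by (simp add: power_add[symmetric])
      finally have "norm (R y) ^ l * (norm (x $ i) * norm (y $ i)) ^ (k - l) \<le> (2 * norm x * norm y) ^ k" .
      then have "\<bar>w (norm y)\<bar> * norm (y $ i) ^ k * (norm (R y) ^ l * (norm (x $ i) * norm (y $ i)) ^ (k - l))
        \<le> \<bar>w (norm y)\<bar> * norm y ^ k * (2 * norm x * norm y) ^ k"
        by (intro mult_mono power_mono Finite_Cartesian_Product.norm_nth_le mult_left_mono) auto
      also have "\<dots> = (2 * norm x) ^ k * (norm y ^ (2 * k) * \<bar>w (norm y)\<bar>)"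
        by (simp add: power_mult_distrib power_mult power2_eq_square mult_ac)
      finally show "norm (F l y) \<le> norm ((2 * norm x) ^ k * (norm y ^ (2 * k) * w (norm y)))"
        by (simp add: F_def norm_mult norm_power abs_mult)
    qed
  qed (use Fm[of l] in simp)
  have F0: "(\<integral>y. F l y \<partial>lborel) = 0" if l: "l \<noteq> 0" for l
  proof -
    obtain c :: complex where c: "norm c = 1" "cnj c ^ l * c ^ 0 = -1"
      using exists_phase_minus_one[OF l] by blast
    \<comment> \<open>Turns all coordinates except i by a phase whose conjugate has l-th power - 1,
      so R^l changes sign and nothing else does.\<close>
    define T where "T y = (\<chi> j. if j = i then y $ j else c * y $ j)" for y :: "complex ^ 'n"
    have "linear T" by (rule linearI) (auto simp: T_def vec_eq_iff algebra_simps)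
    moreover have "norm (T y) = norm y" for y
    proof -
      have "norm (T y $ j) = norm (y $ j)" for j using c by (simp add: T_def norm_mult)
      then show ?thesis by (simp add: norm_vec_def)
    qed
    moreover have "F l (T y) = - F l y" for y
    proof -
      have "R (T y) = cnj c * R y"
        unfolding R_def sum_distrib_left by (intro sum.cong) (auto simp: T_def mult_ac)
      moreover have "T y $ i = y $ i" by (simp add: T_def)
      moreover have "(cnj c * R y) ^ l = - (R y ^ l)" using c(2) by (simp add: power_mult_distrib)
      ultimately show ?thesis unfolding F_def \<open>\<And>y. norm (T y) = norm y\<close> by simp
    qed
    ultimately show ?thesis by (intro integral_eq_0_of_antisymmetry[of "F l" T] Fm)
  qed
  have "(\<integral>y. complex_of_real (w (norm y)) * y $ i ^ k * cinner x y ^ k \<partial>lborel)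
      = (\<integral>y. (\<Sum>l\<le>k. of_nat (k choose l) * F l y) \<partial>lborel)"
  proof (rule Bochner_Integration.integral_cong[OF refl])
    fix y
    show "complex_of_real (w (norm y)) * y $ i ^ k * cinner x y ^ k = (\<Sum>l\<le>k. of_nat (k choose l) * F l y)"
      unfolding split binomial_ring sum_distrib_left F_def by (intro sum.cong refl) (simp only: mult_ac)
  qed
  also have "\<dots> = (\<Sum>l\<le>k. of_nat (k choose l) * (\<integral>y. F l y \<partial>lborel))"
    by (subst Bochner_Integration.integral_sum) (auto intro!: integrable_mult_right Fi)
  also have "\<dots> = (\<Sum>l\<in>{0}. of_nat (k choose l) * (\<integral>y. F l y \<partial>lborel))"
    by (intro sum.mono_neutral_right) (auto simp: F0)
  also have "\<dots> = (\<integral>y. F 0 y \<partial>lborel)" by simp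
  also have "\<dots> = (\<integral>y. x $ i ^ k * complex_of_real (w (norm y) * norm ((y :: complex ^ 'n) $ i) ^ (2 * k)) \<partial>lborel)"
  proof (rule Bochner_Integration.integral_cong[OF refl])
    fix y :: "complex ^ 'n"
    have "y $ i ^ k * cnj (y $ i) ^ k = complex_of_real ((norm (y $ i))\<^sup>2) ^ k"
      by (simp only: power_mult_distrib[symmetric] complex_norm_square)
    then have e: "y $ i ^ k * cnj (y $ i) ^ k = complex_of_real (norm (y $ i) ^ (2 * k))"
      by (simp add: power_mult)
    have "F 0 y = x $ i ^ k * (complex_of_real (w (norm y)) * (y $ i ^ k * cnj (y $ i) ^ k))"
      by (simp add: F_def power_mult_distrib)
    then show "F 0 y = x $ i ^ k * complex_of_real (w (norm y) * norm (y $ i) ^ (2 * k))"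
      unfolding e by simp
  qed
  also have "\<dots> = x $ i ^ k * complex_of_real (\<integral>y. w (norm y) * norm ((y :: complex ^ 'n) $ i) ^ (2 * k) \<partial>lborel)"
    by (simp only: integral_mult_right_zero integral_complex_of_real)
  finally show ?thesis .
qed

declare id_lebesgue_borel[measurable del]

lemma integrable_radial_truncated:
  fixes s R :: real
  assumes m: "m > 0"
  shows "integrable lborel (\<lambda>y :: complex ^ 'n::finite. norm y ^ j * (exp (s * norm y powr (2 * m)) * (if norm y \<le> R then 1 else 0)))"
proof (rule Bochner_Integration.integrable_bound)
  show "integrable lborel (\<lambda>y :: complex ^ 'n. (R ^ j * exp (\<bar>s\<bar> * R powr (2 * m))) * indicat_real (cball 0 R) y)"
    using emeasure_lborel_cball_finite[of "0 :: complex ^ 'n" R]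
    by (intro integrable_mult_right integrable_real_indicator) auto
  show "AE y :: complex ^ 'n in lborel. norm (norm y ^ j * (exp (s * norm y powr (2 * m)) * (if norm y \<le> R then 1 else 0)))
    \<le> norm ((R ^ j * exp (\<bar>s\<bar> * R powr (2 * m))) * indicat_real (cball 0 R) y)"
  proof (intro always_eventually allI)
    fix y :: "complex ^ 'n"
    show "norm (norm y ^ j * (exp (s * norm y powr (2 * m)) * (if norm y \<le> R then 1 else 0)))
    \<le> norm ((R ^ j * exp (\<bar>s\<bar> * R powr (2 * m))) * indicat_real (cball 0 R) y)"
    proof (cases "norm y \<le> R")
      case True
      have R: "R \<ge> 0" using True norm_ge_zero[of y] by linarith
      have "s * norm y powr (2 * m) \<le> \<bar>s\<bar> * R powr (2 * m)"
        using True m by (intro mult_mono powr_mono2) auto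
      then have "norm y ^ j * exp (s * norm y powr (2 * m)) \<le> R ^ j * exp (\<bar>s\<bar> * R powr (2 * m))"
        using True R by (intro mult_mono power_mono) auto
      then show ?thesis using True R by (simp add: abs_mult power_abs)
    qed simp
  qed
qed measurable

lemma component_measurable[measurable]: "(\<lambda>y :: complex ^ 'n::finite. y $ i) \<in> borel_measurable borel"
  by (intro borel_measurable_continuous_onI continuous_intros)

text \<open>The rate s = a / p - c may be so large that the exponential leaves L^2 with weight b.
  The cut-off at R puts the function into both spaces, and it is removed by monotone convergence
  after the operator bound has been applied.\<close>

definition test_fun :: "real \<Rightarrow> real \<Rightarrow> real \<Rightarrow> nat \<Rightarrow> 'n::finite \<Rightarrow> complex ^ 'n \<Rightarrow> complex" where
  "test_fun m s R k i y = complex_of_real (exp (s * norm y powr (2 * m)) * (if norm y \<le> R then 1 else 0)) * y $ i ^ k"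

lemma test_fun_measurable[measurable]: "test_fun m s R k i \<in> borel_measurable borel"
  unfolding test_fun_def by measurable

text \<open>The kernel series is integrated term by term; a common phase on y annihilates every
  degree except k, and \<open>integral_cinner_monomial\<close> evaluates the surviving one.\<close>

lemma proj_test_fun:
  fixes x :: "complex ^ 'n::finite" and i :: 'n
  assumes b: "b > 0" and m: "m > 0" "m \<le> 1" and R: "R \<ge> 0"
  shows "proj b m (test_fun m s R k i) x =
    complex_of_real (kconst b m CARD('n) * kcoef m CARD('n) k * (b powr (1 / m)) ^ k *
      (\<integral>y. (exp ((s - b) * norm y powr (2 * m)) * (if norm y \<le> R then 1 else 0)) * norm ((y :: complex ^ 'n) $ i) ^ (2 * k) \<partial>lborel)) * x $ i ^ k"
proof -
  let ?n = "CARD('n)"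
  have n: "?n \<ge> 1" by (simp add: Suc_le_eq)
  define \<beta> where "\<beta> = b powr (1 / m)"
  define \<kappa> where "\<kappa> = kconst b m ?n"
  have \<beta>: "\<beta> > 0" using b by (simp add: \<beta>_def)
  have \<kappa>: "\<kappa> > 0" unfolding \<kappa>_def by (rule kconst_pos[OF b m(1)])
  define W where "W r = exp ((s - b) * r powr (2 * m)) * (if r \<le> R then 1 else 0)" for r :: real
  have W0: "W r \<ge> 0" for r by (simp add: W_def)
  have [measurable]: "W \<in> borel_measurable borel" unfolding W_def by measurable
  have Wi: "integrable lborel (\<lambda>y :: complex ^ 'n. norm y ^ j * W (norm y))" for j
    unfolding W_def by (rule integrable_radial_truncated[OF m(1)])
  define G where "G j y = complex_of_real (\<kappa> * kcoef m ?n j * \<beta> ^ j) * (complex_of_real (W (norm y)) * y $ i ^ k * cinner x y ^ j)"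
    for j and y :: "complex ^ 'n"
  have Gm[measurable]: "G j \<in> borel_measurable borel" for j unfolding G_def by measurable
  have kc: "kcoef m ?n j > 0" for j by (rule kcoef_pos[OF m(1) n])
  \<comment> \<open>On the support |<x, y>| <= |x| R, so the terms are dominated by a convergent
    numerical series times a fixed integrable function.\<close>
  define h where "h j = \<kappa> * kcoef m ?n j * (\<beta> * (norm x * R)) ^ j" for j
  have h0: "h j \<ge> 0" for j using \<kappa> kc[of j] \<beta> R by (simp add: h_def)
  have G_le: "norm (G j y) \<le> h j * (norm y ^ k * W (norm y))" for j y
  proof (cases "norm y \<le> R")
    case True
    have "norm (cinner x y) \<le> norm x * R"
      using norm_cinner_le[of x y] mult_left_mono[OF True, of "norm x"] by simp
    then have "W (norm y) * (norm (y $ i) ^ k * norm (cinner x y) ^ j) \<le> W (norm y) * (norm y ^ k * (norm x * R) ^ j)"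
      using W0 R by (intro mult_left_mono mult_mono power_mono Finite_Cartesian_Product.norm_nth_le) auto
    then have "(\<kappa> * kcoef m ?n j * \<beta> ^ j) * (W (norm y) * (norm (y $ i) ^ k * norm (cinner x y) ^ j)) \<le> (\<kappa> * kcoef m ?n j * \<beta> ^ j) * (W (norm y) * (norm y ^ k * (norm x * R) ^ j))"
      by (rule mult_left_mono) (use \<kappa> kc[of j] \<beta> in simp)
    moreover have "norm (G j y) = (\<kappa> * kcoef m ?n j * \<beta> ^ j) * (W (norm y) * (norm (y $ i) ^ k * norm (cinner x y) ^ j))"
      using \<kappa> kc[of j] \<beta> W0 by (simp add: G_def norm_mult norm_power mult.assoc)
    ultimately show ?thesis by (simp add: h_def power_mult_distrib mult_ac)
  qed (simp add: G_def W_def)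
  have Gi: "integrable lborel (G j)" for j
  proof (rule Bochner_Integration.integrable_bound[OF integrable_mult_right[OF Wi[of k], of "h j"]])
    show "AE y in lborel. norm (G j y) \<le> norm (h j * (norm y ^ k * W (norm y)))"
      using G_le order_trans[OF _ abs_ge_self] by (intro always_eventually allI) (simp only: real_norm_def, blast)
  qed (use Gm[of j] in simp)
  have ksum: "summable (\<lambda>j. kcoef m ?n j * r ^ j)" if "r \<ge> 0" for r by (rule kcoef_summable[OF m n that])
  have hsum: "summable h"
    unfolding h_def using ksum[of "\<beta> * (norm x * R)"] \<beta> R by (simp add: mult.assoc summable_mult)
  have Gnsum: "summable (\<lambda>j. norm (G j y))" for y
    by (rule summable_comparison_test_ev[OF _ summable_mult2[OF hsum, of "norm y ^ k * W (norm y)"]])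
      (use G_le in \<open>auto intro!: always_eventually\<close>)
  have Gisum: "summable (\<lambda>j. \<integral>y. norm (G j y) \<partial>lborel)"
  proof (rule summable_comparison_test_ev[OF _ summable_mult2[OF hsum, of "\<integral>y. norm y ^ k * W (norm (y :: complex ^ 'n)) \<partial>lborel"]], intro always_eventually allI)
    fix j
    have "(\<integral>y. norm (G j y) \<partial>lborel) \<le> (\<integral>y. h j * (norm y ^ k * W (norm (y :: complex ^ 'n))) \<partial>lborel)"
      by (intro integral_mono integrable_norm Gi integrable_mult_right Wi G_le)
    then show "norm (\<integral>y. norm (G j y) \<partial>lborel) \<le> h j * (\<integral>y. norm y ^ k * W (norm (y :: complex ^ 'n)) \<partial>lborel)"
      by simp
  qed
  have sums: "(\<lambda>j. \<integral>y. G j y \<partial>lborel) sums (\<integral>y. (\<Sum>j. G j y) \<partial>lborel)"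
    using Gi Gnsum Gisum by (intro sums_integral) auto
  have G_suminf: "(\<Sum>j. G j y) = exp (- b * norm y powr (2 * m)) *\<^sub>R (test_fun m s R k i y * kernel b m x y)" for y
  proof -
    have sK: "summable (\<lambda>j. complex_of_real (kcoef m ?n j) * t ^ j)" for t
      by (rule summable_norm_cancel) (use ksum[of "norm t"] kc in \<open>simp add: norm_mult norm_power less_imp_le\<close>)
    let ?t = "complex_of_real \<beta> * cinner x y"
    have "(\<Sum>j. G j y) = (\<Sum>j. (complex_of_real \<kappa> * (complex_of_real (W (norm y)) * y $ i ^ k)) * (complex_of_real (kcoef m ?n j) * ?t ^ j))"
      by (intro suminf_cong) (simp add: G_def power_mult_distrib mult_ac)
    also have "\<dots> = (complex_of_real \<kappa> * (complex_of_real (W (norm y)) * y $ i ^ k)) * kfun m ?n ?t"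
      unfolding kfun_def by (rule suminf_mult[OF sK])
    also have "W (norm y) = exp (- b * norm y powr (2 * m)) * (exp (s * norm y powr (2 * m)) * (if norm y \<le> R then 1 else 0))"
      by (simp add: W_def exp_add[symmetric] algebra_simps)
    finally show ?thesis
      unfolding kernel_eq_kfun test_fun_def \<kappa>_def kconst_def \<beta>_def
      by (simp add: scaleR_conv_of_real mult_ac)
  qed
  have "proj b m (test_fun m s R k i) x = (\<integral>y. exp (- b * norm y powr (2 * m)) *\<^sub>R (test_fun m s R k i y * kernel b m x y) \<partial>lebesgue)"
    unfolding proj_def mu_def by (rule integral_density) (auto intro!: borel_imp_lebesgue)
  also have "\<dots> = (\<integral>y. exp (- b * norm y powr (2 * m)) *\<^sub>R (test_fun m s R k i y * kernel b m x y) \<partial>lborel)"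
    by (rule integral_completion) measurable
  also have "\<dots> = (\<integral>y. (\<Sum>j. G j y) \<partial>lborel)" by (simp only: G_suminf)
  finally have "(\<lambda>j. \<integral>y. G j y \<partial>lborel) sums proj b m (test_fun m s R k i) x" using sums by simp
  \<comment> \<open>The j-th term has bidegree (j, k) in y.\<close>
  moreover have "(\<integral>y. G j y \<partial>lborel) = 0" if "j \<noteq> k" for j
  proof (rule integral_bidegree_eq_0[OF Gm that])
    fix c :: complex and y :: "complex ^ 'n"
    assume "norm c = 1"
    moreover have "cmul c y $ i = c * y $ i" by (simp add: cmul_def)
    ultimately show "G j (cmul c y) = cnj c ^ j * c ^ k * G j y"
      by (simp add: G_def cinner_cmul norm_cmul power_mult_distrib mult_ac)
  qed
  then have "(\<lambda>j. \<integral>y. G j y \<partial>lborel) sums (\<integral>y. G k y \<partial>lborel)"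
    by (intro sums_finite[of "{k}", simplified]) auto
  ultimately have "proj b m (test_fun m s R k i) x = (\<integral>y. G k y \<partial>lborel)"
    using sums_unique2 by blast
  also have "\<dots> = complex_of_real (\<kappa> * kcoef m ?n k * \<beta> ^ k) * (\<integral>y. complex_of_real (W (norm y)) * y $ i ^ k * cinner x y ^ k \<partial>lborel)"
    unfolding G_def by simp
  also have "(\<integral>y. complex_of_real (W (norm y)) * y $ i ^ k * cinner x y ^ k \<partial>lborel)
      = x $ i ^ k * complex_of_real (\<integral>y. W (norm y) * norm ((y :: complex ^ 'n) $ i) ^ (2 * k) \<partial>lborel)"
    by (intro integral_cinner_monomial Wi) measurable
  finally show ?thesis
    unfolding W_def \<kappa>_def \<beta>_def by (simp add: mult_ac)
qed

lemma norm_cinner_axis: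
  fixes y :: "complex ^ 'n::finite"
  shows "norm (cinner (axis i 1) y) = norm (y $ i)"
proof -
  have "cinner (axis i 1) y = (\<Sum>l\<in>UNIV. if l = i then cnj (y $ l) else 0)"
    unfolding cinner_def by (intro sum.cong) (auto simp: axis_def)
  then show ?thesis by simp
qed

text \<open>For k = 0 the identity breaks at r = 0, since 0 ^ 0 = 1 but 0 powr 0 = 0; hence all test
  functions have degree at least 1.\<close>

lemma power_powr_mult:
  fixes r :: real
  assumes "r \<ge> 0" "k \<ge> 1"
  shows "(r ^ k) powr q = r powr (real k * q)"
proof (cases "r = 0")
  case False
  then have "r ^ k = r powr real k" using assms by (simp add: powr_realpow)
  then show ?thesis by (simp add: powr_powr)
qed (use assms in \<open>simp add: zero_power\<close>)

lemma in_Lp_test_fun: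
  fixes i :: "'n::finite"
  assumes m: "m > 0" and p: "p \<ge> 1" and k: "k \<ge> 1"
  shows "in_Lp (test_fun m s R k i) (mu a m) p"
    and "c > 0 \<Longrightarrow> s = a / p - c \<Longrightarrow> Lp_norm (test_fun m s R k i) (mu a m) p
       \<le> ((c * p) powr (- (real k * p + 2 * CARD('n)) / (2 * m)) * radial_const m (real k * p) (axis i 1 :: complex ^ 'n)) powr (1 / p)"
proof -
  have kp: "real k * p > 0" using k p by simp
  have fm: "test_fun m s R k i \<in> borel_measurable (mu a m)"
    using borel_imp_lebesgue[OF test_fun_measurable] by (simp add: measurable_cong_sets[OF sets_mu refl])
  have nn: "(\<integral>\<^sup>+y. ennreal (norm (test_fun m s R k i y) powr p) \<partial>mu a m)
     = (\<integral>\<^sup>+y. ennreal (norm (y $ i) powr (real k * p) * (exp ((s * p - a) * norm y powr (2 * m)) * (if norm y \<le> R then 1 else 0))) \<partial>(lborel :: (complex ^ 'n) measure))"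
  proof -
    have "(\<integral>\<^sup>+y. ennreal (norm (test_fun m s R k i y) powr p) \<partial>mu a m)
      = (\<integral>\<^sup>+y. ennreal (exp (- a * norm y powr (2 * m))) * ennreal (norm (test_fun m s R k i y) powr p) \<partial>lebesgue)"
      by (rule nn_integral_mu) (auto intro!: borel_imp_lebesgue)
    also have "\<dots> = (\<integral>\<^sup>+y. ennreal (exp (- a * norm y powr (2 * m))) * ennreal (norm (test_fun m s R k i y) powr p) \<partial>lborel)"
      by (rule nn_integral_completion)
    also have "\<dots> = (\<integral>\<^sup>+y. ennreal (norm (y $ i) powr (real k * p) * (exp ((s * p - a) * norm y powr (2 * m)) * (if norm y \<le> R then 1 else 0))) \<partial>(lborel :: (complex ^ 'n) measure))"
    proof (rule nn_integral_cong)
      fix y :: "complex ^ 'n"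
      have "norm (test_fun m s R k i y) = exp (s * norm y powr (2 * m)) * (if norm y \<le> R then 1 else 0) * norm (y $ i) ^ k"
        by (simp add: test_fun_def norm_mult norm_power)
      then have "norm (test_fun m s R k i y) powr p = exp (s * norm y powr (2 * m) * p) * (if norm y \<le> R then 1 else 0) * norm (y $ i) powr (real k * p)"
        using k by (simp add: powr_mult exp_powr_real power_powr_mult)
      moreover have "exp ((s * p - a) * norm y powr (2 * m)) = exp (- a * norm y powr (2 * m)) * exp (s * norm y powr (2 * m) * p)"
        by (simp add: exp_add[symmetric] algebra_simps)
      ultimately show "ennreal (exp (- a * norm y powr (2 * m))) * ennreal (norm (test_fun m s R k i y) powr p)
        = ennreal (norm (y $ i) powr (real k * p) * (exp ((s * p - a) * norm y powr (2 * m)) * (if norm y \<le> R then 1 else 0)))"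
        by (simp add: ennreal_mult[symmetric] mult_ac)
    qed
    finally show ?thesis .
  qed
  \<comment> \<open>An integer above k p: |y|^(k p) <= 1 + |y|^N reduces the real exponent to the
    integer powers known to be integrable.\<close>
  define N where "N = nat \<lceil>real k * p\<rceil>"
  have fin: "(\<integral>\<^sup>+y. ennreal (norm (test_fun m s R k i y) powr p) \<partial>mu a m) < \<infinity>"
  proof -
    let ?F = "\<lambda>j. \<lambda>y :: complex ^ 'n. norm y ^ j * (exp ((s * p - a) * norm y powr (2 * m)) * (if norm y \<le> R then 1 else 0))"
    have le: "norm (y $ i) powr (real k * p) \<le> 1 + norm y ^ N" for y :: "complex ^ 'n"
    proof -
      have "norm (y $ i) powr (real k * p) \<le> norm y powr (real k * p)"
        using kp by (intro powr_mono2 Finite_Cartesian_Product.norm_nth_le) auto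
      also have "\<dots> \<le> 1 + norm y ^ N"
      proof (cases "norm y \<le> 1")
        case True
        then have "norm y powr (real k * p) \<le> 1" using kp by (intro powr_le1) auto
        then show ?thesis by (simp add: add_increasing2)
      next
        case False
        then have "norm y powr (real k * p) \<le> norm y powr (real N)"
          by (intro powr_mono) (auto simp: N_def real_nat_ceiling_ge)
        also have "\<dots> = norm y ^ N" using False by (intro powr_realpow) auto
        finally show ?thesis by simp
      qed
      finally show ?thesis .
    qed
    have "integrable lborel (\<lambda>y :: complex ^ 'n. ?F 0 y + ?F N y)"
      by (intro Bochner_Integration.integrable_add integrable_radial_truncated m)
    then have "(\<integral>\<^sup>+y. ennreal (norm (?F 0 y + ?F N y)) \<partial>(lborel :: (complex ^ 'n) measure)) < \<infinity>"
      unfolding integrable_iff_bounded by blast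
    moreover have "(\<integral>\<^sup>+y. ennreal (norm (test_fun m s R k i y) powr p) \<partial>mu a m)
      \<le> (\<integral>\<^sup>+y. ennreal (norm (?F 0 y + ?F N y)) \<partial>(lborel :: (complex ^ 'n) measure))"
      unfolding nn
    proof (intro nn_integral_mono ennreal_leI)
      fix y :: "complex ^ 'n"
      have "norm (y $ i) powr (real k * p) * (exp ((s * p - a) * norm y powr (2 * m)) * (if norm y \<le> R then 1 else 0))
        \<le> (1 + norm y ^ N) * (exp ((s * p - a) * norm y powr (2 * m)) * (if norm y \<le> R then 1 else 0))"
        by (intro mult_right_mono le) auto
      also have "\<dots> = ?F 0 y + ?F N y" by (simp add: distrib_right)
      finally show "norm (y $ i) powr (real k * p) * (exp ((s * p - a) * norm y powr (2 * m)) * (if norm y \<le> R then 1 else 0))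
        \<le> norm (?F 0 y + ?F N y)" by simp
    qed
    ultimately show ?thesis by (rule le_less_trans[rotated])
  qed
  show "in_Lp (test_fun m s R k i) (mu a m) p"
    unfolding in_Lp_def
  proof (intro conjI fm integrableI_nonneg)
    show "(\<integral>\<^sup>+y. ennreal (norm (test_fun m s R k i y) powr p) \<partial>mu a m) < \<infinity>" by (rule fin)
  qed (use fm in auto)
  assume c: "c > 0" and s: "s = a / p - c"
  let ?P = "(c * p) powr (- (real k * p + 2 * CARD('n)) / (2 * m)) * radial_const m (real k * p) (axis i 1 :: complex ^ 'n)"
  have cp: "c * p > 0" using c p by simp
  have P0: "?P \<ge> 0"
    unfolding radial_const_def using kp m by (intro mult_nonneg_nonneg less_imp_le[OF Gamma_real_pos] add_nonneg_pos) auto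
  have e: "s * p - a = - (c * p)" using s p by (simp add: field_simps)
  have "(\<integral>\<^sup>+y. ennreal (norm (test_fun m s R k i y) powr p) \<partial>mu a m)
     \<le> (\<integral>\<^sup>+y. ennreal (norm (cinner (axis i 1) y) powr (real k * p) * exp (- (c * p) * norm y powr (2 * m))) \<partial>(lborel :: (complex ^ 'n) measure))"
    unfolding nn e norm_cinner_axis by (intro nn_integral_mono ennreal_leI mult_left_mono) auto
  also have "\<dots> = ennreal ?P" by (rule nn_integral_radial_const[OF kp cp m])
  finally have le: "(\<integral>\<^sup>+y. ennreal (norm (test_fun m s R k i y) powr p) \<partial>mu a m) \<le> ennreal ?P" .
  have "(\<integral>y. norm (test_fun m s R k i y) powr p \<partial>mu a m) \<le> ?P"
  proof -
    have "(\<integral>y. norm (test_fun m s R k i y) powr p \<partial>mu a m) = enn2real (\<integral>\<^sup>+y. ennreal (norm (test_fun m s R k i y) powr p) \<partial>mu a m)"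
      using fm by (intro integral_eq_nn_integral) auto
    also have "\<dots> \<le> enn2real (ennreal ?P)" by (intro enn2real_mono le) simp
    finally show ?thesis using P0 by simp
  qed
  then show "Lp_norm (test_fun m s R k i) (mu a m) p \<le> ?P powr (1 / p)"
    unfolding Lp_norm_def using p by (intro powr_mono2) auto
qed

text \<open>The reproducing property on monomials: the k-th coefficient is, up to a constant, the
  inverse squared norm of y_i^k. Thus the coefficients drop out of the test inequality, and no
  asymptotics for them are needed there.\<close>

lemma kcoef_radial_const:
  fixes x :: "complex ^ 'n::finite"
  assumes m: "m > 0" and k: "k \<ge> 1" and x: "norm x = 1"
  shows "kcoef m CARD('n) k * radial_const m (real (2 * k)) x = gauss_mass TYPE('n) / m"
proof -
  let ?n = "CARD('n)"
  have "ball_moment (real (2 * k)) x = (\<integral>\<^sup>+y. ennreal (norm (cinner x y) ^ (2 * k)) * indicator (cball 0 1) y \<partial>lborel)"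
    unfolding ball_moment_def
  proof (intro nn_integral_cong)
    fix y
    have "norm (cinner x y) powr real (2 * k) = norm (cinner x y) ^ (2 * k)"
    proof (cases "cinner x y = 0")
      case False
      then show ?thesis by (intro powr_realpow) simp
    qed (use k in \<open>simp add: zero_power\<close>)
    then show "ennreal (norm (cinner x y) powr real (2 * k)) * indicator (cball 0 1) y
      = ennreal (norm (cinner x y) ^ (2 * k)) * indicator (cball 0 1) y" by (simp only:)
  qed
  also have "\<dots> = ennreal (gauss_mass TYPE('n) * fact k / fact (k + ?n))"
    unfolding ball_power_moment_even x by simp
  finally have bm: "enn2real (ball_moment (real (2 * k)) x) = gauss_mass TYPE('n) * fact k / fact (k + ?n)"
    using gauss_mass_pos[where 'n = 'n] by simp
  define v where "v = real (?n + k) / m"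
  have nk: "real (?n + k) > 0" using k by simp
  have v: "v > 0" unfolding v_def using nk m by (rule divide_pos_pos)
  have arg: "(real (2 * k) + 2 * ?n) / (2 * m) + 1 = v + 1" using m by (simp add: v_def field_simps)
  have G1: "Gamma (v + 1) = v * Gamma v" using v by (intro Gamma_plus1) auto
  have G2: "real (?n + k) * Gamma (real (?n + k)) = fact (k + ?n)"
  proof -
    have "Gamma (real (?n + k) + 1) = real (?n + k) * Gamma (real (?n + k))"
      using nk by (intro Gamma_plus1) auto
    moreover have "Gamma (real (?n + k) + 1) = fact (k + ?n)"
      using Gamma_fact[of "k + ?n", where ?'a = real] by (simp add: add_ac)
    ultimately show ?thesis by simp
  qed
  have Gv: "Gamma v \<noteq> 0" using Gamma_real_pos[OF v] by linarith
  have "kcoef m ?n k * radial_const m (real (2 * k)) x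
      = Gamma (real (?n + k)) / (fact k * Gamma v) * (gauss_mass TYPE('n) * fact k / fact (k + ?n) * (v * Gamma v))"
    unfolding kcoef_def v_def[symmetric] radial_const_def bm arg G1 ..
  also have "\<dots> = Gamma (real (?n + k)) * gauss_mass TYPE('n) * v / fact (k + ?n)"
    using Gv by simp
  also have "\<dots> = (real (?n + k) * Gamma (real (?n + k))) * gauss_mass TYPE('n) / (m * fact (k + ?n))"
    unfolding v_def by simp
  also have "\<dots> = gauss_mass TYPE('n) / m" unfolding G2 by simp
  finally show ?thesis .
qed

lemma radial_const_pos:
  fixes x :: "complex ^ 'n::finite"
  assumes "m > 0" "j > 0" "norm x = 1"
  shows "radial_const m j x > 0"
proof -
  obtain C where C: "C > 0" "\<And>(x :: complex ^ 'n) j'. norm x = 1 \<Longrightarrow> j' \<ge> j \<Longrightarrow>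
       radial_const m j' x \<le> C * ((j' / (2 * m)) powr (j' / (2 * m) + (CARD('n) / m - CARD('n) + 1/2)) * exp (- (j' / (2 * m))))"
    "\<And>(x :: complex ^ 'n) j'. norm x = 1 \<Longrightarrow> j' \<ge> j \<Longrightarrow>
       (j' / (2 * m)) powr (j' / (2 * m) + (CARD('n) / m - CARD('n) + 1/2)) * exp (- (j' / (2 * m))) \<le> C * radial_const m j' x"
    by (rule radial_const_asymp[OF assms(1,2), where 'n = 'n]) blast
  have "0 < (j / (2 * m)) powr (j / (2 * m) + (CARD('n) / m - CARD('n) + 1/2)) * exp (- (j / (2 * m)))"
    using assms by simp
  also have "\<dots> \<le> C * radial_const m j x" by (rule C(3)[OF assms(3) order_refl])
  finally show ?thesis using C(1) by (simp add: zero_less_mult_iff)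
qed

text \<open>The projection of a test function is a multiple of x_i^k, so both norms are explicit
  moments. What matters is that the constant is the same for all k and c.\<close>

lemma proj_bounded_imp_test_inequality:
  fixes a b g p q m :: real
  assumes b: "b > 0" and g: "g > 0" and p: "1 \<le> p" and q: "1 \<le> q" and m: "0 < m" "m \<le> 1"
    and bounded: "proj_bounded b m a p g q TYPE('n::finite)"
  obtains C where "C \<ge> 0"
    "\<And>(k :: nat) (c :: real) (i :: 'n). k \<ge> 1 \<Longrightarrow> c > 0 \<Longrightarrow> b - a / p + c > 0 \<Longrightarrow>
      kconst b m CARD('n) * gauss_mass TYPE('n) / m * (b powr (1 / m)) ^ k * (b - a / p + c) powr (- (real k + CARD('n)) / m)
        * (g powr (- (real k * q + 2 * CARD('n)) / (2 * m)) * radial_const m (real k * q) (axis i 1 :: complex ^ 'n)) powr (1 / q)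
      \<le> C * ((c * p) powr (- (real k * p + 2 * CARD('n)) / (2 * m)) * radial_const m (real k * p) (axis i 1 :: complex ^ 'n)) powr (1 / p)"
proof -
  let ?n = "CARD('n)"
  obtain C where C: "\<And>f :: complex ^ 'n \<Rightarrow> complex. in_Lp f (mu b m) 2 \<Longrightarrow> in_Lp f (mu a m) p \<Longrightarrow>
      Lp_norm (proj b m f) (mu g m) q \<le> C * Lp_norm f (mu a m) p"
    using bounded unfolding proj_bounded_def by blast
  show ?thesis
  proof (rule that[of "\<bar>C\<bar>"])
    fix k :: nat and c :: real and i :: 'n
    assume k: "k \<ge> 1" and c: "c > 0" and Ac: "b - a / p + c > 0"
    define s where "s = a / p - c"
    define D where "D = b - a / p + c"
    have D: "D > 0" using Ac by (simp add: D_def)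
    have sb: "s - b = - D" by (simp add: s_def D_def)
    define e where "e = (axis i 1 :: complex ^ 'n)"
    have e: "norm e = 1" by (simp add: e_def norm_axis_1)
    define Q where "Q = g powr (- (real k * q + 2 * ?n) / (2 * m)) * radial_const m (real k * q) e"
    define P where "P = (c * p) powr (- (real k * p + 2 * ?n) / (2 * m)) * radial_const m (real k * p) e"
    have kq: "real k * q > 0" and kp: "real k * p > 0" using k p q by auto
    have Q: "Q > 0" unfolding Q_def using g radial_const_pos[OF m(1) kq e] by simp
    have P: "P > 0" unfolding P_def using c p radial_const_pos[OF m(1) kp e] by simp
    define K where "K = kconst b m ?n * kcoef m ?n k * (b powr (1 / m)) ^ k"
    have n: "?n \<ge> 1" by (simp add: Suc_le_eq)
    have K: "K > 0" unfolding K_def using kconst_pos[OF b m(1), of ?n] kcoef_pos[OF m(1) n, of k] b by simp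
    define I where "I R = (\<integral>y. (exp ((s - b) * norm y powr (2 * m)) * (if norm y \<le> R then 1 else 0)) * norm ((y :: complex ^ 'n) $ i) ^ (2 * k) \<partial>lborel)" for R
    have I0: "I R \<ge> 0" for R unfolding I_def by (intro Bochner_Integration.integral_nonneg) simp
    have bound: "K * I (real N) * Q powr (1 / q) \<le> \<bar>C\<bar> * P powr (1 / p)" for N :: nat
    proof -
      let ?f = "test_fun m s (real N) k i"
      have pf: "proj b m ?f x = complex_of_real (K * I (real N)) * x $ i ^ k" for x
        unfolding K_def I_def by (rule proj_test_fun[OF b m]) simp
      have npf: "norm (proj b m ?f x) powr q = (K * I (real N)) powr q * norm (cinner e x) powr (real k * q)" for x
        unfolding pf e_def norm_cinner_axis using K I0[of "real N"] k
        by (simp add: norm_mult norm_power powr_mult power_powr_mult abs_mult)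
      have "(\<integral>\<^sup>+x. ennreal (norm (proj b m ?f x) powr q) \<partial>mu g m)
        = (\<integral>\<^sup>+x. ennreal (exp (- g * norm x powr (2 * m))) * ennreal (norm (proj b m ?f x) powr q) \<partial>lebesgue)"
        unfolding npf by (rule nn_integral_mu, rule borel_imp_lebesgue) measurable
      also have "\<dots> = (\<integral>\<^sup>+x. ennreal (exp (- g * norm x powr (2 * m))) * ennreal (norm (proj b m ?f x) powr q) \<partial>lborel)"
        by (rule nn_integral_completion)
      also have "\<dots> = (\<integral>\<^sup>+x. ennreal ((K * I (real N)) powr q) * ennreal (norm (cinner e x) powr (real k * q) * exp (- g * norm x powr (2 * m))) \<partial>lborel)"
      proof (rule nn_integral_cong)
        fix x
        have "exp (- g * norm x powr (2 * m)) * ((K * I (real N)) powr q * norm (cinner e x) powr (real k * q))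
          = (K * I (real N)) powr q * (norm (cinner e x) powr (real k * q) * exp (- g * norm x powr (2 * m)))"
          by (simp only: mult_ac)
        then show "ennreal (exp (- g * norm x powr (2 * m))) * ennreal (norm (proj b m ?f x) powr q)
          = ennreal ((K * I (real N)) powr q) * ennreal (norm (cinner e x) powr (real k * q) * exp (- g * norm x powr (2 * m)))"
          unfolding npf by (subst (1 2) ennreal_mult[symmetric]) auto
      qed
      also have "\<dots> = ennreal ((K * I (real N)) powr q) * (\<integral>\<^sup>+x. ennreal (norm (cinner e x) powr (real k * q) * exp (- g * norm x powr (2 * m))) \<partial>lborel)"
        by (rule nn_integral_cmult) measurable
      also have "(\<integral>\<^sup>+x. ennreal (norm (cinner e x) powr (real k * q) * exp (- g * norm x powr (2 * m))) \<partial>lborel) = ennreal Q"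
        unfolding Q_def by (rule nn_integral_radial_const[OF kq g m(1)])
      also have "ennreal ((K * I (real N)) powr q) * ennreal Q = ennreal ((K * I (real N)) powr q * Q)"
        using Q by (intro ennreal_mult[symmetric]) auto
      finally have nnq: "(\<integral>\<^sup>+x. ennreal (norm (proj b m ?f x) powr q) \<partial>mu g m) = ennreal ((K * I (real N)) powr q * Q)" .
      have "(\<integral>x. norm (proj b m ?f x) powr q \<partial>mu g m) = enn2real (\<integral>\<^sup>+x. ennreal (norm (proj b m ?f x) powr q) \<partial>mu g m)"
      proof (rule integral_eq_nn_integral)
        have "(\<lambda>x. (K * I (real N)) powr q * norm (cinner e x) powr (real k * q)) \<in> borel_measurable lebesgue"
          by (intro borel_imp_lebesgue) measurable
        then show "(\<lambda>x. norm (proj b m ?f x) powr q) \<in> borel_measurable (mu g m)"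
          unfolding npf measurable_cong_sets[OF sets_mu refl] .
      qed simp
      also have "\<dots> = (K * I (real N)) powr q * Q"
        unfolding nnq using Q by (intro enn2real_ennreal mult_nonneg_nonneg) auto
      finally have "(\<integral>x. norm (proj b m ?f x) powr q \<partial>mu g m) = (K * I (real N)) powr q * Q" .
      then have "Lp_norm (proj b m ?f) (mu g m) q = ((K * I (real N)) powr q * Q) powr (1 / q)"
        unfolding Lp_norm_def by (rule arg_cong)
      also have "\<dots> = ((K * I (real N)) powr q) powr (1 / q) * Q powr (1 / q)" by (rule powr_mult)
      also have "((K * I (real N)) powr q) powr (1 / q) = K * I (real N)"
      proof -
        have "0 \<le> K * I (real N)" using K I0[of "real N"] by simp
        then show ?thesis using q by (simp add: powr_powr)
      qed
      finally have lhs: "Lp_norm (proj b m ?f) (mu g m) q = K * I (real N) * Q powr (1 / q)" .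
      have "Lp_norm (proj b m ?f) (mu g m) q \<le> C * Lp_norm ?f (mu a m) p"
        using p k by (intro C in_Lp_test_fun m) auto
      also have "\<dots> \<le> \<bar>C\<bar> * Lp_norm ?f (mu a m) p"
        by (intro mult_right_mono) (auto simp: Lp_norm_def)
      also have "\<dots> \<le> \<bar>C\<bar> * P powr (1 / p)"
        unfolding P_def e_def by (intro mult_left_mono in_Lp_test_fun(2)[OF m(1) p k c s_def]) simp
      finally show ?thesis unfolding lhs .
    qed
    \<comment> \<open>The operator bound, solved for the integral over the ball of radius N; the
      bound is independent of N.\<close>
    define M where "M = \<bar>C\<bar> * P powr (1 / p) / (K * Q powr (1 / q))"
    have KQ: "K * Q powr (1 / q) > 0" using K Q by simp
    have IM: "I (real N) \<le> M" for N
      unfolding M_def using bound[of N] KQ by (simp add: pos_le_divide_eq mult_ac)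
    define J where "J N y = ennreal ((exp ((s - b) * norm y powr (2 * m)) * (if norm y \<le> real N then 1 else 0)) * norm (y $ i) ^ (2 * k))"
      for N :: nat and y :: "complex ^ 'n"
    have JI: "(\<integral>\<^sup>+y. J N y \<partial>lborel) = ennreal (I (real N))" for N
      unfolding J_def I_def
    proof (rule nn_integral_eq_integral)
      show "integrable lborel (\<lambda>y :: complex ^ 'n. exp ((s - b) * norm y powr (2 * m)) * (if norm y \<le> real N then 1 else 0) * norm (y $ i) ^ (2 * k))"
      proof (rule Bochner_Integration.integrable_bound[OF integrable_radial_truncated[OF m(1), of "2 * k" "s - b" "real N"]])
        show "AE y :: complex ^ 'n in lborel. norm (exp ((s - b) * norm y powr (2 * m)) * (if norm y \<le> real N then 1 else 0) * norm (y $ i) ^ (2 * k))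
          \<le> norm (norm y ^ (2 * k) * (exp ((s - b) * norm y powr (2 * m)) * (if norm y \<le> real N then 1 else 0)))"
          by (intro always_eventually allI) (auto intro!: power_mono Finite_Cartesian_Product.norm_nth_le)
      qed measurable
    qed simp
    have "ennreal (D powr (- (real (2 * k) + 2 * ?n) / (2 * m)) * radial_const m (real (2 * k)) e)
       = (\<integral>\<^sup>+y. ennreal (norm (cinner e y) powr (real (2 * k)) * exp (- D * norm y powr (2 * m))) \<partial>lborel)"
      using k by (intro nn_integral_radial_const[symmetric] D m) simp
    \<comment> \<open>The integral without cut-off is the supremum of the truncated ones; the
      supremum is attained pointwise as soon as N >= |y|.\<close>
    also have "\<dots> = (\<integral>\<^sup>+y. (SUP N. J N y) \<partial>lborel)"
    proof (rule nn_integral_cong)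
      fix y :: "complex ^ 'n"
      let ?v = "ennreal (norm (cinner e y) powr (real (2 * k)) * exp (- D * norm y powr (2 * m)))"
      have v: "?v = ennreal (exp ((s - b) * norm y powr (2 * m)) * norm (y $ i) ^ (2 * k))"
        unfolding sb e_def norm_cinner_axis using k power_powr_mult[of "norm (y $ i)" "2 * k" 1]
        by (simp add: mult.commute)
      show "?v = (SUP N. J N y)"
      proof (rule antisym)
        obtain N :: nat where N: "norm y \<le> real N" using real_arch_simple by blast
        have "?v = J N y" unfolding v J_def using N by simp
        also have "\<dots> \<le> (SUP N. J N y)" by (rule SUP_upper) simp
        finally show "?v \<le> (SUP N. J N y)" .
        show "(SUP N. J N y) \<le> ?v"
          unfolding v J_def by (intro SUP_least ennreal_leI mult_right_mono) auto
      qed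
    qed
    also have "\<dots> = (SUP N. \<integral>\<^sup>+y. J N y \<partial>lborel)"
    proof (rule nn_integral_monotone_convergence_SUP)
      show "incseq J"
        unfolding incseq_def le_fun_def J_def by (intro allI impI ennreal_leI mult_right_mono mult_left_mono) auto
      show "J N \<in> borel_measurable lborel" for N unfolding J_def by simp
    qed
    also have "\<dots> \<le> ennreal M"
      unfolding JI by (intro SUP_least ennreal_leI IM)
    finally have "D powr (- (real (2 * k) + 2 * ?n) / (2 * m)) * radial_const m (real (2 * k)) e \<le> M"
      using order_trans[OF I0[of "real 0"] IM[of 0]] by (subst (asm) ennreal_le_iff) auto
    then have "K * Q powr (1 / q) * (D powr (- (real (2 * k) + 2 * ?n) / (2 * m)) * radial_const m (real (2 * k)) e) \<le> \<bar>C\<bar> * P powr (1 / p)"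
      unfolding M_def using KQ by (simp add: pos_le_divide_eq mult_ac)
    moreover have "- (real (2 * k) + 2 * ?n) / (2 * m) = - (real k + ?n) / m"
      using m by (simp add: field_simps)
    moreover have "K * Q powr (1 / q) * (D powr r * radial_const m (real (2 * k)) e)
      = kconst b m ?n * gauss_mass TYPE('n) / m * (b powr (1 / m)) ^ k * D powr r * Q powr (1 / q)" for r
    proof -
      have "K * Q powr (1 / q) * (D powr r * radial_const m (real (2 * k)) e)
        = kconst b m ?n * (b powr (1 / m)) ^ k * D powr r * Q powr (1 / q) * (kcoef m ?n k * radial_const m (real (2 * k)) e)"
        unfolding K_def by (simp only: mult_ac)
      then show ?thesis unfolding kcoef_radial_const[OF m(1) k e] by simp
    qed
    ultimately have "kconst b m ?n * gauss_mass TYPE('n) / m * (b powr (1 / m)) ^ k * D powr (- (real k + ?n) / m) * Q powr (1 / q)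
      \<le> \<bar>C\<bar> * P powr (1 / p)"
      by (simp only:)
    then show "kconst b m CARD('n) * gauss_mass TYPE('n) / m * (b powr (1 / m)) ^ k * (b - a / p + c) powr (- (real k + CARD('n)) / m)
        * (g powr (- (real k * q + 2 * CARD('n)) / (2 * m)) * radial_const m (real k * q) (axis i 1 :: complex ^ 'n)) powr (1 / q)
      \<le> \<bar>C\<bar> * ((c * p) powr (- (real k * p + 2 * CARD('n)) / (2 * m)) * radial_const m (real k * p) (axis i 1 :: complex ^ 'n)) powr (1 / p)"
      unfolding D_def Q_def P_def e_def .
  qed simp
qed

text \<open>Stirling's formula turns the inequality for the test functions into one between a linear and
  a logarithmic term in \<open>w = k / (2 * m)\<close>.\<close>

lemma proj_bounded_imp_growth:
  fixes a b g p q m c :: real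
  assumes b: "b > 0" and g: "g > 0" and p: "1 \<le> p" and q: "1 \<le> q" and m: "0 < m" "m \<le> 1"
    and bounded: "proj_bounded b m a p g q TYPE('n::finite)"
    and c: "c > 0" and D: "b - a / p + c > 0"
  obtains B where "\<And>k :: nat. k \<ge> 1 \<Longrightarrow>
      (real k / (2 * m)) * ln (b\<^sup>2 * c * q / ((b - a / p + c)\<^sup>2 * g))
      + (CARD('n) / m - CARD('n) + 1/2) * (1 / q - 1 / p) * ln (real k / (2 * m)) \<le> B"
proof -
  let ?n = "real CARD('n)"
  define D where "D = b - a / p + c"
  have Dp: "D > 0" using assms by (simp add: D_def)
  define e where "e = (axis (undefined :: 'n) 1 :: complex ^ 'n)"
  have e: "norm e = 1" by (simp add: e_def norm_axis_1)
  define E where "E = ?n / m - ?n + 1/2"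
  define S where "S j = (j / (2 * m)) powr (j / (2 * m) + E) * exp (- (j / (2 * m)))" for j
  obtain C1 where C1: "C1 > 0" "\<And>(x :: complex ^ 'n) j. norm x = 1 \<Longrightarrow> j \<ge> 1 \<Longrightarrow> radial_const m j x \<le> C1 * S j"
    "\<And>(x :: complex ^ 'n) j. norm x = 1 \<Longrightarrow> j \<ge> 1 \<Longrightarrow> S j \<le> C1 * radial_const m j x"
    unfolding S_def E_def by (rule radial_const_asymp[OF m(1) zero_less_one, where 'n = 'n]) blast
  obtain C2 where C2: "C2 \<ge> 0"
    "\<And>(k :: nat) (c :: real) (i :: 'n). k \<ge> 1 \<Longrightarrow> c > 0 \<Longrightarrow> b - a / p + c > 0 \<Longrightarrow>
      kconst b m CARD('n) * gauss_mass TYPE('n) / m * (b powr (1 / m)) ^ k * (b - a / p + c) powr (- (real k + CARD('n)) / m)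
        * (g powr (- (real k * q + 2 * CARD('n)) / (2 * m)) * radial_const m (real k * q) (axis i 1 :: complex ^ 'n)) powr (1 / q)
      \<le> C2 * ((c * p) powr (- (real k * p + 2 * CARD('n)) / (2 * m)) * radial_const m (real k * p) (axis i 1 :: complex ^ 'n)) powr (1 / p)"
    by (rule proj_bounded_imp_test_inequality[OF b g p q m bounded]) blast
  define K where "K = kconst b m CARD('n) * gauss_mass TYPE('n) / m"
  have K: "K > 0" unfolding K_def using kconst_pos[OF b m(1), of "CARD('n)"] gauss_mass_pos[where 'n = 'n] m by simp
  \<comment> \<open>Everything in the logarithm of the test inequality that does not depend on
    k.\<close>
  define B where "B = ln C2 + (1 / p) * ln C1 - (?n / (m * p)) * ln (c * p) - ln K + (?n / m) * ln D + (1 / q) * ln C1 + (?n / (m * q)) * ln g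
      + (E / p) * ln p - (E / q) * ln q"
  show ?thesis
  proof (rule that[of B])
    fix k :: nat assume k: "k \<ge> 1"
    define w where "w = real k / (2 * m)"
    have w: "w > 0" using k m by (simp add: w_def)
    have lnS: "S j > 0 \<and> ln (S j) = (j / (2 * m) + E) * ln (j / (2 * m)) - j / (2 * m)" if "j > 0" for j
      using that m by (simp add: S_def ln_mult_pos ln_powr)
    have kq: "real k * q \<ge> 1" and kp: "real k * p \<ge> 1"
    proof -
      have k1: "real k \<ge> 1" using k by simp
      show "real k * q \<ge> 1" using mult_mono[OF k1 q] by simp
      show "real k * p \<ge> 1" using mult_mono[OF k1 p] by simp
    qed
    define rq where "rq = radial_const m (real k * q) e"
    define rp where "rp = radial_const m (real k * p) e"
    have rq: "rq > 0" unfolding rq_def using kq by (intro radial_const_pos e m) simp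
    have rp: "rp > 0" unfolding rp_def using kp by (intro radial_const_pos e m) simp
    have sq: "ln (S (real k * q)) \<le> ln C1 + ln rq"
    proof -
      have "S (real k * q) \<le> C1 * rq" unfolding rq_def by (rule C1(3)[OF e kq])
      moreover have "0 < S (real k * q)" using lnS[of "real k * q"] kq by linarith
      moreover have "0 < C1 * rq" using C1(1) rq by simp
      ultimately have "ln (S (real k * q)) \<le> ln (C1 * rq)" by (simp only: ln_le_cancel_iff)
      then show ?thesis using C1(1) rq by (simp add: ln_mult_pos)
    qed
    have sp: "ln rp \<le> ln C1 + ln (S (real k * p))"
    proof -
      have "rp \<le> C1 * S (real k * p)" unfolding rp_def by (rule C1(2)[OF e kp])
      moreover have S: "0 < S (real k * p)" using lnS[of "real k * p"] kp by linarith
      moreover from S have "0 < C1 * S (real k * p)" using C1(1) by simp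
      ultimately have "ln rp \<le> ln (C1 * S (real k * p))" using rp by (simp only: ln_le_cancel_iff)
      then show ?thesis using C1(1) S by (simp add: ln_mult_pos)
    qed
    have wq: "real k * q / (2 * m) = w * q" and wp: "real k * p / (2 * m) = w * p" by (simp_all add: w_def)
    have main: "K * (b powr (1 / m)) ^ k * D powr (- (real k + ?n) / m) * (g powr (- (real k * q + 2 * ?n) / (2 * m)) * rq) powr (1 / q)
      \<le> C2 * ((c * p) powr (- (real k * p + 2 * ?n) / (2 * m)) * rp) powr (1 / p)" (is "?L \<le> C2 * ?R")
      using C2(2)[OF k c D, of undefined] unfolding K_def D_def rq_def rp_def e_def by simp
    have posL: "K * (b powr (1 / m)) ^ k * D powr (- (real k + ?n) / m) * (g powr (- (real k * q + 2 * ?n) / (2 * m)) * rq) powr (1 / q) > 0"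
      using K b Dp g rq by simp
    have posR: "((c * p) powr (- (real k * p + 2 * ?n) / (2 * m)) * rp) powr (1 / p) > 0"
      using c p rp by simp
    \<comment> \<open>Positivity is forced by the positive left side; it is needed to take
      logarithms.\<close>
    have C2p: "C2 > 0"
    proof (rule ccontr)
      assume "\<not> C2 > 0"
      then have "C2 = 0" using C2(1) by simp
      then show False using main posL by simp
    qed
    have "ln ?L \<le> ln (C2 * ?R)" using main posL mult_pos_pos[OF C2p posR] by (simp only: ln_le_cancel_iff)
    moreover have "ln ?L = ln K + (real k / m) * ln b + (- (real k + ?n) / m) * ln D
      + (1 / q) * ((- (real k * q + 2 * ?n) / (2 * m)) * ln g + ln rq)"
    proof -
      have l4: "ln (x1 * x2 * x3 * x4) = ln x1 + ln x2 + ln x3 + ln x4"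
        if "x1 > 0" "x2 > 0" "x3 > 0" "x4 > 0" for x1 x2 x3 x4 :: real
        using that by (simp add: ln_mult_pos)
      have "(b powr (1 / m)) ^ k = b powr (real k / m)"
        using b by (simp add: powr_realpow[symmetric] powr_powr)
      moreover have "ln (g powr z * rq) = z * ln g + ln rq" for z
        using g rq by (simp add: ln_mult_pos ln_powr)
      ultimately show ?thesis
        using K b Dp g rq by (subst l4) (simp_all only: ln_powr, simp_all)
    qed
    moreover have "ln (C2 * ?R) = ln C2 + (1 / p) * ((- (real k * p + 2 * ?n) / (2 * m)) * ln (c * p) + ln rp)"
    proof -
      have "ln ((c * p) powr z * rp) = z * ln (c * p) + ln rp" for z
        using c p rp by (simp add: ln_mult_pos ln_powr)
      then show ?thesis using ln_mult_pos[OF C2p posR] by (simp only: ln_powr)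
    qed
    moreover have "real k / m = 2 * w" "- (real k + ?n) / m = - (2 * w + ?n / m)"
      "- (real k * q + 2 * ?n) / (2 * m) = - (w * q + ?n / m)" "- (real k * p + 2 * ?n) / (2 * m) = - (w * p + ?n / m)"
      using m by (simp_all add: w_def field_simps)
    ultimately have "ln K + (2 * w) * ln b + (- (2 * w + ?n / m)) * ln D + (1 / q) * (- (w * q + ?n / m) * ln g + ln rq)
      \<le> ln C2 + (1 / p) * (- (w * p + ?n / m) * ln (c * p) + ln rp)"
      by (simp only:)
    then have ineq: "ln K + 2 * w * ln b - (2 * w + ?n / m) * ln D + (1 / q) * (- (w * q + ?n / m) * ln g + ln rq)
      \<le> ln C2 + (1 / p) * (- (w * p + ?n / m) * ln (c * p) + ln rp)"
      by linarith
    have lq: "(1 / q) * ((w * q + E) * ln (w * q) - w * q) - (1 / q) * ln C1 \<le> (1 / q) * ln rq"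
    proof -
      have "(w * q + E) * ln (w * q) - w * q - ln C1 \<le> ln rq"
        using sq lnS[of "real k * q"] kq unfolding wq by simp
      then have "(1 / q) * ((w * q + E) * ln (w * q) - w * q - ln C1) \<le> (1 / q) * ln rq"
        using q by (intro mult_left_mono) auto
      then show ?thesis by (simp only: right_diff_distrib)
    qed
    have lp: "(1 / p) * ln rp \<le> (1 / p) * ((w * p + E) * ln (w * p) - w * p) + (1 / p) * ln C1"
    proof -
      have "ln rp \<le> (w * p + E) * ln (w * p) - w * p + ln C1"
        using sp lnS[of "real k * p"] kp unfolding wp by simp
      then have "(1 / p) * ln rp \<le> (1 / p) * ((w * p + E) * ln (w * p) - w * p + ln C1)"
        using p by (intro mult_left_mono) auto
      then show ?thesis by (simp only: distrib_left)
    qed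
    \<comment> \<open>The leading parts w ln w and - w do not depend on r, so they cancel between r
      = q and r = p. What remains is linear in w plus E / r times ln w.\<close>
    have expand: "(1 / r) * ((w * r + E) * ln (w * r) - w * r) = w * (ln w + ln r) + (E / r) * (ln w + ln r) - w" if "r \<ge> 1" for r
    proof -
      have "ln (w * r) = ln w + ln r" using w that by (simp add: ln_mult_pos)
      then show ?thesis using that by (simp add: field_simps)
    qed
    have expand2: "(1 / r) * (- (w * r + ?n / m) * y + z) = - w * y - (?n / (m * r)) * y + (1 / r) * z" if "r \<ge> 1" for r y z
      using that m by (simp add: field_simps)
    have rho: "ln (b\<^sup>2 * c * q / (D\<^sup>2 * g)) = 2 * ln b + ln c + ln q - 2 * ln D - ln g"
      using b c q Dp g by (simp add: ln_div ln_mult_pos ln_realpow)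
    have cp: "ln (c * p) = ln c + ln p" using c p by (simp add: ln_mult_pos)
    have "ln K + 2 * w * ln b - (2 * w + ?n / m) * ln D - w * ln g - (?n / (m * q)) * ln g
        + (w * (ln w + ln q) + (E / q) * (ln w + ln q) - w) - (1 / q) * ln C1
      \<le> ln C2 - w * ln (c * p) - (?n / (m * p)) * ln (c * p) + (w * (ln w + ln p) + (E / p) * (ln w + ln p) - w) + (1 / p) * ln C1"
      using ineq lq lp unfolding expand2[OF q] expand2[OF p] expand[OF q] expand[OF p] by linarith
    then have "w * (2 * ln b + ln c + ln q - 2 * ln D - ln g) + (E / q - E / p) * ln w \<le> B"
      unfolding B_def cp by (simp add: algebra_simps)
    moreover have "E / q - E / p = E * (1 / q - 1 / p)" by (simp add: right_diff_distrib)
    ultimately have "w * ln (b\<^sup>2 * c * q / (D\<^sup>2 * g)) + E * (1 / q - 1 / p) * ln w \<le> B"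
      unfolding rho by simp
    then show "(real k / (2 * m)) * ln (b\<^sup>2 * c * q / ((b - a / p + c)\<^sup>2 * g))
      + (CARD('n) / m - CARD('n) + 1/2) * (1 / q - 1 / p) * ln (real k / (2 * m)) \<le> B"
      unfolding w_def E_def D_def by simp
  qed
qed

text \<open>Division by w = k / (2m), which tends to infinity, decides the sign of r because ln w /
  w tends to 0. The logarithm becomes visible only when the linear term vanishes.\<close>

lemma linear_log_growth:
  fixes m r s B :: real
  assumes m: "m > 0" and le: "\<And>k :: nat. k \<ge> 1 \<Longrightarrow> (real k / (2 * m)) * r + s * ln (real k / (2 * m)) \<le> B"
  shows "r \<le> 0" and "r = 0 \<Longrightarrow> s \<le> 0"
proof -
  define w where "w k = real k / (2 * m)" for k :: nat
  have wtop: "filterlim w at_top sequentially"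
    unfolding w_def using m
    by (intro filterlim_tendsto_pos_mult_at_top[OF tendsto_const _ filterlim_real_sequentially, of "1 / (2 * m)", simplified mult.commute[of "1 / (2 * m)"] times_divide_eq_right mult_1_right]) auto
  have ev: "eventually (\<lambda>k :: nat. w k > 0 \<and> k \<ge> 1) sequentially"
    by (rule eventually_mono[OF eventually_ge_at_top[of "1 :: nat"]]) (use m in \<open>auto simp: w_def\<close>)
  have lnw: "((\<lambda>k. ln (w k) / w k) \<longlongrightarrow> 0) sequentially"
    by (rule filterlim_compose[OF ln_x_over_x_tendsto_0 wtop])
  have iw: "((\<lambda>k. B / w k) \<longlongrightarrow> 0) sequentially"
    by (rule tendsto_divide_0[OF tendsto_const filterlim_at_top_imp_at_infinity[OF wtop]])
  have "((\<lambda>k. r + s * (ln (w k) / w k)) \<longlongrightarrow> r + s * 0) sequentially"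
    by (intro tendsto_intros lnw)
  moreover have "eventually (\<lambda>k. r + s * (ln (w k) / w k) \<le> B / w k) sequentially"
    using ev
  proof eventually_elim
    case (elim k)
    then have "(w k * r + s * ln (w k)) / w k \<le> B / w k"
      using le[of k] by (intro divide_right_mono) (auto simp: w_def)
    then show ?case using elim by (simp add: add_divide_distrib)
  qed
  ultimately have "r + s * 0 \<le> 0"
    by (intro tendsto_le[OF _ iw]) auto
  then show "r \<le> 0" by simp
  assume r: "r = 0"
  show "s \<le> 0"
  proof (rule ccontr)
    assume s: "\<not> s \<le> 0"
    have "filterlim (\<lambda>k. ln (w k)) at_top sequentially"
      by (rule filterlim_compose[OF ln_at_top wtop])
    then have "eventually (\<lambda>k. ln (w k) > B / s) sequentially"
      by (simp add: filterlim_at_top_dense)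
    then have "eventually (\<lambda>k :: nat. ln (w k) > B / s \<and> k \<ge> 1) sequentially"
      using eventually_ge_at_top[of "1 :: nat"] by (rule eventually_conj)
    then obtain k where k: "ln (w k) > B / s" "k \<ge> 1"
      by (auto simp: eventually_sequentially)
    then have "s * ln (w k) > B" using s by (simp add: field_simps)
    then show False using le[OF k(2)] r by (simp add: w_def)
  qed
qed

theorem theorem1:
  fixes a b g p q m :: real
  assumes "b > 0" and "g > 0" and "1 \<le> p" and "1 \<le> q" and "0 < m" and "m \<le> 1"
  shows "proj_bounded b m a p g q TYPE('n::finite) \<longleftrightarrow>
           (q < qmax a b g p \<or> (q = qmax a b g p \<and> qmax a b g p \<ge> p))"
proof -
  note b = assms(1) and g = assms(2) and p = assms(3) and q = assms(4) and m = assms(5,6)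
  define A where "A = b - a / p"
  have qm: "qmax a b g p = 4 * g * A / b\<^sup>2" by (simp add: qmax_def A_def)
  have lt: "q < qmax a b g p \<longleftrightarrow> b\<^sup>2 < 4 * A * (g / q)"
    unfolding qm using b q by (simp add: pos_less_divide_eq mult_ac)
  have eq: "q = qmax a b g p \<longleftrightarrow> b\<^sup>2 = 4 * A * (g / q)"
  proof -
    have "q = qmax a b g p \<longleftrightarrow> q * b\<^sup>2 = 4 * g * A" unfolding qm using b by (simp add: eq_divide_eq)
    also have "\<dots> \<longleftrightarrow> b\<^sup>2 = 4 * A * (g / q)" using q by (auto simp: field_simps)
    finally show ?thesis .
  qed
  show ?thesis
  proof
    assume bounded: "proj_bounded b m a p g q TYPE('n)"
    define E where "E = CARD('n) / m - CARD('n) + 1/2"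
    \<comment> \<open>Here m <= 1 gives n / m >= n; positivity is what allows p <= q to be read off
      at the end.\<close>
    have E: "E > 0"
    proof -
      have "real CARD('n) * m \<le> real CARD('n) * 1" using m by (intro mult_left_mono) auto
      then have "real CARD('n) \<le> real CARD('n) / m" using m by (simp add: pos_le_divide_eq)
      then show ?thesis by (simp add: E_def)
    qed
    have growth: "ln (b\<^sup>2 * c * q / ((A + c)\<^sup>2 * g)) \<le> 0 \<and>
        (ln (b\<^sup>2 * c * q / ((A + c)\<^sup>2 * g)) = 0 \<longrightarrow> E * (1 / q - 1 / p) \<le> 0)" if c: "c > 0" "A + c > 0" for c
    proof -
      obtain B where B: "\<And>k :: nat. k \<ge> 1 \<Longrightarrow>
        (real k / (2 * m)) * ln (b\<^sup>2 * c * q / ((b - a / p + c)\<^sup>2 * g))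
        + (CARD('n) / m - CARD('n) + 1/2) * (1 / q - 1 / p) * ln (real k / (2 * m)) \<le> B"
        using proj_bounded_imp_growth[OF b g p q m bounded c(1)] c(2) unfolding A_def by blast
      show ?thesis
        using linear_log_growth[OF m(1), of "ln (b\<^sup>2 * c * q / ((b - a / p + c)\<^sup>2 * g))" "(CARD('n) / m - CARD('n) + 1/2) * (1 / q - 1 / p)" B] B
        unfolding A_def E_def by blast
    qed
    have rho_le: "b\<^sup>2 * c * q \<le> (A + c)\<^sup>2 * g" if c: "c > 0" "A + c > 0" for c
    proof -
      have pos: "b\<^sup>2 * c * q / ((A + c)\<^sup>2 * g) > 0" using b c q g by simp
      then have "b\<^sup>2 * c * q / ((A + c)\<^sup>2 * g) \<le> 1" using growth[OF c] by simp
      then show ?thesis using c g by (simp add: pos_divide_le_eq)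
    qed
    have A: "A > 0"
    proof (rule ccontr)
      assume "\<not> A > 0"
      then have A: "A \<le> 0" by simp
      \<comment> \<open>If A <= 0, the choice c = - A + \<epsilon> makes A + c = \<epsilon> small
        while c stays at least \<epsilon>. The bound then gives b^2 \<epsilon> q <= g \<epsilon>^2,
        and this value of \<epsilon> makes the right side half of the left.\<close>
      define \<epsilon> where "\<epsilon> = b\<^sup>2 * q / (2 * g)"
      have \<epsilon>: "\<epsilon> > 0" using b q g by (simp add: \<epsilon>_def)
      have "b\<^sup>2 * (- A + \<epsilon>) * q \<le> \<epsilon>\<^sup>2 * g" using rho_le[of "- A + \<epsilon>"] A \<epsilon> by simp
      moreover have "b\<^sup>2 * \<epsilon> * q \<le> b\<^sup>2 * (- A + \<epsilon>) * q"
        using A b q by (intro mult_right_mono mult_left_mono) auto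
      moreover have "\<epsilon>\<^sup>2 * g = b\<^sup>2 * \<epsilon> * q / 2" using g by (simp add: \<epsilon>_def power2_eq_square)
      moreover have "b\<^sup>2 * \<epsilon> * q > 0" using b \<epsilon> q by simp
      ultimately show False by linarith
    qed
    \<comment> \<open>The choice c = A maximizes c / (A + c)^2, with value 1 / (4 A).\<close>
    have "b\<^sup>2 * A * q \<le> (A + A)\<^sup>2 * g" by (rule rho_le) (use A in auto)
    then have "A * (b\<^sup>2 * q) \<le> A * (4 * A * g)" by (simp add: power2_eq_square algebra_simps)
    then have le: "b\<^sup>2 * q \<le> 4 * A * g" using A by (rule mult_left_le_imp_le)
    show "q < qmax a b g p \<or> (q = qmax a b g p \<and> qmax a b g p \<ge> p)"
    proof (cases "b\<^sup>2 * q = 4 * A * g")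
      case False
      then have "b\<^sup>2 < 4 * A * (g / q)" using le q by (simp add: pos_less_divide_eq)
      then show ?thesis using lt by simp
    next
      case True
      have eqq: "q = qmax a b g p" unfolding eq using True q by (simp add: eq_divide_eq)
      have "b\<^sup>2 * A * q = (A + A)\<^sup>2 * g"
      proof -
        have "b\<^sup>2 * A * q = A * (b\<^sup>2 * q)" by simp
        then show ?thesis unfolding True by (simp add: power2_eq_square algebra_simps)
      qed
      moreover have "(A + A)\<^sup>2 * g > 0" using A g by simp
      ultimately have "b\<^sup>2 * A * q / ((A + A)\<^sup>2 * g) = 1" using A g by simp
      \<comment> \<open>At c = A the quotient inside the logarithm is 1, so the linear term vanishes
        and boundedness of the logarithmic term decides.\<close>
      then have "E * (1 / q - 1 / p) \<le> 0" using growth[of A] A by simp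
      then have "1 / q \<le> 1 / p" using E by (simp add: mult_le_0_iff)
      then have "p \<le> q" using p q by (simp add: field_simps)
      then show ?thesis using eqq by simp
    qed
  next
    assume "q < qmax a b g p \<or> (q = qmax a b g p \<and> qmax a b g p \<ge> p)"
    then show "proj_bounded b m a p g q TYPE('n)"
    proof
      assume "q < qmax a b g p"
      then show ?thesis
        unfolding lt A_def by (intro proj_bounded_subcritical b g p q m)
    next
      assume h: "q = qmax a b g p \<and> qmax a b g p \<ge> p"
      then have "b\<^sup>2 = 4 * A * (g / q)" "p \<le> q" using eq by auto
      then show ?thesis
        unfolding A_def by (intro proj_bounded_critical b g p m)
    qed
  qed
qed

end
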